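(* For $\tau$ in the upper half plane and $q=e^{2\pi i\tau}$, let $$a_1(q):=\sum_{n_1,n_2\ge 0}\frac{q^{2n_1^2+6n_1n_2+6n_2^2}}{(q;q)_{n_1}(q^3;q^3)_{n_2}},\qquad a_2(q):=\sum_{n_1,n_2\ge 0}\frac{q^{2n_1^2+6n_1n_2+6n_2^2+n_1+3n_2}\,(1+q^{2n_1+3n_2+1})}{(q;q)_{n_1}(q^3;q^3)_{n_2}},$$ and let $X(\tau)=\big(q^{-1/24}a_1(q),\,q^{5/24}a_2(q)\big)^{\mathrm T}$. Then for all $\tau$ with $\mathrm{Im}\,\tau>0$, $$X(\tau+1)=\mathrm{diag}(\zeta_{24}^{-1},\zeta_{24}^{5})\,X(\tau),\qquad X\Big(-\frac1\tau\Big)=\frac{1}{\sqrt2}\begin{pmatrix}1&1\\1&-1\end{pmatrix}X\Big(\frac\tau3\Big).$$ As a consequence, $X(\tau)$ is a vector-valued modular function on $\Gamma_0(3)$.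
   Context: Notation: $\zeta_N=e^{2\pi i/N}$; for rational $r$, $q^r:=e^{2\pi i r\tau}$; $(a;q)_n=\prod_{k=0}^{n-1}(1-aq^k)$, $(a;q)_\infty=\prod_{k\ge0}(1-aq^k)$, $(a_1,\dots,a_m;q)_\infty=\prod_i(a_i;q)_\infty$. By the known Capparelli identities (in the form of Kanade–Russell and Kurşungöz), $a_1(q)=(-q^2,-q^3,-q^4,-q^6;q^6)_\infty$ and $a_2(q)=(-q,-q^3,-q^5,-q^6;q^6)_\infty$. $\Gamma_0(N)$ is the group of matrices in $\mathrm{SL}(2,\mathbb Z)$ whose lower-left entry is divisible by $N$, acting on the upper half plane by Möbius transformations. A (column) vector-valued function $X$ on the upper half plane is called a vector-valued modular function on $\Gamma_0(N)$ if for every $\gamma\in\Gamma_0(N)$ there is a constant complex matrix $\rho(\gamma)$ with $X(\gamma\tau)=\rho(\gamma)X(\tau)$ for all $\tau$. *)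

theory Defs
  imports "HOL-Analysis.Analysis"
begin

definition zeta :: "nat \<Rightarrow> complex" where
  "zeta N = exp (2 * of_real pi * \<i> / of_nat N)"

text \<open>\<open>q_pow r \<tau>\<close> is \<open>q\<close> to the rational power \<open>r\<close>, as a function of \<open>\<tau>\<close>; it is not a
  principal-branch power of the number \<open>q\<close>.\<close>

definition q_pow :: "rat \<Rightarrow> complex \<Rightarrow> complex" where
  "q_pow r \<tau> = exp (2 * of_real pi * \<i> * of_rat r * \<tau>)"

definition q_poch :: "complex \<Rightarrow> complex \<Rightarrow> nat \<Rightarrow> complex" where
  "q_poch a q n = (\<Prod>k<n. 1 - a * q ^ k)"

definition a1 :: "complex \<Rightarrow> complex" where
  "a1 q = (\<Sum>\<^sub>\<infinity>(n1, n2) \<in> UNIV.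
     q ^ (2 * n1\<^sup>2 + 6 * n1 * n2 + 6 * n2\<^sup>2) / (q_poch q q n1 * q_poch (q ^ 3) (q ^ 3) n2))"

definition a2 :: "complex \<Rightarrow> complex" where
  "a2 q = (\<Sum>\<^sub>\<infinity>(n1, n2) \<in> UNIV.
     q ^ (2 * n1\<^sup>2 + 6 * n1 * n2 + 6 * n2\<^sup>2 + n1 + 3 * n2) * (1 + q ^ (2 * n1 + 3 * n2 + 1))
       / (q_poch q q n1 * q_poch (q ^ 3) (q ^ 3) n2))"

definition X :: "complex \<Rightarrow> complex ^ 2" where
  "X \<tau> = vector [q_pow (-1/24) \<tau> * a1 (q_pow 1 \<tau>), q_pow (5/24) \<tau> * a2 (q_pow 1 \<tau>)]"

definition Gamma0 :: "nat \<Rightarrow> (int ^ 2 ^ 2) set" where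
  "Gamma0 N = {\<gamma>. det \<gamma> = 1 \<and> int N dvd \<gamma> $ 2 $ 1}"

definition moebius_act :: "int ^ 2 ^ 2 \<Rightarrow> complex \<Rightarrow> complex" where
  "moebius_act \<gamma> = moebius (of_int (\<gamma> $ 1 $ 1)) (of_int (\<gamma> $ 1 $ 2))
                            (of_int (\<gamma> $ 2 $ 1)) (of_int (\<gamma> $ 2 $ 2))"

text \<open>Only the values of \<open>F\<close> on the upper half plane matter. As in the source, neither
  holomorphy nor multiplicativity of \<open>\<rho>\<close> is part of the notion.\<close>

definition vv_modular_function :: "nat \<Rightarrow> (complex \<Rightarrow> complex ^ 'n) \<Rightarrow> bool" where
  "vv_modular_function N F \<longleftrightarrow>
     (\<forall>\<gamma> \<in> Gamma0 N. \<exists>\<rho> :: complex ^ 'n ^ 'n. \<forall>\<tau>. Im \<tau> > 0 \<longrightarrow> F (moebius_act \<gamma> \<tau>) = \<rho> *v F \<tau>)"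

end

theory Submission
  imports Defs "HOL-Complex_Analysis.Complex_Analysis" "HOL-Real_Asymp.Real_Asymp"
begin

text \<open>The sums \<open>a\<^sub>1\<close> and \<open>a\<^sub>2\<close> are evaluated as theta quotients: writing the coefficients of
  \<open>(-p z; q)\<^sub>\<infinity>\<close> through three products with base \<open>q\<^sup>3\<close> turns the double sum into a quadruple sum,
  which three applications of Durfee's identity collapse to \<open>\<Sum> q\<^bsup>3 A\<^sup>2 + A\<^esup> / (q\<^sup>3; q\<^sup>3)\<^sub>\<infinity>\<close> and
  \<open>\<Sum> q\<^bsup>3 A\<^sup>2 + 2 A\<^esup> / (q\<^sup>3; q\<^sup>3)\<^sub>\<infinity>\<close>. By Jacobi's triple product, the first component of \<open>X\<close> at \<open>\<tau>\<close>
  is the product of Weber functions \<open>f(6\<tau>) f\<^sub>2(2\<tau>) / \<surd>2\<close>. The inversion \<open>f(-1/\<tau>) = f(\<tau>)\<close>,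
  \<open>f\<^sub>2(-1/\<tau>) = f\<^sub>1(\<tau>)\<close> follows from \<open>f f\<^sub>1 f\<^sub>2 = \<surd>2\<close> and the inversion of quotients of theta
  constants, which is needed on the imaginary axis only, the identity theorem doing the rest.
  Splitting \<open>\<Sum> x\<^bsup>3 A\<^sup>2 + 2 A\<^esup>\<close> by the parity of \<open>A\<close> expresses \<open>f(\<tau>/6) f\<^sub>1(\<tau>/2)\<close> through both
  components of \<open>X\<close> at \<open>\<tau>/3\<close>. The second component follows by replacing \<open>\<tau>\<close> with \<open>-3/\<tau>\<close>.\<close>

section \<open>\<open>q\<close>-Pochhammer symbols\<close>

text \<open>Put r^2 = q and p = r^3. The quadratic exponent comes from completing a square: twice 2
  m^2 + 6 m n + 6 n^2 is 3 (m + 2 n)^2 + m^2, so q to that exponent is p^((m + 2 n)^2) r^(m^2). Here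
  r^(m^2) / (q; q)_m is an Euler coefficient of (-r z; q)_inf, and sorting the factors of that
  product modulo 3 gives (-p y z, -p z / y, -p z; p^2)_inf with y = q. Taking y = q^2 gives (1 + z /
  r) (-r^3 z; q)_inf instead, which leads to \<open>a2\<close> after a rearrangement. The pair y, 1
  / y lets the difference of two indices survive as the index of a theta series. The obstacle in the
  inversion is the normalising constant of a single theta series. Quotients do not see it, and the
  constant product of the three Weber functions replaces it. Recovering each Weber function then
  takes a square root and a cube root, which are unambiguous because all values on the imaginary
  axis are positive.\<close>

definition qpoch :: "'a::comm_ring_1 \<Rightarrow> 'a \<Rightarrow> nat \<Rightarrow> 'a" where
  "qpoch a q n = (\<Prod>k<n. 1 - a * q ^ k)"

text \<open>Both symbols are generic in the field: positivity on the imaginary axis is argued over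
  the reals, holomorphy over the complex numbers, and \<open>qinf_of_real\<close> connects the
  two.\<close>

definition qinf :: "'a::{real_normed_field,banach} \<Rightarrow> 'a \<Rightarrow> 'a" where
  "qinf a q = (\<Prod>k. 1 - a * q ^ k)"

lemma qpoch_0 [simp]: "qpoch a q 0 = 1"
  and qpoch_Suc: "qpoch a q (Suc n) = qpoch a q n * (1 - a * q ^ n)"
  by (simp_all add: qpoch_def)

lemma convergent_prod_qpoch:
  fixes a q :: "'a::{real_normed_field,banach}"
  assumes "norm q < 1"
  shows "convergent_prod (\<lambda>k. 1 - a * q ^ k)"
proof -
  have "summable (\<lambda>k. norm (a * q ^ k))"
    using assms by (simp add: norm_mult norm_power summable_mult summable_geometric)
  then have "abs_convergent_prod (\<lambda>k. 1 - a * q ^ k)"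
    by (simp add: abs_convergent_prod_conv_summable)
  then show ?thesis by (rule abs_convergent_prod_imp_convergent_prod)
qed

lemma qpoch_tendsto_qinf:
  fixes a q :: "'a::{real_normed_field,banach}"
  assumes "norm q < 1"
  shows "qpoch a q \<longlonglongrightarrow> qinf a q"
  using convergent_prod_LIMSEQ[OF convergent_prod_qpoch[OF assms, of a]]
  unfolding qpoch_def qinf_def by (subst (asm) LIMSEQ_lessThan_iff_atMost[symmetric])

lemma one_minus_power_neq_0:
  fixes q :: "'a::real_normed_field"
  assumes "norm q < 1"
  shows "1 - q ^ Suc n \<noteq> 0"
proof
  assume "1 - q ^ Suc n = 0"
  then have "norm (q ^ Suc n) = 1" by (simp flip: eq_iff_diff_eq_0)
  moreover have "norm (q ^ Suc n) < 1"
    using assms by (simp add: norm_power power_less_one_iff del: power_Suc)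
  ultimately show False by simp
qed

lemma qpoch_neq_0:
  fixes q :: "'a::real_normed_field"
  assumes "norm q < 1"
  shows "qpoch q q n \<noteq> 0"
  using one_minus_power_neq_0[OF assms] by (simp add: qpoch_def)

lemma qinf_neq_0:
  fixes q :: "'a::{real_normed_field,banach}"
  assumes "norm q < 1"
  shows "qinf q q \<noteq> 0"
  unfolding qinf_def
  using one_minus_power_neq_0[OF assms] by (intro prodinf_nonzero convergent_prod_qpoch assms) simp

text \<open>The reciprocals converge because the limit \<open>qinf q q\<close> is nonzero. The bound
  controls the denominators in the summability and dominated convergence arguments.\<close>

lemma qpoch_inverse_bounded:
  fixes q :: "'a::{real_normed_field,banach}"
  assumes "norm q < 1"
  obtains C where "C > 0" "\<And>n. norm (1 / qpoch q q n) \<le> C"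
proof -
  have "(\<lambda>n. 1 / qpoch q q n) \<longlonglongrightarrow> 1 / qinf q q"
    by (intro tendsto_intros qpoch_tendsto_qinf qinf_neq_0 assms)
  then have "Bseq (\<lambda>n. 1 / qpoch q q n)"
    using convergentI convergent_imp_Bseq by blast
  then show ?thesis using that unfolding Bseq_def by blast
qed

section \<open>Durfee's identity, finite and in the limit\<close>

text \<open>Split 1 - Q^(M+1) as (1 - Q^(M+1-k)) + Q^(M+1-k) (1 - Q^k). The first part removes the
  last factor of the Pochhammer symbol at M+1-k; the second removes the last factor of the one at k,
  and shifting k by one then raises a to a + 1.\<close>

lemma durfee_sum_step:
  fixes Q :: "'a::real_normed_field"
  assumes "norm Q < 1"
  shows "(\<Sum>k\<le>Suc M. Q ^ (k\<^sup>2 + a * k) / (qpoch Q Q (k + a) * qpoch Q Q k * qpoch Q Q (Suc M - k)))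
           * (1 - Q ^ Suc M)
       = (\<Sum>k\<le>M. Q ^ (k\<^sup>2 + a * k) / (qpoch Q Q (k + a) * qpoch Q Q k * qpoch Q Q (M - k)))
       + Q ^ (Suc M + a) * (\<Sum>k\<le>M. Q ^ (k\<^sup>2 + Suc a * k) / (qpoch Q Q (k + Suc a) * qpoch Q Q k * qpoch Q Q (M - k)))"
    (is "?S * _ = ?S1 + _ * ?S2")
proof -
  let ?P = "qpoch Q Q"
  let ?t = "\<lambda>k. Q ^ (k\<^sup>2 + a * k) / (?P (k + a) * ?P k * ?P (Suc M - k))"
  note nz [simp] = qpoch_neq_0[OF assms] one_minus_power_neq_0[OF assms, unfolded power_Suc]
  have nz2 [simp]: "Q * Q ^ n \<noteq> 1" for n using nz(2)[of n] by (metis diff_self)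
  have "?S * (1 - Q ^ Suc M) = (\<Sum>k\<le>Suc M. ?t k * (1 - Q ^ (Suc M - k)) + ?t k * (Q ^ (Suc M - k) * (1 - Q ^ k)))"
    unfolding sum_distrib_right
  proof (rule sum.cong[OF refl])
    fix k assume "k \<in> {..Suc M}"
    then have "Q ^ Suc M = Q ^ (Suc M - k) * Q ^ k" by (simp flip: power_add)
    then show "?t k * (1 - Q ^ Suc M) = ?t k * (1 - Q ^ (Suc M - k)) + ?t k * (Q ^ (Suc M - k) * (1 - Q ^ k))"
      by (simp only:) (simp only: ring_distribs, simp)
  qed
  also have "\<dots> = (\<Sum>k\<le>Suc M. ?t k * (1 - Q ^ (Suc M - k))) + (\<Sum>k\<le>Suc M. ?t k * (Q ^ (Suc M - k) * (1 - Q ^ k)))"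
    by (rule sum.distrib)
  also have "(\<Sum>k\<le>Suc M. ?t k * (1 - Q ^ (Suc M - k))) = ?S1"
  proof -
    have "?t k * (1 - Q ^ (Suc M - k)) = Q ^ (k\<^sup>2 + a * k) / (?P (k + a) * ?P k * ?P (M - k))" if "k \<le> M" for k
      using that by (simp add: Suc_diff_le qpoch_Suc)
    then show ?thesis by simp
  qed
  also have "(\<Sum>k\<le>Suc M. ?t k * (Q ^ (Suc M - k) * (1 - Q ^ k))) = Q ^ (Suc M + a) * ?S2"
  proof -
    have "?t (Suc k) * (Q ^ (Suc M - Suc k) * (1 - Q ^ Suc k))
        = Q ^ (Suc M + a) * (Q ^ (k\<^sup>2 + Suc a * k) / (?P (k + Suc a) * ?P k * ?P (M - k)))"
      if "k \<le> M" for k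
    proof -
      have e: "(Suc k)\<^sup>2 + a * Suc k + (M - k) = Suc M + a + (k\<^sup>2 + Suc a * k)"
        using that by (simp add: power2_eq_square algebra_simps)
      have "?t (Suc k) * (Q ^ (Suc M - Suc k) * (1 - Q ^ Suc k))
          = Q ^ ((Suc k)\<^sup>2 + a * Suc k + (M - k)) / (?P (k + Suc a) * ?P k * ?P (M - k))"
        by (simp add: qpoch_Suc power_add del: power_Suc) (simp add: qpoch_Suc mult_ac)
      then show ?thesis unfolding e by (simp add: power_add)
    qed
    then show ?thesis unfolding sum.atMost_Suc_shift sum_distrib_left by simp
  qed
  finally show ?thesis .
qed

text \<open>A limiting case of the q-Chu-Vandermonde sum. The recurrence raises the shift, so the
  induction hypothesis is used both at a and at a + 1.\<close>

lemma durfee_finite: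
  fixes Q :: "'a::real_normed_field"
  assumes Q: "norm Q < 1"
  shows "(\<Sum>k\<le>N. Q ^ (k\<^sup>2 + a * k) / (qpoch Q Q (k + a) * qpoch Q Q k * qpoch Q Q (N - k)))
       = 1 / (qpoch Q Q N * qpoch Q Q (N + a))"
proof (induction N arbitrary: a)
  case 0
  show ?case by simp
next
  case (Suc N)
  let ?P = "qpoch Q Q"
  note nz [simp] = qpoch_neq_0[OF assms]
  have nz2: "1 - Q ^ Suc n \<noteq> 0" for n using one_minus_power_neq_0[OF Q] by blast
  have P: "?P (Suc n) = ?P n * (1 - Q ^ Suc n)" for n by (simp add: qpoch_Suc)
  have "(\<Sum>k\<le>Suc N. Q ^ (k\<^sup>2 + a * k) / (?P (k + a) * ?P k * ?P (Suc N - k))) * (1 - Q ^ Suc N)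
      = 1 / (?P N * ?P (N + a)) + Q ^ (Suc N + a) * (1 / (?P N * ?P (Suc (N + a))))"
    unfolding durfee_sum_step[OF Q] Suc.IH by simp
  also have "\<dots> = 1 / (?P N * ?P (Suc (N + a)))"
    using nz2[of "N + a"] unfolding P by (simp add: divide_simps del: power_Suc)
  finally show ?case
    using nz2[of N] unfolding P[of N] by (simp add: field_simps del: power_Suc)
qed

text \<open>The term is the n-th power of p^n z, whose norm is eventually below 1/2.\<close>

lemma summable_quadratic_power:
  fixes p z :: "'a::{real_normed_field,banach}"
  assumes "norm p < 1"
  shows "summable (\<lambda>n. norm (p ^ n\<^sup>2 * z ^ n))"
proof -
  have "(\<lambda>n. norm (p ^ n * z)) \<longlonglongrightarrow> 0"
    using assms by (intro tendsto_norm_zero tendsto_mult_left_zero LIMSEQ_power_zero)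
  then have "\<forall>\<^sub>F n in sequentially. norm (p ^ n * z) < 1 / 2"
    by (rule order_tendstoD) simp
  then have "\<forall>\<^sub>F n in sequentially. norm (norm (p ^ n\<^sup>2 * z ^ n)) \<le> (1 / 2) ^ n"
  proof eventually_elim
    case (elim n)
    have "norm (p ^ n\<^sup>2 * z ^ n) = norm (p ^ n * z) ^ n"
      by (simp add: norm_mult norm_power power_mult power2_eq_square power_mult_distrib)
    also have "\<dots> \<le> (1 / 2) ^ n" using elim by (intro power_mono) auto
    finally show ?case by simp
  qed
  then show ?thesis by (rule summable_comparison_test_ev) (simp add: summable_geometric)
qed

text \<open>Let N tend to infinity in the finite form. On the left \<open>qpoch Q Q (N - k)\<close>
  contributes a factor 1 / (Q; Q)_inf, which cancels one of the two such factors on the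
  right.\<close>

lemma durfee_has_sum:
  fixes Q :: "'a::{real_normed_field,banach}"
  assumes Q: "norm Q < 1"
  shows "((\<lambda>k. Q ^ (k\<^sup>2 + a * k) / (qpoch Q Q k * qpoch Q Q (k + a))) has_sum 1 / qinf Q Q) UNIV"
proof -
  let ?P = "qpoch Q Q"
  let ?t = "\<lambda>k. Q ^ (k\<^sup>2 + a * k) / (?P k * ?P (k + a))"
  obtain C where C: "C > 0" "\<And>n. norm (1 / ?P n) \<le> C" using qpoch_inverse_bounded[OF Q] by blast
  have C': "norm (1 / (?P k * ?P (k + a))) \<le> C * C" for k
    using mult_mono[OF C(2)[of k] C(2)[of "k + a"]] C(1) by (simp add: norm_mult norm_divide)
  have pw: "Q ^ (k\<^sup>2 + a * k) = Q ^ k\<^sup>2 * (Q ^ a) ^ k" for k by (simp add: power_add power_mult)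
  have bt: "norm (?t k) \<le> C * C * norm (Q ^ k\<^sup>2 * (Q ^ a) ^ k)" for k
    using mult_right_mono[OF C'[of k], of "norm (Q ^ k\<^sup>2 * (Q ^ a) ^ k)"] unfolding pw
    by (simp add: norm_mult norm_divide)
  have sm: "summable (\<lambda>k. norm (Q ^ k\<^sup>2 * (Q ^ a) ^ k))" by (rule summable_quadratic_power[OF Q])
  have st: "summable (\<lambda>k. norm (?t k))"
    by (rule summable_comparison_test'[OF summable_mult[OF sm, of "C * C"], of 0]) (use bt in simp)
  \<comment> \<open>Terms beyond the finite range are set to zero, so that each finite sum becomes a
    full series and Tannery's theorem applies.\<close>
  define f where "f k N = (if k \<le> N then ?t k * (1 / ?P (N - k)) else 0)" for k N
  have "(\<lambda>N. suminf (\<lambda>k. f k N)) \<longlonglongrightarrow> suminf (\<lambda>k. ?t k * (1 / qinf Q Q))"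
  proof (rule tannerys_theorem[THEN conjunct2, THEN conjunct2])
    show "(\<lambda>N. f k N) \<longlonglongrightarrow> ?t k * (1 / qinf Q Q)" for k
    proof (rule LIMSEQ_offset[where k = k])
      have "(\<lambda>n. ?t k * (1 / ?P n)) \<longlonglongrightarrow> ?t k * (1 / qinf Q Q)"
        by (intro tendsto_intros qpoch_tendsto_qinf qinf_neq_0 Q)
      then show "(\<lambda>n. f k (n + k)) \<longlonglongrightarrow> ?t k * (1 / qinf Q Q)" by (simp add: f_def)
    qed
    have "norm (f k N) \<le> norm (?t k) * C" for k N
    proof (cases "k \<le> N")
      case True
      then show ?thesis using mult_left_mono[OF C(2)[of "N - k"], of "norm (?t k)"]
        by (simp add: f_def norm_mult norm_divide)
    next
      case False
      then show ?thesis using C(1) by (simp add: f_def)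
    qed
    then show "\<forall>\<^sub>F (k, N) in at_top \<times>\<^sub>F sequentially. norm (f k N) \<le> norm (?t k) * C"
      by (auto intro!: always_eventually)
    show "summable (\<lambda>k. norm (?t k) * C)" by (intro summable_mult2 st)
  qed simp
  moreover have "suminf (\<lambda>k. f k N) = 1 / (?P N * ?P (N + a))" for N
  proof -
    have "suminf (\<lambda>k. f k N) = (\<Sum>k\<le>N. f k N)" by (rule suminf_finite) (auto simp: f_def)
    also have "\<dots> = (\<Sum>k\<le>N. Q ^ (k\<^sup>2 + a * k) / (?P (k + a) * ?P k * ?P (N - k)))"
      by (intro sum.cong) (auto simp: f_def mult_ac)
    also have "\<dots> = 1 / (?P N * ?P (N + a))" by (rule durfee_finite[OF Q])
    finally show ?thesis .
  qed
  ultimately have "(\<lambda>N. 1 / (?P N * ?P (N + a))) \<longlonglongrightarrow> suminf ?t * (1 / qinf Q Q)"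
    using suminf_mult2[OF summable_norm_cancel[OF st], of "1 / qinf Q Q"] by simp
  moreover have "(\<lambda>N. 1 / (?P N * ?P (N + a))) \<longlonglongrightarrow> 1 / (qinf Q Q * qinf Q Q)"
    by (intro tendsto_intros LIMSEQ_ignore_initial_segment qpoch_tendsto_qinf Q)
      (simp add: qinf_neq_0[OF Q])
  ultimately have "suminf ?t * (1 / qinf Q Q) = 1 / (qinf Q Q * qinf Q Q)"
    by (rule LIMSEQ_unique)
  then have "suminf ?t = 1 / qinf Q Q" using qinf_neq_0[OF Q] by (simp add: divide_simps)
  then show ?thesis
    using norm_summable_imp_has_sum[OF st summable_sums[OF summable_norm_cancel[OF st]]] by (simp only:)
qed

text \<open>The series satisfies G z = (1 + p z) G (Q z); iterating this and using continuity at 0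
  yields the product. Taking Q = p^2 turns the triangular exponent of Euler's expansion into a
  square.\<close>

lemma euler_has_sum:
  fixes p z :: "'a::{real_normed_field,banach}"
  assumes p: "norm p < 1"
  defines "Q \<equiv> p\<^sup>2"
  shows "summable (\<lambda>i. norm (p ^ i\<^sup>2 * z ^ i / qpoch Q Q i))"
    and "((\<lambda>i. p ^ i\<^sup>2 * z ^ i / qpoch Q Q i) has_sum qinf (- p * z) Q) UNIV"
proof -
  let ?P = "qpoch Q Q"
  have Q: "norm Q < 1" using p by (simp add: Q_def norm_power power_less_one_iff)
  obtain C where C: "C > 0" "\<And>n. norm (1 / ?P n) \<le> C" using qpoch_inverse_bounded[OF Q] by blast
  show sm: "summable (\<lambda>i. norm (p ^ i\<^sup>2 * z ^ i / ?P i))" for z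
  proof (rule summable_comparison_test'[OF summable_mult[OF summable_quadratic_power[OF p, of z], of C], of 0])
    show "norm (norm (p ^ i\<^sup>2 * z ^ i / ?P i)) \<le> C * norm (p ^ i\<^sup>2 * z ^ i)" for i
      using mult_right_mono[OF C(2)[of i], of "norm (p ^ i\<^sup>2 * z ^ i)"] by (simp add: norm_mult norm_divide)
  qed
  define g where "g i = p ^ i\<^sup>2 / ?P i" for i
  define G where "G z = (\<Sum>i. g i * z ^ i)" for z
  have sg: "summable (\<lambda>i. g i * z ^ i)" for z
    using summable_norm_cancel[OF sm[of z]] by (simp add: g_def)
  have g_Suc: "g (Suc i) * (1 - Q ^ Suc i) = p * Q ^ i * g i" for i
  proof -
    have e: "p ^ (Suc i)\<^sup>2 = p * Q ^ i * p ^ i\<^sup>2"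
    proof -
      have "(Suc i)\<^sup>2 = Suc (2 * i + i\<^sup>2)" by (simp add: power2_eq_square)
      then show ?thesis by (simp add: Q_def power_add power_mult)
    qed
    define u where "u = 1 - Q ^ Suc i"
    have "u \<noteq> 0" unfolding u_def by (rule one_minus_power_neq_0[OF Q])
    moreover have "?P (Suc i) = ?P i * u" by (simp add: qpoch_Suc u_def)
    ultimately show ?thesis unfolding g_def e u_def[symmetric] by simp
  qed
  have rec: "G z = (1 + p * z) * G (Q * z)" for z
  proof -
    have "G z - G (Q * z) = (\<Sum>i. g i * z ^ i - g i * (Q * z) ^ i)"
      unfolding G_def by (rule suminf_diff[OF sg sg])
    also have "\<dots> = (\<Sum>i. g i * (1 - Q ^ i) * z ^ i)" by (simp add: power_mult_distrib algebra_simps)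
    also have "\<dots> = (\<Sum>i. g (Suc i) * (1 - Q ^ Suc i) * z ^ Suc i)"
    proof (subst suminf_split_head)
      show "summable (\<lambda>i. g i * (1 - Q ^ i) * z ^ i)"
        using summable_diff[OF sg[of z] sg[of "Q * z"]] by (simp add: power_mult_distrib algebra_simps)
    qed simp
    also have "\<dots> = (\<Sum>i. p * z * (g i * (Q * z) ^ i))"
      unfolding g_Suc by (simp add: power_mult_distrib mult_ac)
    also have "\<dots> = p * z * G (Q * z)" unfolding G_def by (rule suminf_mult[OF sg])
    finally show ?thesis by (simp add: algebra_simps)
  qed
  have "G z = qpoch (- p * z) Q n * G (Q ^ n * z)" for z n
  proof (induction n)
    case (Suc n)
    then show ?case using rec[of "Q ^ n * z"] by (simp add: qpoch_Suc algebra_simps)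
  qed simp
  moreover have "(\<lambda>n. qpoch (- p * z) Q n * G (Q ^ n * z)) \<longlonglongrightarrow> qinf (- p * z) Q * G 0" for z
  proof (intro tendsto_mult qpoch_tendsto_qinf Q)
    have "isCont G 0" unfolding G_def by (rule isCont_powser_converges_everywhere[OF sg])
    moreover have "(\<lambda>n. Q ^ n * z) \<longlonglongrightarrow> 0"
      using Q by (intro tendsto_mult_left_zero LIMSEQ_power_zero)
    ultimately show "(\<lambda>n. G (Q ^ n * z)) \<longlonglongrightarrow> G 0" by (rule isCont_tendsto_compose)
  qed
  moreover have "G 0 = 1" unfolding G_def powser_zero by (simp add: g_def)
  ultimately have "G z = qinf (- p * z) Q" for z
    using LIMSEQ_unique[of "\<lambda>n. G z" "G z"] by simp
  then show "((\<lambda>i. p ^ i\<^sup>2 * z ^ i / ?P i) has_sum qinf (- p * z) Q) UNIV"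
    using norm_summable_imp_has_sum[OF sm[of z] summable_sums[OF summable_norm_cancel[OF sm[of z]]]]
    by (simp add: G_def g_def)
qed

section \<open>Jacobi's triple product and a quadruple sum\<close>

lemma summable_on_mult_Times:
  fixes f :: "'b \<Rightarrow> 'a::{real_normed_field,banach}" and g :: "'c \<Rightarrow> 'a"
  assumes "(\<lambda>x. norm (f x)) summable_on UNIV" "(\<lambda>x. norm (g x)) summable_on UNIV"
  shows "(\<lambda>(x, y). norm (f x * g y)) summable_on UNIV"
proof -
  have "(\<lambda>(x, y). norm (f x * g y)) summable_on (Sigma UNIV (\<lambda>_. UNIV))"
  proof (rule summable_on_SigmaI)
    show "((\<lambda>y. case (x, y) of (x, y) \<Rightarrow> norm (f x * g y)) has_sum norm (f x) * (\<Sum>\<^sub>\<infinity>y. norm (g y))) UNIV" for x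
      using has_sum_cmult_right[OF has_sum_infsum[OF assms(2)], of "norm (f x)"] by (simp add: norm_mult)
    show "(\<lambda>x. norm (f x) * (\<Sum>\<^sub>\<infinity>y. norm (g y))) summable_on UNIV"
      by (intro summable_on_cmult_left assms)
  qed auto
  then show ?thesis by simp
qed

lemma has_sum_mult_Times:
  fixes f :: "'b \<Rightarrow> 'a::{real_normed_field,banach}" and g :: "'c \<Rightarrow> 'a"
  assumes "(\<lambda>x. norm (f x)) summable_on UNIV" "(\<lambda>x. norm (g x)) summable_on UNIV"
    and "(f has_sum S) UNIV" "(g has_sum T) UNIV"
  shows "((\<lambda>(x, y). f x * g y) has_sum S * T) UNIV"
proof -
  have "((\<lambda>(x, y). f x * g y) has_sum S * T) (Sigma UNIV (\<lambda>_. UNIV))"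
  proof (rule has_sum_SigmaI)
    show "((\<lambda>y. case (x, y) of (x, y) \<Rightarrow> f x * g y) has_sum f x * T) UNIV" for x
      using has_sum_cmult_right[OF assms(4), of "f x"] by simp
    show "((\<lambda>x. f x * T) has_sum S * T) UNIV" by (rule has_sum_cmult_left[OF assms(3)])
    show "(\<lambda>(x, y). f x * g y) summable_on (Sigma UNIV (\<lambda>_. UNIV))"
      using abs_summable_summable[of "\<lambda>(x, y). f x * g y" UNIV] summable_on_mult_Times[OF assms(1,2)]
      by (simp add: case_prod_unfold)
  qed
  then show ?thesis by simp
qed

text \<open>A pair of naturals (i, k) is coded by A = i - k and l = min i k, so that i = l + max A 0
  and k = l + max (-A) 0. In these coordinates i^2 + k^2 contains twice the Durfee exponent l^2 +
  |A| l.\<close>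

lemma pair_of_difference:
  fixes A :: int and l :: nat
  defines "a \<equiv> nat \<bar>A\<bar>"
  shows "(l + nat A)\<^sup>2 + (l + nat (- A))\<^sup>2 = a\<^sup>2 + 2 * (l\<^sup>2 + a * l)"
    and "(l + nat A) + (l + nat (- A)) = 2 * l + a"
    and "P (l + nat A) * P (l + nat (- A)) = P l * (P (l + a) :: 'b::comm_ring_1)"
    and "z \<noteq> 0 \<Longrightarrow> z ^ (l + nat A) * (1 / z) ^ (l + nat (- A)) = (z powi A :: 'a::field)"
proof -
  have "A = int a \<and> nat A = a \<and> nat (- A) = 0 \<or> A = - int a \<and> nat A = 0 \<and> nat (- A) = a"
    unfolding a_def by linarith
  note * = this
  show "(l + nat A)\<^sup>2 + (l + nat (- A))\<^sup>2 = a\<^sup>2 + 2 * (l\<^sup>2 + a * l)"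
    using * by (auto simp: power2_eq_square algebra_simps)
  show "(l + nat A) + (l + nat (- A)) = 2 * l + a" using * by auto
  show "P (l + nat A) * P (l + nat (- A)) = P l * P (l + a)" using * by (auto simp: mult.commute)
  show "z \<noteq> 0 \<Longrightarrow> z ^ (l + nat A) * (1 / z) ^ (l + nat (- A)) = z powi A"
    using * by (auto simp: power_add power_one_over power_int_minus field_simps)
qed

lemma powi_square_nat: "p powi A\<^sup>2 = (p::'a::field) ^ (nat \<bar>A\<bar>)\<^sup>2"
proof -
  have "A\<^sup>2 = int ((nat \<bar>A\<bar>)\<^sup>2)" by simp
  then show ?thesis by (metis power_int_of_nat)
qed

text \<open>Multiply Euler's expansions at z and at 1 / z and sort by the difference A of the
  indices. The sum over their minimum is Durfee's identity with shift |A|, whose value does not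
  depend on A.\<close>

theorem jacobi_triple_product:
  fixes p z :: "'a::{real_normed_field,banach}"
  assumes p: "norm p < 1" and z: "z \<noteq> 0"
  shows "((\<lambda>A. p powi A\<^sup>2 * z powi A) has_sum
            qinf (- p * z) (p\<^sup>2) * qinf (- p / z) (p\<^sup>2) * qinf (p\<^sup>2) (p\<^sup>2)) UNIV"
proof -
  define Q where "Q = p\<^sup>2"
  let ?P = "qpoch Q Q"
  define e where "e z i = p ^ i\<^sup>2 * z ^ i / ?P i" for z i
  have Q: "norm Q < 1" using p by (simp add: Q_def norm_power power_less_one_iff)
  have "(\<lambda>i. norm (e z i)) summable_on UNIV" for z
    using norm_summable_imp_summable_on[of "\<lambda>i. norm (e z i)"] euler_has_sum(1)[OF p, of z]
    by (simp add: e_def Q_def)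
  moreover have "(e z has_sum qinf (- p * z) Q) UNIV" for z
    using euler_has_sum(2)[OF p, of z] by (simp add: e_def[abs_def] Q_def)
  ultimately have *: "((\<lambda>(i, k). e z i * e (1 / z) k) has_sum qinf (- p * z) Q * qinf (- p * (1 / z)) Q) UNIV"
    by (intro has_sum_mult_Times)
  then have "((\<lambda>(A, l). p powi A\<^sup>2 * z powi A * (Q ^ (l\<^sup>2 + nat \<bar>A\<bar> * l) / (?P l * ?P (l + nat \<bar>A\<bar>))))
          has_sum qinf (- p * z) Q * qinf (- p * (1 / z)) Q) (Sigma UNIV (\<lambda>_. UNIV))"
  proof (rule has_sum_reindex_bij_witness[where j = "\<lambda>(i, k). (int i - int k, min i k)"
        and i = "\<lambda>(A, l). (l + nat A, l + nat (- A))", THEN iffD1, rotated -1], goal_cases)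
    case (5 x)
    obtain i k where x: "x = (i, k)" by (cases x)
    define A l where "A = int i - int k" and "l = min i k"
    have ik: "l + nat A = i" "l + nat (- A) = k" by (auto simp: A_def l_def)
    have "e z (l + nat A) * e (1 / z) (l + nat (- A))
        = p ^ ((l + nat A)\<^sup>2 + (l + nat (- A))\<^sup>2) * (z ^ (l + nat A) * (1 / z) ^ (l + nat (- A)))
           / (?P (l + nat A) * ?P (l + nat (- A)))"
      by (simp add: e_def power_add)
    also have "\<dots> = p powi A\<^sup>2 * z powi A * (Q ^ (l\<^sup>2 + nat \<bar>A\<bar> * l) / (?P l * ?P (l + nat \<bar>A\<bar>)))"
      unfolding pair_of_difference(1) pair_of_difference(3)[where P = ?P] powi_square_nat pair_of_difference(4)[OF z]
      unfolding power_add power_mult Q_def[symmetric] by simp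
    finally show ?case unfolding ik by (simp add: x A_def l_def)
  qed auto
  then have "((\<lambda>A. p powi A\<^sup>2 * z powi A * (1 / qinf Q Q))
          has_sum qinf (- p * z) Q * qinf (- p * (1 / z)) Q) UNIV"
    by (rule has_sum_SigmaD) (use has_sum_cmult_right[OF durfee_has_sum[OF Q]] in simp)
  from has_sum_cmult_left[OF this, of "qinf Q Q"] show ?thesis
    using qinf_neq_0[OF Q] by (simp add: Q_def)
qed

section \<open>The quadruple sum and its two evaluations\<close>

text \<open>The indices i, k, j belong to the Euler expansions with parameters y, 1 / y and 1, and n
  to the base q^3 denominator of the double sum. The square of i + k + j + 2 n couples all
  four.\<close>

definition durfee4 :: "'a::field \<Rightarrow> 'a \<Rightarrow> nat \<times> nat \<times> nat \<times> nat \<Rightarrow> 'a" where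
  "durfee4 p y = (\<lambda>(i, k, j, n). p ^ ((i + k + j + 2 * n)\<^sup>2 + i\<^sup>2 + k\<^sup>2 + j\<^sup>2) * (y ^ i * (1 / y) ^ k)
     / (qpoch (p\<^sup>2) (p\<^sup>2) i * qpoch (p\<^sup>2) (p\<^sup>2) k * qpoch (p\<^sup>2) (p\<^sup>2) j * qpoch (p\<^sup>2) (p\<^sup>2) n))"

text \<open>Three absolutely convergent Euler series absorb the squares of i, k and j. Since n <= (i
  + k + j + 2 n)^2, the coupled power is bounded by a geometric term in n.\<close>

lemma durfee4_summable:
  fixes p y :: "'a::{real_normed_field,banach}"
  assumes p: "norm p < 1"
  shows "durfee4 p y summable_on UNIV"
proof -
  define Q where "Q = p\<^sup>2"
  let ?P = "qpoch Q Q"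
  define e where "e z i = p ^ i\<^sup>2 * z ^ i / ?P i" for z i
  have Q: "norm Q < 1" using p by (simp add: Q_def norm_power power_less_one_iff)
  obtain C where C: "C > 0" "\<And>n. norm (1 / ?P n) \<le> C" using qpoch_inverse_bounded[OF Q] by blast
  define g where "g n = norm p ^ n * C" for n
  have e: "(\<lambda>i. norm (e z i)) summable_on UNIV" for z
    using norm_summable_imp_summable_on[of "\<lambda>i. norm (e z i)"] euler_has_sum(1)[OF p, of z]
    by (simp add: e_def Q_def)
  have "g summable_on UNIV"
    using p C(1) unfolding g_def
    by (intro summable_on_cmult_left norm_summable_imp_summable_on) (simp add: summable_geometric)
  moreover have "norm (g n) = g n" for n using C(1) by (simp add: g_def)
  ultimately have g: "(\<lambda>n. norm (g n)) summable_on UNIV" by simp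
  have e': "(\<lambda>i. norm (norm (e z i))) summable_on UNIV" for z using e[of z] by simp
  have s: "(\<lambda>(i, k, j, n). norm (e y i) * (norm (e (1 / y) k) * (norm (e 1 j) * g n))) summable_on UNIV"
  proof -
    have 1: "(\<lambda>(x, y). norm (norm (e 1 x) * g y)) summable_on UNIV"
      by (rule summable_on_mult_Times[OF e' g])
    have 2: "(\<lambda>(x, z). norm (norm (e (1 / y) x) * (case z of (j, n) \<Rightarrow> norm (e 1 j) * g n))) summable_on UNIV"
      by (rule summable_on_mult_Times[OF e']) (use 1 in \<open>simp add: case_prod_unfold\<close>)
    have 3: "(\<lambda>(x, z). norm (norm (e y x) * (case z of (k, j, n) \<Rightarrow> norm (e (1 / y) k) * (norm (e 1 j) * g n)))) summable_on UNIV"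
      by (rule summable_on_mult_Times[OF e']) (use 2 in \<open>simp add: case_prod_unfold\<close>)
    then show ?thesis using C(1) by (simp add: case_prod_unfold g_def abs_mult)
  qed
  have "(\<lambda>x. norm (durfee4 p y x)) summable_on UNIV"
  proof (rule Infinite_Sum.abs_summable_on_comparison_test'[OF s])
    fix x :: "nat \<times> nat \<times> nat \<times> nat"
    obtain i k j n where x: "x = (i, k, j, n)" by (cases x) auto
    have "n \<le> (i + k + j + 2 * n)\<^sup>2"
      unfolding power2_eq_square by (rule order_trans[OF _ le_square]) simp
    then have "norm p ^ (i + k + j + 2 * n)\<^sup>2 * norm (1 / ?P n) \<le> norm p ^ n * C"
      using p by (intro mult_mono power_decreasing C) auto
    then have "norm (e y i) * norm (e (1 / y) k) * norm (e 1 j) * (norm p ^ (i + k + j + 2 * n)\<^sup>2 * norm (1 / ?P n))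
        \<le> norm (e y i) * norm (e (1 / y) k) * norm (e 1 j) * g n"
      unfolding g_def by (rule mult_left_mono) simp
    moreover have "durfee4 p y x = e y i * e (1 / y) k * e 1 j * (p ^ (i + k + j + 2 * n)\<^sup>2 * (1 / ?P n))"
      by (simp add: durfee4_def x e_def power_add Q_def[symmetric])
    ultimately show "norm (durfee4 p y x) \<le> (case x of (i, k, j, n) \<Rightarrow>
        norm (e y i) * (norm (e (1 / y) k) * (norm (e 1 j) * g n)))"
      by (simp add: x norm_mult norm_divide norm_power mult.assoc)
  qed
  then show ?thesis by (rule abs_summable_summable)
qed

text \<open>In the coordinates \<open>A = i - k\<close>, \<open>l = min i k\<close>, \<open>N = l + n\<close>, \<open>M = N + j\<close> the sums over \<open>l\<close>, \<open>N\<close>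
  and \<open>M\<close> are nested Durfee sums with the same shift \<open>\<bar>A\<bar>\<close>.\<close>

lemma durfee4_difference:
  fixes p y :: "'a::field" and A :: int
  assumes y: "y \<noteq> 0" and l: "l \<le> N" "N \<le> M"
  defines "Q \<equiv> p\<^sup>2" and "a \<equiv> nat \<bar>A\<bar>"
  shows "durfee4 p y (l + nat A, l + nat (- A), M - N, N - l)
    = Q powi A\<^sup>2 * y powi A * (Q ^ (M\<^sup>2 + a * M) * (Q ^ (N\<^sup>2 + a * N) / qpoch Q Q (M - N) *
        (Q ^ (l\<^sup>2 + a * l) / (qpoch Q Q (l + a) * qpoch Q Q l * qpoch Q Q (N - l)))))"
proof -
  let ?P = "qpoch Q Q"
  obtain n where N: "N = l + n" using l(1) le_Suc_ex by blast
  obtain j where M: "M = N + j" using l(2) le_Suc_ex by blast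
  have "(l + nat A + (l + nat (- A)) + j + 2 * n)\<^sup>2 + (l + nat A)\<^sup>2 + (l + nat (- A))\<^sup>2 + j\<^sup>2
      = ((l + nat A) + (l + nat (- A)) + j + 2 * n)\<^sup>2 + ((l + nat A)\<^sup>2 + (l + nat (- A))\<^sup>2) + j\<^sup>2"
    by simp
  \<comment> \<open>With i + k = 2 l + a the coupled index is M + N + a, and (M + N + a)^2 + (M -
    N)^2 = 2 M^2 + 2 N^2 + 2 a (M + N) + a^2. The total exponent is therefore even, and powers of p
    become powers of Q.\<close>
  also have "\<dots> = 2 * (a\<^sup>2 + (M\<^sup>2 + a * M) + (N\<^sup>2 + a * N) + (l\<^sup>2 + a * l))"
    unfolding pair_of_difference(1,2) a_def[symmetric] N M by (simp add: power2_eq_square algebra_simps)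
  finally have "p ^ ((l + nat A + (l + nat (- A)) + j + 2 * n)\<^sup>2 + (l + nat A)\<^sup>2 + (l + nat (- A))\<^sup>2 + j\<^sup>2)
      = Q powi A\<^sup>2 * Q ^ (M\<^sup>2 + a * M) * Q ^ (N\<^sup>2 + a * N) * Q ^ (l\<^sup>2 + a * l)"
    unfolding powi_square_nat a_def[symmetric] by (simp only: power_mult power_add Q_def)
  moreover have "?P (l + nat A) * ?P (l + nat (- A)) = ?P l * ?P (l + a)"
    unfolding a_def by (rule pair_of_difference)
  moreover have "y ^ (l + nat A) * (1 / y) ^ (l + nat (- A)) = y powi A"
    by (rule pair_of_difference(4)[OF y])
  moreover have "M - N = j" "N - l = n" using M N by auto
  ultimately show ?thesis by (simp add: durfee4_def Q_def[symmetric] mult_ac)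
qed

text \<open>Each inner sum evaluates to 1 / ((Q; Q)_N (Q; Q)_(N + a)), exactly the weight with which
  Durfee's identity applies to the next sum outward.\<close>

lemma durfee4_has_sum:
  fixes p y :: "'a::{real_normed_field,banach}"
  assumes p: "norm p < 1" and y: "y \<noteq> 0"
  defines "Q \<equiv> p\<^sup>2"
  shows "((\<lambda>A. Q powi A\<^sup>2 * y powi A * (1 / qinf Q Q)) has_sum infsum (durfee4 p y) UNIV) UNIV"
proof -
  let ?P = "qpoch Q Q"
  have Q: "norm Q < 1" using p by (simp add: Q_def norm_power power_less_one_iff)
  have T: "(durfee4 p y has_sum infsum (durfee4 p y) UNIV) UNIV"
    by (rule has_sum_infsum[OF durfee4_summable[OF p]])
  have nat: "min i k + nat (int i - int k) = i" "min i k + nat (int k - int i) = k" for i k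
    by auto
  from T have "((\<lambda>(A, M, N, l). durfee4 p y (l + nat A, l + nat (- A), M - N, N - l)) has_sum infsum (durfee4 p y) UNIV)
     (Sigma UNIV (\<lambda>A. Sigma UNIV (\<lambda>M. Sigma {..M} (\<lambda>N. {..N}))))"
    by (rule has_sum_reindex_bij_witness[where j = "\<lambda>(i, k, j, n). (int i - int k, min i k + n + j, min i k + n, min i k)"
        and i = "\<lambda>(A, M, N, l). (l + nat A, l + nat (- A), M - N, N - l)", THEN iffD1, rotated -1]) (auto simp: nat)
  then show ?thesis
  proof (rule has_sum_SigmaD)
    fix A :: int
    define a where "a = nat \<bar>A\<bar>"
    have "((\<lambda>(M, N, l). durfee4 p y (l + nat A, l + nat (- A), M - N, N - l)) has_sum Q powi A\<^sup>2 * y powi A * (1 / qinf Q Q))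
        (Sigma UNIV (\<lambda>M. Sigma {..M} (\<lambda>N. {..N})))"
    proof (rule has_sum_SigmaI)
      fix M
      have "(\<Sum>(N, l)\<in>Sigma {..M} (\<lambda>N. {..N}). durfee4 p y (l + nat A, l + nat (- A), M - N, N - l))
          = (\<Sum>N\<le>M. \<Sum>l\<le>N. durfee4 p y (l + nat A, l + nat (- A), M - N, N - l))"
        by (rule sum.Sigma[symmetric]) auto
      also have "\<dots> = (\<Sum>N\<le>M. \<Sum>l\<le>N. Q powi A\<^sup>2 * y powi A * (Q ^ (M\<^sup>2 + a * M) * (Q ^ (N\<^sup>2 + a * N) / ?P (M - N) *
        (Q ^ (l\<^sup>2 + a * l) / (?P (l + a) * ?P l * ?P (N - l))))))"
        by (intro sum.cong refl) (simp add: durfee4_difference[OF y] Q_def[symmetric] a_def)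
      also have "\<dots> = Q powi A\<^sup>2 * y powi A * (Q ^ (M\<^sup>2 + a * M) *
          (\<Sum>N\<le>M. Q ^ (N\<^sup>2 + a * N) / ?P (M - N) * (1 / (?P N * ?P (N + a)))))"
        by (simp only: sum_distrib_left[symmetric] durfee_finite[OF Q])
      also have "(\<Sum>N\<le>M. Q ^ (N\<^sup>2 + a * N) / ?P (M - N) * (1 / (?P N * ?P (N + a))))
          = (\<Sum>N\<le>M. Q ^ (N\<^sup>2 + a * N) / (?P (N + a) * ?P N * ?P (M - N)))"
        by (simp add: mult_ac)
      also have "\<dots> = 1 / (?P M * ?P (M + a))" by (rule durfee_finite[OF Q])
      finally show "((\<lambda>x. case (M, x) of (M, N, l) \<Rightarrow> durfee4 p y (l + nat A, l + nat (- A), M - N, N - l))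
          has_sum Q powi A\<^sup>2 * y powi A * (Q ^ (M\<^sup>2 + a * M) * (1 / (?P M * ?P (M + a))))) (Sigma {..M} (\<lambda>N. {..N}))"
        by (intro has_sum_finiteI) (auto simp: case_prod_unfold)
    next
      show "((\<lambda>M. Q powi A\<^sup>2 * y powi A * (Q ^ (M\<^sup>2 + a * M) * (1 / (?P M * ?P (M + a)))))
          has_sum Q powi A\<^sup>2 * y powi A * (1 / qinf Q Q)) UNIV"
        using has_sum_cmult_right[OF durfee_has_sum[OF Q]] by simp
    next
      have "inj_on (\<lambda>(M, N, l). (l + nat A, l + nat (- A), M - N, N - l)) (Sigma UNIV (\<lambda>M. Sigma {..M} (\<lambda>N. {..N})))"
        by (auto simp: inj_on_def)
      moreover have "durfee4 p y summable_on ((\<lambda>(M, N, l). (l + nat A, l + nat (- A), M - N, N - l)) ` (Sigma UNIV (\<lambda>M. Sigma {..M} (\<lambda>N. {..N}))))"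
        by (rule summable_on_subset_banach[OF durfee4_summable[OF p]]) simp
      ultimately show "(\<lambda>(M, N, l). durfee4 p y (l + nat A, l + nat (- A), M - N, N - l)) summable_on
          (Sigma UNIV (\<lambda>M. Sigma {..M} (\<lambda>N. {..N})))"
        by (simp add: summable_on_reindex comp_def case_prod_unfold)
    qed
    then show "((\<lambda>x. case (A, x) of (A, M, N, l) \<Rightarrow> durfee4 p y (l + nat A, l + nat (- A), M - N, N - l))
        has_sum Q powi A\<^sup>2 * y powi A * (1 / qinf Q Q)) (Sigma UNIV (\<lambda>M. Sigma {..M} (\<lambda>N. {..N})))"
      by simp
  qed
qed

text \<open>The coefficients of (-p b z; p^2)_inf in z. Formal series allow such products to be
  compared coefficientwise.\<close>

definition euler_fps :: "'a::field \<Rightarrow> 'a \<Rightarrow> 'a fps" where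
  "euler_fps p b = Abs_fps (\<lambda>m. p ^ m\<^sup>2 * b ^ m / qpoch (p\<^sup>2) (p\<^sup>2) m)"

text \<open>Grouping by m = i + k + j makes the coupling factor constant on each group, so the group
  sums are coefficients of a product of three Euler series.\<close>

lemma durfee4_has_sum_fps:
  fixes p y :: "'a::{real_normed_field,banach}"
  assumes p: "norm p < 1"
  shows "((\<lambda>(m, n). p ^ (m + 2 * n)\<^sup>2 * fps_nth (euler_fps p y * (euler_fps p (1 / y) * euler_fps p 1)) m / qpoch (p\<^sup>2) (p\<^sup>2) n)
     has_sum infsum (durfee4 p y) UNIV) UNIV"
proof -
  let ?P = "qpoch (p\<^sup>2) (p\<^sup>2)" and ?E = "euler_fps p"
  have "(durfee4 p y has_sum infsum (durfee4 p y) UNIV) UNIV"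
    by (rule has_sum_infsum[OF durfee4_summable[OF p]])
  then have *: "((\<lambda>((m, n), i, k). durfee4 p y (i, k, m - i - k, n)) has_sum infsum (durfee4 p y) UNIV)
     (Sigma UNIV (\<lambda>(m, n). Sigma {0..m} (\<lambda>i. {0..m - i})))"
    by (rule has_sum_reindex_bij_witness[where j = "\<lambda>(i, k, j, n). ((i + k + j, n), i, k)"
        and i = "\<lambda>((m, n), i, k). (i, k, m - i - k, n)", THEN iffD1, rotated -1]) auto
  have **: "((\<lambda>z. case (x, z) of ((m, n), i, k) \<Rightarrow> durfee4 p y (i, k, m - i - k, n)) has_sum
        (case x of (m, n) \<Rightarrow> p ^ (m + 2 * n)\<^sup>2 * fps_nth (?E y * (?E (1 / y) * ?E 1)) m / ?P n))
        (case x of (m, n) \<Rightarrow> Sigma {0..m} (\<lambda>i. {0..m - i}))" for x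
  proof -
    obtain m n where x: "x = (m, n)" by (cases x)
    have "(\<Sum>(i, k)\<in>Sigma {0..m} (\<lambda>i. {0..m - i}). durfee4 p y (i, k, m - i - k, n))
        = (\<Sum>i=0..m. \<Sum>k=0..m - i. durfee4 p y (i, k, m - i - k, n))"
      by (rule sum.Sigma[symmetric]) auto
    also have "\<dots> = (\<Sum>i=0..m. \<Sum>k=0..m - i. p ^ (m + 2 * n)\<^sup>2 / ?P n *
        (fps_nth (?E y) i * (fps_nth (?E (1 / y)) k * fps_nth (?E 1) (m - i - k))))"
    proof (intro sum.cong refl)
      fix i k assume "i \<in> {0..m}" "k \<in> {0..m - i}"
      then have "i + k + (m - i - k) = m" by auto
      then show "durfee4 p y (i, k, m - i - k, n) = p ^ (m + 2 * n)\<^sup>2 / ?P n *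
        (fps_nth (?E y) i * (fps_nth (?E (1 / y)) k * fps_nth (?E 1) (m - i - k)))"
        by (simp add: durfee4_def euler_fps_def power_add) (simp add: mult_ac)
    qed
    also have "\<dots> = p ^ (m + 2 * n)\<^sup>2 / ?P n * fps_nth (?E y * (?E (1 / y) * ?E 1)) m"
      by (simp only: fps_mult_nth sum_distrib_left)
    finally show ?thesis
      unfolding x by (intro has_sum_finiteI) (auto simp: case_prod_unfold)
  qed
  show ?thesis
    by (rule has_sum_SigmaD[OF *]) (use ** in \<open>simp add: case_prod_unfold\<close>)
qed

text \<open>Formal counterpart of the functional equation in \<open>euler_has_sum\<close>: the first
  factor 1 + p b z of the product is split off.\<close>

lemma euler_fps_step:
  fixes p b :: "'a::real_normed_field"
  assumes "norm p < 1"
  shows "euler_fps p b = (1 + fps_const (p * b) * fps_X) * euler_fps p (b * p\<^sup>2)"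
proof (rule fps_ext)
  fix n
  have Q: "norm (p\<^sup>2) < 1" using assms by (simp add: norm_power power_less_one_iff)
  show "fps_nth (euler_fps p b) n = fps_nth ((1 + fps_const (p * b) * fps_X) * euler_fps p (b * p\<^sup>2)) n"
  proof (cases n)
    case 0
    then show ?thesis by (simp add: euler_fps_def)
  next
    case (Suc i)
    define u where "u = 1 - (p\<^sup>2) ^ Suc i"
    have u: "u \<noteq> 0" unfolding u_def by (rule one_minus_power_neq_0[OF Q])
    have P: "qpoch (p\<^sup>2) (p\<^sup>2) (Suc i) = qpoch (p\<^sup>2) (p\<^sup>2) i * u" by (simp add: qpoch_Suc u_def)
    have e: "p ^ (Suc i)\<^sup>2 = p * (p\<^sup>2) ^ i * p ^ i\<^sup>2"
    proof -
      have "(Suc i)\<^sup>2 = Suc (2 * i + i\<^sup>2)" by (simp add: power2_eq_square)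
      then show ?thesis by (simp add: power_add power_mult)
    qed
    have "fps_nth ((1 + fps_const (p * b) * fps_X) * euler_fps p (b * p\<^sup>2)) (Suc i)
       = p ^ (Suc i)\<^sup>2 * (b * p\<^sup>2) ^ Suc i / qpoch (p\<^sup>2) (p\<^sup>2) (Suc i)
         + p * b * (p ^ i\<^sup>2 * (b * p\<^sup>2) ^ i / qpoch (p\<^sup>2) (p\<^sup>2) i)"
      by (simp add: distrib_right mult.assoc euler_fps_def del: power_Suc)
    also have "p * b * (p ^ i\<^sup>2 * (b * p\<^sup>2) ^ i / qpoch (p\<^sup>2) (p\<^sup>2) i) = p ^ (Suc i)\<^sup>2 * b ^ Suc i * u / qpoch (p\<^sup>2) (p\<^sup>2) (Suc i)"
      unfolding e P using u by (simp add: power_mult_distrib)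
    also have "p ^ (Suc i)\<^sup>2 * (b * p\<^sup>2) ^ Suc i / qpoch (p\<^sup>2) (p\<^sup>2) (Suc i)
         + p ^ (Suc i)\<^sup>2 * b ^ Suc i * u / qpoch (p\<^sup>2) (p\<^sup>2) (Suc i) = p ^ (Suc i)\<^sup>2 * b ^ Suc i / qpoch (p\<^sup>2) (p\<^sup>2) (Suc i)"
      unfolding add_divide_distrib[symmetric] u_def power_mult_distrib by (simp add: algebra_simps del: power_Suc)
    finally show ?thesis by (simp add: Suc euler_fps_def del: power_Suc)
  qed
qed

text \<open>Splitting 1 + r z off the series with parameter 1 / q turns the parameters q, 1 / q, 1
  into q, q^2, 1, which are q times the original ones. Hence H z = (1 + r z) H (q z), and with
  constant term 1 this recurrence has only the coefficients of (-r z; q)_inf as solution.\<close>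

lemma euler_fps_triple:
  fixes r :: "'a::real_normed_field"
  assumes r: "norm r < 1" "r \<noteq> 0"
  defines "q \<equiv> r\<^sup>2" and "p \<equiv> r ^ 3"
  shows "euler_fps p q * (euler_fps p (1 / q) * euler_fps p 1) = Abs_fps (\<lambda>m. r ^ m\<^sup>2 / qpoch q q m)"
    (is "?H = _")
proof -
  let ?E = "euler_fps p"
  have p: "norm p < 1" using r by (simp add: p_def norm_power power_less_one_iff)
  have q: "norm q < 1" "q \<noteq> 0" using r by (simp_all add: q_def norm_power power_less_one_iff)
  have pw: "p * (1 / q) = r" "1 / q * p\<^sup>2 = q\<^sup>2"
    using r by (simp_all add: p_def q_def field_simps power2_eq_square power3_eq_cube)
  have H': "?E (q\<^sup>2) * (?E 1 * ?E q) = ?H oo (fps_const q * fps_X)"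
  proof -
    have "?E b oo (fps_const q * fps_X) = ?E (b * q)" for b
      by (rule fps_ext) (simp add: euler_fps_def power_mult_distrib)
    then show ?thesis using q by (simp add: fps_compose_mult_distrib power2_eq_square)
  qed
  have "?H = (1 + fps_const r * fps_X) * (?E (q\<^sup>2) * (?E 1 * ?E q))"
    unfolding euler_fps_step[OF p, of "1 / q"] pw by (simp add: mult_ac)
  then have step: "?H = (1 + fps_const r * fps_X) * (?H oo (fps_const q * fps_X))" unfolding H' .
  have "fps_nth ?H m = r ^ m\<^sup>2 / qpoch q q m" for m
  proof (induction m)
    case 0
    then show ?case by (simp add: euler_fps_def)
  next
    case (Suc m)
    define u where "u = 1 - q ^ Suc m"
    have u: "u \<noteq> 0" unfolding u_def by (rule one_minus_power_neq_0[OF q(1)])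
    have P: "qpoch q q (Suc m) = qpoch q q m * u" by (simp add: qpoch_Suc u_def)
    have e: "r ^ (Suc m)\<^sup>2 = r * q ^ m * r ^ m\<^sup>2"
    proof -
      have "(Suc m)\<^sup>2 = Suc (2 * m + m\<^sup>2)" by (simp add: power2_eq_square)
      then show ?thesis by (simp add: power_add power_mult q_def)
    qed
    have "fps_nth ?H (Suc m) = fps_nth ((1 + fps_const r * fps_X) * (?H oo (fps_const q * fps_X))) (Suc m)"
      by (rule arg_cong[OF step])
    also have "\<dots> = q ^ Suc m * fps_nth ?H (Suc m) + r * (q ^ m * fps_nth ?H m)"
      by (simp add: distrib_right mult.assoc del: power_Suc fps_mult_nth_1)
    finally have "fps_nth ?H (Suc m) * u = r * q ^ m * fps_nth ?H m" by (simp add: u_def algebra_simps)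
    then have "fps_nth ?H (Suc m) = r * q ^ m * fps_nth ?H m / u" using u by (simp add: eq_divide_eq)
    then show ?case unfolding Suc.IH P e by (simp add: mult_ac)
  qed
  then show ?thesis by (intro fps_ext) simp
qed

section \<open>The two double sums as theta quotients\<close>

lemma q_poch_eq_qpoch: "q_poch a q n = qpoch a q n"
  by (simp add: q_poch_def qpoch_def)

text \<open>After the factor 1 + z / r is split off, the parameters become q^2, q, 1, the q-dilate
  of the previous triple. The two terms of this factor produce the sums of \<open>U\<close> and
  \<open>V\<close> in \<open>a2_theta\<close>.\<close>

lemma euler_fps_triple_shifted:
  fixes r :: "'a::real_normed_field"
  assumes r: "norm r < 1" "r \<noteq> 0"
  defines "q \<equiv> r\<^sup>2" and "p \<equiv> r ^ 3"
  shows "euler_fps p (q\<^sup>2) * (euler_fps p (1 / q\<^sup>2) * euler_fps p 1)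
       = (1 + fps_const (1 / r) * fps_X) * Abs_fps (\<lambda>m. q ^ m * (r ^ m\<^sup>2 / qpoch q q m))"
proof -
  let ?E = "euler_fps p"
  have p: "norm p < 1" using r by (simp add: p_def norm_power power_less_one_iff)
  have q: "q \<noteq> 0" using r by (simp add: q_def)
  have pw: "p * (1 / q\<^sup>2) = 1 / r" "1 / q\<^sup>2 * p\<^sup>2 = q"
    using r by (simp_all add: p_def q_def field_simps power2_eq_square power3_eq_cube)
  have E: "?E b oo (fps_const q * fps_X) = ?E (b * q)" for b
    by (rule fps_ext) (simp add: euler_fps_def power_mult_distrib)
  have "?E (q\<^sup>2) * (?E 1 * ?E q) = (?E q * (?E (1 / q) * ?E 1)) oo (fps_const q * fps_X)"
    using q by (simp add: fps_compose_mult_distrib power2_eq_square E)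
  also have "\<dots> = Abs_fps (\<lambda>m. q ^ m * (r ^ m\<^sup>2 / qpoch q q m))"
    using euler_fps_triple[OF r, folded q_def p_def] by (simp add: fps_compose_linear)
  finally have H': "?E (q\<^sup>2) * (?E 1 * ?E q) = Abs_fps (\<lambda>m. q ^ m * (r ^ m\<^sup>2 / qpoch q q m))" .
  have "?E (q\<^sup>2) * (?E (1 / q\<^sup>2) * ?E 1) = (1 + fps_const (1 / r) * fps_X) * (?E (q\<^sup>2) * (?E 1 * ?E q))"
    unfolding euler_fps_step[OF p, of "1 / q\<^sup>2"] pw by (simp only: mult_ac)
  then show ?thesis unfolding H' .
qed

lemma power_cube_sqrt:
  fixes r :: "'a::comm_ring_1"
  shows "(r ^ 3) ^ (m + 2 * n)\<^sup>2 * r ^ m\<^sup>2 = (r\<^sup>2) ^ (2 * m\<^sup>2 + 6 * m * n + 6 * n\<^sup>2)"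
proof -
  have "3 * (m + 2 * n)\<^sup>2 + m\<^sup>2 = 2 * (2 * m\<^sup>2 + 6 * m * n + 6 * n\<^sup>2)"
    by (simp add: power2_eq_square algebra_simps)
  then show ?thesis by (metis power_mult power_add)
qed

lemma powi_theta_exponent:
  fixes q :: "'a::field"
  assumes "q \<noteq> 0"
  shows "(q ^ 3) powi A\<^sup>2 * (q ^ k) powi A = q powi (3 * A\<^sup>2 + int k * A)"
proof -
  have "(q ^ 3) powi A\<^sup>2 = q powi (3 * A\<^sup>2)" "(q ^ k) powi A = q powi (int k * A)"
    using power_int_mult[of q "int 3" "A\<^sup>2"] power_int_mult[of q "int k" A] by (simp_all only: power_int_of_nat) simp_all
  then show ?thesis using assms by (simp add: power_int_add)
qed

text \<open>The sum of \<open>durfee4\<close> with y = q is evaluated in two ways: grouped by i + k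
  + j it is \<open>a1 q\<close>, sorted by i - k it is a theta series over (q^3; q^3)_inf.\<close>

theorem a1_theta:
  assumes q: "norm q < 1" "q \<noteq> 0"
  shows "((\<lambda>A::int. q powi (3 * A\<^sup>2 + A)) has_sum a1 q * qinf (q ^ 3) (q ^ 3)) UNIV"
proof -
  define r where "r = csqrt q"
  have rq: "r\<^sup>2 = q" by (simp add: r_def)
  have "(norm r)\<^sup>2 < 1" using q(1) unfolding rq[symmetric] norm_power .
  then have r: "norm r < 1" "r \<noteq> 0" using rq q(2) by (auto simp: abs_square_less_1)
  let ?p = "r ^ 3"
  have p: "norm ?p < 1" using r by (simp add: norm_power power_less_one_iff)
  have pq: "?p\<^sup>2 = q ^ 3" by (simp add: rq[symmetric] flip: power_mult)
  define S where "S = infsum (durfee4 ?p q) UNIV"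
  have "((\<lambda>(m, n). ?p ^ (m + 2 * n)\<^sup>2 * (r ^ m\<^sup>2 / qpoch q q m) / qpoch (q ^ 3) (q ^ 3) n) has_sum S) UNIV"
    using durfee4_has_sum_fps[OF p, of q, unfolded pq] euler_fps_triple[OF r, unfolded rq] by (simp add: S_def)
  moreover have "?p ^ (m + 2 * n)\<^sup>2 * (r ^ m\<^sup>2 / qpoch q q m) / qpoch (q ^ 3) (q ^ 3) n
      = q ^ (2 * m\<^sup>2 + 6 * m * n + 6 * n\<^sup>2) / (q_poch q q m * q_poch (q ^ 3) (q ^ 3) n)" for m n
    using power_cube_sqrt[of r m n] by (simp add: rq q_poch_eq_qpoch)
  ultimately have "a1 q = S" unfolding a1_def by (intro infsumI) simp
  moreover have "((\<lambda>A. (q ^ 3) powi A\<^sup>2 * q powi A * (1 / qinf (q ^ 3) (q ^ 3))) has_sum S) UNIV"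
    using durfee4_has_sum[OF p q(2)] unfolding pq S_def .
  from has_sum_cmult_left[OF this, of "qinf (q ^ 3) (q ^ 3)"]
  have "((\<lambda>A. (q ^ 3) powi A\<^sup>2 * q powi A) has_sum S * qinf (q ^ 3) (q ^ 3)) UNIV"
    using qinf_neq_0[of "q ^ 3"] q by (simp add: norm_power power_less_one_iff)
  ultimately show ?thesis using powi_theta_exponent[OF q(2), of _ 1] by simp
qed

text \<open>The missing first row is filled with zeros, so that a shifted and an unshifted series
  can be combined term by term.\<close>

lemma has_sum_shift_fst:
  assumes "(g has_sum S) UNIV"
  shows "((\<lambda>(m, n). case m of 0 \<Rightarrow> 0 | Suc m' \<Rightarrow> g (m', n)) has_sum S) UNIV"
proof -
  let ?h = "\<lambda>(m, n). (Suc m, n)" and ?f = "\<lambda>(m, n). case m of 0 \<Rightarrow> 0 | Suc m' \<Rightarrow> g (m', n)"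
  have "inj ?h" by (auto simp: inj_on_def)
  moreover have "?f \<circ> ?h = g" by auto
  ultimately have "(?f has_sum S) (range ?h)" using assms has_sum_reindex[of ?h UNIV ?f S] by metis
  moreover have "?f x = 0" if "x \<notin> range ?h" for x
    using that by (cases x) (auto split: nat.splits simp: image_iff)
  ultimately show ?thesis by (subst has_sum_cong_neutral[where S = "range ?h" and g = ?f and f = ?f, symmetric]) auto
qed

lemma has_sum_shift_snd:
  assumes "(g has_sum S) UNIV"
  shows "((\<lambda>(m, n). case n of 0 \<Rightarrow> 0 | Suc n' \<Rightarrow> g (m, n')) has_sum S) UNIV"
proof -
  let ?h = "\<lambda>(m, n). (m, Suc n)" and ?f = "\<lambda>(m, n). case n of 0 \<Rightarrow> 0 | Suc n' \<Rightarrow> g (m, n')"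
  have "inj ?h" by (auto simp: inj_on_def)
  moreover have "?f \<circ> ?h = g" by auto
  ultimately have "(?f has_sum S) (range ?h)" using assms has_sum_reindex[of ?h UNIV ?f S] by metis
  moreover have "?f x = 0" if "x \<notin> range ?h" for x
    using that by (cases x) (auto split: nat.splits simp: image_iff)
  ultimately show ?thesis by (subst has_sum_cong_neutral[where S = "range ?h" and g = ?f and f = ?f, symmetric]) auto
qed

lemma double_sum_summable:
  fixes q :: "'a::{real_normed_field,banach}"
  assumes q: "norm q < 1" and e: "\<And>m n. m + n \<le> e m n"
  shows "(\<lambda>(m, n). q ^ e m n / (qpoch q q m * qpoch (q ^ 3) (q ^ 3) n)) summable_on UNIV"
proof -
  have q3: "norm (q ^ 3) < 1" using q by (simp add: norm_power power_less_one_iff)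
  obtain C where C: "C > 0" "\<And>n. norm (1 / qpoch q q n) \<le> C" using qpoch_inverse_bounded[OF q] by blast
  obtain D where D: "D > 0" "\<And>n. norm (1 / qpoch (q ^ 3) (q ^ 3) n) \<le> D" using qpoch_inverse_bounded[OF q3] by blast
  have "(\<lambda>n. norm q ^ n) summable_on UNIV"
    using q by (intro norm_summable_imp_summable_on) (simp add: summable_geometric)
  then have "(\<lambda>m. norm (norm q ^ m)) summable_on UNIV" by simp
  from summable_on_cmult_right[OF summable_on_mult_Times[OF this this], of "C * D"]
  have s: "(\<lambda>x. C * D * (case x of (m, n) \<Rightarrow> norm q ^ (m + n))) summable_on UNIV"
    by (simp add: case_prod_unfold power_add)
  have "(\<lambda>x. norm (case x of (m, n) \<Rightarrow> q ^ e m n / (qpoch q q m * qpoch (q ^ 3) (q ^ 3) n))) summable_on UNIV"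
  proof (rule Infinite_Sum.abs_summable_on_comparison_test'[OF s])
    fix x :: "nat \<times> nat"
    obtain m n where x: "x = (m, n)" by (cases x)
    have "norm (1 / qpoch q q m) * norm (1 / qpoch (q ^ 3) (q ^ 3) n) * norm q ^ e m n \<le> C * D * norm q ^ (m + n)"
      using q e C D by (intro mult_mono power_decreasing) auto
    then show "norm (case x of (m, n) \<Rightarrow> q ^ e m n / (qpoch q q m * qpoch (q ^ 3) (q ^ 3) n))
        \<le> C * D * (case x of (m, n) \<Rightarrow> norm q ^ (m + n))"
      by (simp add: x norm_mult norm_divide norm_power)
  qed
  then show ?thesis by (rule abs_summable_summable)
qed

text \<open>The same two evaluations with y = q^2. The linear factor 1 + z / r leaves two double
  sums, which have to be rearranged into the summand of \<open>a2\<close>.\<close>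

theorem a2_theta:
  assumes q: "norm q < 1" "q \<noteq> 0"
  shows "((\<lambda>A::int. q powi (3 * A\<^sup>2 + 2 * A)) has_sum a2 q * qinf (q ^ 3) (q ^ 3)) UNIV"
proof -
  define r where "r = csqrt q"
  have rq: "r\<^sup>2 = q" by (simp add: r_def)
  have "(norm r)\<^sup>2 < 1" using q(1) unfolding rq[symmetric] norm_power .
  then have r: "norm r < 1" "r \<noteq> 0" using rq q(2) by (auto simp: abs_square_less_1)
  let ?p = "r ^ 3"
  have p: "norm ?p < 1" using r by (simp add: norm_power power_less_one_iff)
  have pq: "?p\<^sup>2 = q ^ 3" by (simp add: rq[symmetric] flip: power_mult)
  have q3: "norm (q ^ 3) < 1" using q by (simp add: norm_power power_less_one_iff)
  define S where "S = infsum (durfee4 ?p (q\<^sup>2)) UNIV"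
  let ?P = "qpoch q q" and ?R = "qpoch (q ^ 3) (q ^ 3)"
  define E where "E m n = 2 * m\<^sup>2 + 6 * m * n + 6 * n\<^sup>2" for m n :: nat
  define t where "t e = (\<lambda>(m, n). q ^ e m n / (?P m * ?R n))" for e
  \<comment> \<open>The triple product identity yields \<open>\<Sum> U + \<Sum> V\<close>, whereas \<open>a2\<close> is \<open>\<Sum> U' + \<Sum> V'\<close>; a shift of \<open>n\<close>
    and a shift of \<open>m\<close> show that both \<open>\<Sum> U - \<Sum> U'\<close> and \<open>\<Sum> V' - \<Sum> V\<close> equal \<open>\<Sum> W\<close>.\<close>
  define U V W U' V'
    where "U = t (\<lambda>m n. E m n + m)" and "V = t (\<lambda>m n. E m n + 4 * m + 6 * n + 1)"
      and "W = t (\<lambda>m n. E m n + 7 * m + 12 * n + 6)"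
      and "U' = t (\<lambda>m n. E m n + m + 3 * n)" and "V' = t (\<lambda>m n. E m n + 3 * m + 6 * n + 1)"
  have mn: "m + n \<le> E m n" for m n
  proof -
    have "m \<le> m\<^sup>2" "n \<le> n\<^sup>2" by (simp_all add: power2_eq_square)
    then show ?thesis unfolding E_def by linarith
  qed
  have t: "(t e has_sum infsum (t e) UNIV) UNIV" if "\<And>m n. E m n \<le> e m n" for e
    unfolding t_def using double_sum_summable[OF q(1)] that mn order_trans by (intro has_sum_infsum) blast
  have hU: "(U has_sum infsum U UNIV) UNIV" and hV: "(V has_sum infsum V UNIV) UNIV"
    and hW: "(W has_sum infsum W UNIV) UNIV"
    unfolding U_def V_def W_def by (rule t, simp)+
  have nz: "?P m \<noteq> 0" "?R m \<noteq> 0" for m using qpoch_neq_0[OF q(1)] qpoch_neq_0[OF q3] by auto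
  have P: "?P (Suc m) = ?P m * (1 - q ^ Suc m)" for m by (simp add: qpoch_Suc)
  have R: "?R (Suc n) = ?R n * (1 - q ^ (3 * Suc n))" for n by (simp only: qpoch_Suc power_mult power_Suc)

  have "U' (m, n) = U (m, n) - (case n of 0 \<Rightarrow> 0 | Suc n' \<Rightarrow> W (m, n'))" for m n
  proof (cases n)
    case 0
    then show ?thesis by (simp add: U_def U'_def t_def)
  next
    case (Suc k)
    \<comment> \<open>\<open>W\<close> is chosen so that its exponent at (m, n - 1) is that of
      \<open>U\<close> at (m, n), and its exponent at (m - 1, n) is that of \<open>V'\<close> at (m,
      n).\<close>
    have e: "E m k + 7 * m + 12 * k + 6 = E m n + m"
      by (simp add: E_def Suc power2_eq_square algebra_simps)
    define u where "u = 1 - q ^ (3 * Suc k)"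
    have R': "?R n = ?R k * u" using R[of k] by (simp add: Suc u_def)
    have u: "u \<noteq> 0" using nz(2)[of n] R' by auto
    have "W (m, k) = q ^ (E m n + m) * u / (?P m * ?R n)"
      using u nz by (simp add: W_def t_def e R')
    moreover have "U' (m, n) = q ^ (E m n + m) * (1 - u) / (?P m * ?R n)"
      by (simp add: U'_def t_def u_def Suc power_add del: power_Suc mult_Suc_right)
    ultimately show ?thesis
      by (simp add: Suc U_def t_def right_diff_distrib diff_divide_distrib)
  qed
  then have U': "U' = (\<lambda>x. U x - (\<lambda>(m, n). case n of 0 \<Rightarrow> 0 | Suc n' \<Rightarrow> W (m, n')) x)" by auto
  have hU': "(U' has_sum infsum U UNIV - infsum W UNIV) UNIV"
    unfolding U' diff_conv_add_uminus
    by (intro has_sum_add hU has_sum_uminusI has_sum_shift_snd hW)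

  have "V' (m, n) = V (m, n) + (case m of 0 \<Rightarrow> 0 | Suc m' \<Rightarrow> W (m', n))" for m n
  proof (cases m)
    case 0
    then show ?thesis by (simp add: V_def V'_def t_def)
  next
    case (Suc k)
    have e: "E k n + 7 * k + 12 * n + 6 = E m n + 3 * m + 6 * n + 1"
      by (simp add: E_def Suc power2_eq_square algebra_simps)
    define u where "u = 1 - q ^ Suc k"
    have P': "?P m = ?P k * u" using P[of k] by (simp add: Suc u_def)
    have u: "u \<noteq> 0" using nz(1)[of m] P' by auto
    have "W (k, n) = q ^ (E m n + 3 * m + 6 * n + 1) * u / (?P m * ?R n)"
      using u nz by (simp add: W_def t_def e P')
    moreover have "V (m, n) = q ^ (E m n + 3 * m + 6 * n + 1) * (1 - u) / (?P m * ?R n)"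
    proof -
      have "E m n + 4 * m + 6 * n + 1 = (E m n + 3 * m + 6 * n + 1) + Suc k" by (simp add: Suc)
      then have e: "q ^ (E m n + 4 * m + 6 * n + 1) = q ^ (E m n + 3 * m + 6 * n + 1) * q ^ Suc k"
        by (simp only: power_add[symmetric])
      show ?thesis unfolding V_def t_def prod.case e u_def by simp
    qed
    moreover have "(case m of 0 \<Rightarrow> 0 | Suc m' \<Rightarrow> W (m', n)) = W (k, n)" by (simp add: Suc)
    moreover have "V' (m, n) = q ^ (E m n + 3 * m + 6 * n + 1) / (?P m * ?R n)" by (simp add: V'_def t_def)
    ultimately show ?thesis by (simp add: right_diff_distrib diff_divide_distrib)
  qed
  then have V': "V' = (\<lambda>x. V x + (\<lambda>(m, n). case m of 0 \<Rightarrow> 0 | Suc m' \<Rightarrow> W (m', n)) x)" by auto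
  have hV': "(V' has_sum infsum V UNIV + infsum W UNIV) UNIV"
    unfolding V' by (intro has_sum_add hV has_sum_shift_fst hW)

  have "a2 q = (infsum U UNIV - infsum W UNIV) + (infsum V UNIV + infsum W UNIV)"
  proof -
    have "(case x of (n1, n2) \<Rightarrow> q ^ (2 * n1\<^sup>2 + 6 * n1 * n2 + 6 * n2\<^sup>2 + n1 + 3 * n2) * (1 + q ^ (2 * n1 + 3 * n2 + 1))
       / (q_poch q q n1 * q_poch (q ^ 3) (q ^ 3) n2)) = U' x + V' x" for x
    proof -
      obtain m n where x: "x = (m, n)" by (cases x)
      have "E m n + 3 * m + 6 * n + 1 = (E m n + m + 3 * n) + (2 * m + 3 * n + 1)" by simp
      then have e: "q ^ (E m n + 3 * m + 6 * n + 1) = q ^ (E m n + m + 3 * n) * q ^ (2 * m + 3 * n + 1)"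
        by (simp only: power_add[symmetric])
      show ?thesis
        unfolding x U'_def V'_def t_def prod.case q_poch_eq_qpoch E_def[symmetric] e
        by (simp only: distrib_left mult_1_right add_divide_distrib)
    qed
    then have "a2 q = infsum (\<lambda>x. U' x + V' x) UNIV" unfolding a2_def by (intro infsum_cong)
    then show ?thesis using infsumI[OF has_sum_add[OF hU' hV']] by (simp only:)
  qed
  then have a2: "a2 q = infsum U UNIV + infsum V UNIV" by simp

  have "((\<lambda>(m, n). ?p ^ (m + 2 * n)\<^sup>2 * fps_nth ((1 + fps_const (1 / r) * fps_X) * Abs_fps (\<lambda>m. q ^ m * (r ^ m\<^sup>2 / ?P m))) m / ?R n)
      has_sum S) UNIV"
    using durfee4_has_sum_fps[OF p, of "q\<^sup>2"] euler_fps_triple_shifted[OF r] by (simp only: rq pq S_def)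
  moreover have "?p ^ (m + 2 * n)\<^sup>2 * fps_nth ((1 + fps_const (1 / r) * fps_X) * Abs_fps (\<lambda>m. q ^ m * (r ^ m\<^sup>2 / ?P m))) m / ?R n
      = U (m, n) + (case m of 0 \<Rightarrow> 0 | Suc m' \<Rightarrow> V (m', n))" for m n
  proof -
    have U: "?p ^ (m + 2 * n)\<^sup>2 * (q ^ m * (r ^ m\<^sup>2 / ?P m)) / ?R n = U (m, n)"
      using power_cube_sqrt[of r m n] by (simp add: U_def t_def E_def rq power_add)
    show ?thesis
    proof (cases m)
      case 0
      then show ?thesis using U by (simp add: distrib_right mult.assoc)
    next
      case (Suc k)
      \<comment> \<open>The index k = m - 1 has the opposite parity to m, so the exponent of r is
        odd; the single leftover r cancels the 1 / r of the linear factor.\<close>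
      have e: "3 * (m + 2 * n)\<^sup>2 + k\<^sup>2 = Suc (2 * (E k n + 3 * k + 6 * n + 1))"
        by (simp add: E_def Suc power2_eq_square algebra_simps)
      have "?p ^ (m + 2 * n)\<^sup>2 * r ^ k\<^sup>2 = r * q ^ (E k n + 3 * k + 6 * n + 1)"
        using arg_cong[OF e, of "\<lambda>e. r ^ e"] unfolding power_add power_mult rq power_Suc by simp
      note pr = this
      have V: "?p ^ (m + 2 * n)\<^sup>2 * (1 / r * (q ^ k * (r ^ k\<^sup>2 / ?P k))) / ?R n = V (k, n)"
      proof -
        have "E k n + 4 * k + 6 * n + 1 = (E k n + 3 * k + 6 * n + 1) + k" by simp
        then have e: "q ^ (E k n + 4 * k + 6 * n + 1) = q ^ (E k n + 3 * k + 6 * n + 1) * q ^ k"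
          by (simp only: power_add[symmetric])
        have "V (k, n) = q ^ (E k n + 3 * k + 6 * n + 1) * q ^ k / (?P k * ?R n)"
          unfolding V_def t_def prod.case e ..
        moreover have "?p ^ (m + 2 * n)\<^sup>2 * (1 / r * (q ^ k * (r ^ k\<^sup>2 / ?P k))) / ?R n
            = (?p ^ (m + 2 * n)\<^sup>2 * r ^ k\<^sup>2) / r * q ^ k / (?P k * ?R n)" by (simp add: mult_ac)
        ultimately show ?thesis unfolding pr using r by simp
      qed
      have c: "fps_nth ((1 + fps_const (1 / r) * fps_X) * Abs_fps (\<lambda>m. q ^ m * (r ^ m\<^sup>2 / ?P m))) m
        = q ^ m * (r ^ m\<^sup>2 / ?P m) + 1 / r * (q ^ k * (r ^ k\<^sup>2 / ?P k))"
        by (simp add: Suc distrib_right mult.assoc del: power_Suc)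
      show ?thesis unfolding c distrib_left add_divide_distrib U V by (simp add: Suc)
    qed
  qed
  ultimately have "((\<lambda>x. U x + (\<lambda>(m, n). case m of 0 \<Rightarrow> 0 | Suc m' \<Rightarrow> V (m', n)) x) has_sum S) UNIV"
    by (simp add: case_prod_unfold)
  moreover have "((\<lambda>x. U x + (\<lambda>(m, n). case m of 0 \<Rightarrow> 0 | Suc m' \<Rightarrow> V (m', n)) x) has_sum a2 q) UNIV"
    unfolding a2 by (intro has_sum_add hU has_sum_shift_fst hV)
  ultimately have "a2 q = S" using has_sum_unique by blast
  moreover have "((\<lambda>A. (q ^ 3) powi A\<^sup>2 * (q\<^sup>2) powi A * (1 / qinf (q ^ 3) (q ^ 3))) has_sum S) UNIV"
    using durfee4_has_sum[OF p, of "q\<^sup>2"] q(2) unfolding pq S_def by simp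
  from has_sum_cmult_left[OF this, of "qinf (q ^ 3) (q ^ 3)"]
  have "((\<lambda>A. (q ^ 3) powi A\<^sup>2 * (q\<^sup>2) powi A) has_sum S * qinf (q ^ 3) (q ^ 3)) UNIV"
    using qinf_neq_0[OF q3] by simp
  ultimately show ?thesis using powi_theta_exponent[OF q(2), of _ 2] by simp
qed

section \<open>Product forms of theta series\<close>

lemma norm_power_less_1:
  fixes q :: "'a::real_normed_div_algebra"
  assumes "norm q < 1" "n > 0"
  shows "norm (q ^ n) < 1"
  using assms by (simp add: norm_power power_less_one_iff)

lemma qinf_shift:
  fixes a q :: "'a::{real_normed_field,banach}"
  assumes "norm q < 1"
  shows "qinf a q = (1 - a) * qinf (a * q) q"
proof -
  have "qpoch a q (Suc n) = (1 - a) * qpoch (a * q) q n" for n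
    unfolding qpoch_def prod.lessThan_Suc_shift by (simp add: mult.assoc)
  then have "(\<lambda>n. qpoch a q (Suc n)) \<longlonglongrightarrow> (1 - a) * qinf (a * q) q"
    by (simp add: tendsto_mult_left qpoch_tendsto_qinf[OF assms])
  moreover have "(\<lambda>n. qpoch a q (Suc n)) \<longlonglongrightarrow> qinf a q"
    by (rule LIMSEQ_Suc[OF qpoch_tendsto_qinf[OF assms]])
  ultimately show ?thesis by (rule LIMSEQ_unique[rotated])
qed

lemma qinf_mult_minus:
  fixes a q :: "'a::{real_normed_field,banach}"
  assumes "norm q < 1"
  shows "qinf a q * qinf (- a) q = qinf (a\<^sup>2) (q\<^sup>2)"
proof -
  have "qpoch a q n * qpoch (- a) q n = qpoch (a\<^sup>2) (q\<^sup>2) n" for n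
    unfolding qpoch_def prod.distrib[symmetric]
    by (intro prod.cong refl) (simp add: algebra_simps power2_eq_square power_mult_distrib)
  moreover have "(\<lambda>n. qpoch a q n * qpoch (- a) q n) \<longlonglongrightarrow> qinf a q * qinf (- a) q"
    by (intro tendsto_mult qpoch_tendsto_qinf assms)
  moreover have "qpoch (a\<^sup>2) (q\<^sup>2) \<longlonglongrightarrow> qinf (a\<^sup>2) (q\<^sup>2)"
    using assms by (intro qpoch_tendsto_qinf norm_power_less_1) auto
  ultimately show ?thesis using LIMSEQ_unique by simp
qed

lemma qpoch_add: "qpoch a q (k + m) = qpoch a q k * (\<Prod>j<m. 1 - a * q ^ (k + j))"
  by (induction m) (simp_all add: qpoch_Suc mult_ac)

lemma qinf_split:
  fixes a q :: "'a::{real_normed_field,banach}"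
  assumes q: "norm q < 1" and m: "m > 0"
  shows "qinf a q = (\<Prod>j<m. qinf (a * q ^ j) (q ^ m))"
proof -
  have "qpoch a q (n * m) = (\<Prod>j<m. qpoch (a * q ^ j) (q ^ m) n)" for n
  proof (induction n)
    case (Suc n)
    have "qpoch a q (Suc n * m) = qpoch a q (n * m) * (\<Prod>j<m. 1 - a * q ^ (n * m + j))"
      using qpoch_add[of a q "n * m" m] by (simp add: add.commute)
    also have "(\<Prod>j<m. 1 - a * q ^ (n * m + j)) = (\<Prod>j<m. 1 - a * q ^ j * (q ^ m) ^ n)"
      by (simp add: power_add power_mult mult_ac)
    finally show ?case by (simp add: Suc qpoch_Suc prod.distrib)
  qed simp
  moreover have "(\<lambda>n. qpoch a q (n * m)) \<longlonglongrightarrow> qinf a q"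
    using LIMSEQ_subseq_LIMSEQ[OF qpoch_tendsto_qinf[OF q], of "\<lambda>n. n * m" a] m
    by (simp add: strict_mono_def comp_def)
  moreover have "(\<lambda>n. \<Prod>j<m. qpoch (a * q ^ j) (q ^ m) n) \<longlonglongrightarrow> (\<Prod>j<m. qinf (a * q ^ j) (q ^ m))"
    by (intro tendsto_prod qpoch_tendsto_qinf norm_power_less_1 q m)
  ultimately show ?thesis using LIMSEQ_unique by simp
qed

text \<open>Dedekind's eta function without its factor q^(1/24); the products below are rewritten as
  quotients of these.\<close>

abbreviation euler_phi :: "'a::{real_normed_field,banach} \<Rightarrow> 'a" where
  "euler_phi q \<equiv> qinf q q"

text \<open>These rest on (1 - y) (1 + y) = 1 - y^2 for each factor and on splitting the exponents
  by parity.\<close>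

lemma qinf_products:
  fixes x :: "'a::{real_normed_field,banach}"
  assumes x: "norm x < 1"
  shows "qinf (- x) x = euler_phi (x\<^sup>2) / euler_phi x"
    and "qinf x (x\<^sup>2) = euler_phi x / euler_phi (x\<^sup>2)"
    and "qinf (- x) (x\<^sup>2) = (euler_phi (x\<^sup>2))\<^sup>2 / (euler_phi x * euler_phi (x ^ 4))"
proof -
  have nz: "euler_phi (x ^ Suc n) \<noteq> 0" for n by (intro qinf_neq_0 norm_power_less_1 x) simp
  have nz1: "euler_phi x \<noteq> 0" "euler_phi (x\<^sup>2) \<noteq> 0" "euler_phi (x ^ 4) \<noteq> 0"
    using nz[of 0] nz[of 1] nz[of 3] by (simp_all add: numeral_2_eq_2 eval_nat_numeral)
  have neg: "qinf (- x) x = euler_phi (x\<^sup>2) / euler_phi x" if "norm x < 1" "euler_phi x \<noteq> 0" for x :: 'a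
    using qinf_mult_minus[OF that(1), of x] that(2) by (simp add: field_simps)
  show "qinf (- x) x = euler_phi (x\<^sup>2) / euler_phi x" by (rule neg[OF x nz1(1)])
  show "qinf x (x\<^sup>2) = euler_phi x / euler_phi (x\<^sup>2)"
    using qinf_split[OF x, of 2 x] nz1 by (simp add: numeral_2_eq_2 field_simps)
  have "qinf (- x) x = qinf (- x) (x\<^sup>2) * qinf (- (x\<^sup>2)) (x\<^sup>2)"
    using qinf_split[OF x, of 2 "- x"] by (simp add: numeral_2_eq_2)
  moreover have "qinf (- (x\<^sup>2)) (x\<^sup>2) = euler_phi (x ^ 4) / euler_phi (x\<^sup>2)"
    using neg[of "x\<^sup>2"] x nz1 by (simp add: norm_power_less_1)
  ultimately show "qinf (- x) (x\<^sup>2) = (euler_phi (x\<^sup>2))\<^sup>2 / (euler_phi x * euler_phi (x ^ 4))"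
    using neg[OF x nz1(1)] nz1 by (simp add: field_simps power2_eq_square)
qed

text \<open>The cases z = 1, z = -1 and z = p of the triple product, that is, the theta constants
  theta_3, theta_4 and p^(-1/4) theta_2 with nome p.\<close>

lemma theta_products:
  fixes p :: "'a::{real_normed_field,banach}"
  assumes p: "norm p < 1" "p \<noteq> 0"
  shows "((\<lambda>A::int. p powi A\<^sup>2) has_sum euler_phi (p\<^sup>2) ^ 5 / (euler_phi p * euler_phi (p ^ 4))\<^sup>2) UNIV"
    and "((\<lambda>A::int. p powi A\<^sup>2 * (- 1) powi A) has_sum (euler_phi p)\<^sup>2 / euler_phi (p\<^sup>2)) UNIV"
    and "((\<lambda>A::int. p powi (A\<^sup>2 + A)) has_sum 2 * (euler_phi (p ^ 4))\<^sup>2 / euler_phi (p\<^sup>2)) UNIV"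
proof -
  have p2: "norm (p\<^sup>2) < 1" using p by (simp add: norm_power_less_1)
  have nz: "euler_phi p \<noteq> 0" "euler_phi (p\<^sup>2) \<noteq> 0" "euler_phi (p ^ 4) \<noteq> 0"
    by (intro qinf_neq_0 norm_power_less_1 p; simp)+
  note J = jacobi_triple_product[OF p(1)] and P = qinf_products[OF p(1)]
  have "(a\<^sup>2 / (b * c)) * (a\<^sup>2 / (b * c)) * a = a ^ 5 / (b * c)\<^sup>2" for a b c :: 'a
    by (simp add: power2_eq_square eval_nat_numeral mult_ac)
  then show "((\<lambda>A::int. p powi A\<^sup>2) has_sum euler_phi (p\<^sup>2) ^ 5 / (euler_phi p * euler_phi (p ^ 4))\<^sup>2) UNIV"
    using J[of 1] by (simp add: P(3))
  have v: "euler_phi p / euler_phi (p\<^sup>2) * (euler_phi p / euler_phi (p\<^sup>2)) * euler_phi (p\<^sup>2)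
      = (euler_phi p)\<^sup>2 / euler_phi (p\<^sup>2)"
    using nz by (simp add: power2_eq_square)
  have "- p * - 1 = p" "- p / - 1 = p" by simp_all
  from J[of "- 1", unfolded this P(2) v]
  show "((\<lambda>A::int. p powi A\<^sup>2 * (- 1) powi A) has_sum (euler_phi p)\<^sup>2 / euler_phi (p\<^sup>2)) UNIV"
    by simp
  \<comment> \<open>The factor with exponent zero is 1 + 1, the origin of the 2.\<close>
  have "qinf (- 1) (p\<^sup>2) = 2 * (euler_phi (p ^ 4) / euler_phi (p\<^sup>2))"
    using qinf_shift[OF p2, of "- 1"] qinf_products(1)[OF p2] by simp
  moreover have "qinf (- p * p) (p\<^sup>2) = euler_phi (p ^ 4) / euler_phi (p\<^sup>2)"
    using qinf_products(1)[OF p2] by (simp add: power2_eq_square[symmetric])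
  moreover have "p powi A\<^sup>2 * p powi A = p powi (A\<^sup>2 + A)" for A
    using p by (simp add: power_int_add)
  ultimately show "((\<lambda>A::int. p powi (A\<^sup>2 + A)) has_sum 2 * (euler_phi (p ^ 4))\<^sup>2 / euler_phi (p\<^sup>2)) UNIV"
    using J[of p] p nz by (simp add: power2_eq_square field_simps)
qed

text \<open>The triple product yields two of the three residue classes that make up (-q^2; q^2)_inf,
  respectively (-q; q^2)_inf, modulo 6. The third class is itself an eta quotient and can be divided
  out.\<close>

lemma capparelli_theta_products:
  fixes q :: "'a::{real_normed_field,banach}"
  assumes q: "norm q < 1" "q \<noteq> 0"
  shows "((\<lambda>A::int. q powi (3 * A\<^sup>2 + A)) has_sum
            euler_phi (q ^ 4) * (euler_phi (q ^ 6))\<^sup>2 / (euler_phi (q\<^sup>2) * euler_phi (q ^ 12))) UNIV"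
    and "((\<lambda>A::int. q powi (3 * A\<^sup>2 + 2 * A)) has_sum
            (euler_phi (q\<^sup>2))\<^sup>2 * euler_phi (q ^ 3) * euler_phi (q ^ 12)
              / (euler_phi q * euler_phi (q ^ 4) * euler_phi (q ^ 6))) UNIV"
proof -
  have nz [simp]: "euler_phi (q ^ n) \<noteq> 0" if "n > 0" for n
    by (intro qinf_neq_0 norm_power_less_1 q that)
  have [simp]: "euler_phi q \<noteq> 0" by (intro qinf_neq_0 q)
  have n: "norm (q ^ n) < 1" if "n > 0" for n using norm_power_less_1[OF q(1) that] .
  have prod3: "(\<Prod>j<3. f j) = f 0 * f 1 * f 2" for f :: "nat \<Rightarrow> 'a"
    by (simp add: numeral_3_eq_3 numeral_2_eq_2)
  have alg1: "Y * X * d = a * d\<^sup>2 / (b * c)"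
    if "Z = X * Y * W" "Z = a / b" "W = c / d" "b \<noteq> 0" "c \<noteq> 0" "d \<noteq> 0" for X Y Z W a b c d :: 'a
    using that by (auto simp: field_simps power2_eq_square)
  have alg2: "Y * X * d = a\<^sup>2 * e * f / (b * c * d)"
    if "Z = X * W * Y" "Z = a\<^sup>2 / (b * c)" "W = d\<^sup>2 / (e * f)"
      "b \<noteq> 0" "c \<noteq> 0" "d \<noteq> 0" "e \<noteq> 0" "f \<noteq> 0" for X Y Z W a b c d e f :: 'a
    using that by (auto simp: field_simps power2_eq_square)
  have *: "(q ^ 3) powi A\<^sup>2 * q powi A = q powi (3 * A\<^sup>2 + A)" for A
    using powi_theta_exponent[OF q(2), of A 1] by simp
  have J1: "((\<lambda>A::int. q powi (3 * A\<^sup>2 + A)) has_sum qinf (- (q ^ 4)) (q ^ 6) * qinf (- (q\<^sup>2)) (q ^ 6) * euler_phi (q ^ 6)) UNIV"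
  proof -
    have "- (q ^ 3) * q = - (q ^ 4)" "- (q ^ 3) / q = - (q\<^sup>2)" "(q ^ 3)\<^sup>2 = q ^ 6"
      using q(2) by (simp_all add: eval_nat_numeral)
    then show ?thesis using jacobi_triple_product[OF n[of 3] q(2)] * by simp
  qed
  have "qinf (- (q\<^sup>2)) (q\<^sup>2) = qinf (- (q\<^sup>2)) (q ^ 6) * qinf (- (q ^ 4)) (q ^ 6) * qinf (- (q ^ 6)) (q ^ 6)"
  proof -
    have "- (q\<^sup>2) * (q\<^sup>2) ^ 0 = - (q\<^sup>2)" "- (q\<^sup>2) * (q\<^sup>2) ^ 1 = - (q ^ 4)" "- (q\<^sup>2) * (q\<^sup>2) ^ 2 = - (q ^ 6)"
      "(q\<^sup>2) ^ 3 = q ^ 6"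
      by (simp_all add: eval_nat_numeral)
    then show ?thesis using qinf_split[OF n[of 2], of 3 "- (q\<^sup>2)"] unfolding prod3 by simp
  qed
  moreover have "qinf (- (q\<^sup>2)) (q\<^sup>2) = euler_phi (q ^ 4) / euler_phi (q\<^sup>2)"
    using qinf_products(1)[OF n[of 2]] by (simp flip: power_mult)
  moreover have "qinf (- (q ^ 6)) (q ^ 6) = euler_phi (q ^ 12) / euler_phi (q ^ 6)"
    using qinf_products(1)[OF n[of 6]] by (simp flip: power_mult)
  ultimately have "qinf (- (q ^ 4)) (q ^ 6) * qinf (- (q\<^sup>2)) (q ^ 6) * euler_phi (q ^ 6)
      = euler_phi (q ^ 4) * (euler_phi (q ^ 6))\<^sup>2 / (euler_phi (q\<^sup>2) * euler_phi (q ^ 12))"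
    by (rule alg1) simp_all
  with J1 show "((\<lambda>A::int. q powi (3 * A\<^sup>2 + A)) has_sum
            euler_phi (q ^ 4) * (euler_phi (q ^ 6))\<^sup>2 / (euler_phi (q\<^sup>2) * euler_phi (q ^ 12))) UNIV"
    by simp
  have "(q ^ 3) powi A\<^sup>2 * (q\<^sup>2) powi A = q powi (3 * A\<^sup>2 + 2 * A)" for A
    using powi_theta_exponent[OF q(2), of A 2] by simp
  moreover have "q ^ 3 / q\<^sup>2 = q" using q(2) by (simp add: eval_nat_numeral)
  ultimately have J2: "((\<lambda>A::int. q powi (3 * A\<^sup>2 + 2 * A)) has_sum qinf (- (q ^ 5)) (q ^ 6) * qinf (- q) (q ^ 6) * euler_phi (q ^ 6)) UNIV"
    using jacobi_triple_product[OF n[of 3], of "q\<^sup>2"] q(2) by (simp flip: power_mult power_add)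
  have "qinf (- q) (q\<^sup>2) = qinf (- q) (q ^ 6) * qinf (- (q ^ 3)) (q ^ 6) * qinf (- (q ^ 5)) (q ^ 6)"
  proof -
    have "- q * (q\<^sup>2) ^ 0 = - q" "- q * (q\<^sup>2) ^ 1 = - (q ^ 3)" "- q * (q\<^sup>2) ^ 2 = - (q ^ 5)" "(q\<^sup>2) ^ 3 = q ^ 6"
      by (simp_all add: eval_nat_numeral)
    then show ?thesis using qinf_split[OF n[of 2], of 3 "- q"] unfolding prod3 by simp
  qed
  moreover have "qinf (- q) (q\<^sup>2) = (euler_phi (q\<^sup>2))\<^sup>2 / (euler_phi q * euler_phi (q ^ 4))"
    by (rule qinf_products(3)[OF q(1)])
  moreover have "qinf (- (q ^ 3)) (q ^ 6) = (euler_phi (q ^ 6))\<^sup>2 / (euler_phi (q ^ 3) * euler_phi (q ^ 12))"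
    using qinf_products(3)[OF n[of 3]] by (simp flip: power_mult)
  ultimately have "qinf (- (q ^ 5)) (q ^ 6) * qinf (- q) (q ^ 6) * euler_phi (q ^ 6)
      = (euler_phi (q\<^sup>2))\<^sup>2 * euler_phi (q ^ 3) * euler_phi (q ^ 12) / (euler_phi q * euler_phi (q ^ 4) * euler_phi (q ^ 6))"
    by (rule alg2) simp_all
  with J2 show "((\<lambda>A::int. q powi (3 * A\<^sup>2 + 2 * A)) has_sum
            (euler_phi (q\<^sup>2))\<^sup>2 * euler_phi (q ^ 3) * euler_phi (q ^ 12)
              / (euler_phi q * euler_phi (q ^ 4) * euler_phi (q ^ 6))) UNIV"
    by simp
qed

text \<open>For A = 2 b the exponent is 4 (3 b^2 + b); for A = -2 b - 1 it is 4 (3 b^2 + 2 b) + 1.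
  So both theta series at x^4 arise from the second one at x.\<close>

lemma theta_parity_split:
  fixes x :: "'a::{real_normed_field,banach}"
  assumes x: "norm x < 1" "x \<noteq> 0"
    and 1: "((\<lambda>A::int. (x ^ 4) powi (3 * A\<^sup>2 + A)) has_sum S1) UNIV"
    and 2: "((\<lambda>A::int. (x ^ 4) powi (3 * A\<^sup>2 + 2 * A)) has_sum S2) UNIV"
  shows "((\<lambda>A::int. x powi (3 * A\<^sup>2 + 2 * A)) has_sum S1 + x * S2) UNIV"
proof -
  let ?f = "\<lambda>A::int. x powi (3 * A\<^sup>2 + 2 * A)"
  have p4: "(x ^ 4) powi k = x powi (4 * k)" for k
    using power_int_mult[of x "int 4" k] by (simp only: power_int_of_nat) simp
  have "(?f has_sum S1) {A. even A}"
  proof (rule has_sum_reindex_bij_witness[where j = "\<lambda>A. A div 2" and i = "\<lambda>A. 2 * A", THEN iffD2, rotated -1, OF 1])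
    show "(x ^ 4) powi (3 * (A div 2)\<^sup>2 + A div 2) = x powi (3 * A\<^sup>2 + 2 * A)" if "A \<in> {A. even A}" for A :: int
      using that unfolding p4 by (elim CollectE evenE) (simp add: power2_eq_square algebra_simps)
  qed auto
  moreover have "(?f has_sum x * S2) {A. odd A}"
  \<comment> \<open>Odd numbers are written as -2 b - 1, since 2 b + 1 would give the linear term 4
    b instead of 2 b.\<close>
  proof (rule has_sum_reindex_bij_witness[where j = "\<lambda>A. - ((A + 1) div 2)" and i = "\<lambda>A. - 2 * A - 1", THEN iffD2, rotated -1,
        OF has_sum_cmult_right[OF 2, of x]])
    show "x * (x ^ 4) powi (3 * (- ((A + 1) div 2))\<^sup>2 + 2 * - ((A + 1) div 2)) = x powi (3 * A\<^sup>2 + 2 * A)"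
      if "A \<in> {A. odd A}" for A :: int
    proof -
      from that obtain b where A: "A = 2 * b + 1" by (auto elim: oddE)
      have "(A + 1) div 2 = b + 1" by (simp add: A)
      moreover have "x * x powi k = x powi (1 + k)" for k using x by (simp add: power_int_add)
      ultimately show ?thesis unfolding p4 by (simp add: A power2_eq_square algebra_simps)
    qed
  qed (auto elim!: oddE)
  ultimately have "(?f has_sum S1 + x * S2) ({A. even A} \<union> {A. odd A})"
    by (rule has_sum_Un_disjoint) auto
  moreover have "{A. even A} \<union> {A. odd A} = (UNIV :: int set)" by auto
  ultimately show ?thesis by simp
qed

section \<open>Inversion of theta quotients\<close>

text \<open>Polya's proof: the binomial expansion of \<open>(2 * cos u) ^ (2 * m)\<close>, summed over the
  points \<open>u = pi * (k + x) / l\<close>, gives a finite form of the inversion formula. Its limit with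
  \<open>m / l\<^sup>2 \<longlongrightarrow> s\<close> is taken only for the quotient of the cases \<open>x = 1 / 2\<close> and \<open>x = 0\<close>, where
  the normalising constants cancel.\<close>

lemma tannery_int:
  fixes a :: "int \<Rightarrow> nat \<Rightarrow> real"
  assumes lim: "\<And>k. (\<lambda>n. a k n) \<longlonglongrightarrow> b k"
    and bound: "\<And>k n. \<bar>a k n\<bar> \<le> M k" and M: "M summable_on UNIV"
  shows "(\<lambda>n. infsum (\<lambda>k. a k n) UNIV) \<longlonglongrightarrow> infsum b UNIV"
proof -
  have "(\<lambda>i. M (int_decode i)) summable_on UNIV"
    using M summable_on_reindex_bij_betw[OF bij_int_decode] by blast
  then have sM: "summable (\<lambda>i. M (int_decode i))" by (rule summable_on_imp_summable)
  have eq: "suminf (\<lambda>i. f (int_decode i)) = infsum f UNIV" if "\<And>k. \<bar>f k\<bar> \<le> M k" for f :: "int \<Rightarrow> real"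
  proof -
    have "summable (\<lambda>i. norm (f (int_decode i)))"
      by (rule summable_comparison_test'[OF sM, of 0]) (use that in auto)
    then have "((\<lambda>i. f (int_decode i)) has_sum suminf (\<lambda>i. f (int_decode i))) UNIV"
      by (intro norm_summable_imp_has_sum summable_sums) (auto intro: summable_norm_cancel)
    then show ?thesis
      using infsumI infsum_reindex_bij_betw[OF bij_int_decode, of f] by metis
  qed
  have "\<bar>b k\<bar> \<le> M k" for k
    by (rule tendsto_upperbound[OF tendsto_rabs[OF lim[of k]]]) (use bound in auto)
  moreover have "(\<lambda>n. suminf (\<lambda>i. a (int_decode i) n)) \<longlonglongrightarrow> suminf (\<lambda>i. b (int_decode i))"
    by (rule tannerys_theorem[where M = "\<lambda>i. M (int_decode i)", THEN conjunct2, THEN conjunct2])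
      (use lim bound sM in \<open>auto intro!: always_eventually\<close>)
  moreover have "suminf (\<lambda>i. a (int_decode i) n) = infsum (\<lambda>k. a k n) UNIV" for n
    by (rule eq) (rule bound)
  ultimately show ?thesis using eq[of b] by simp
qed

text \<open>The product of cos u and exp (u^2 / 2) decreases on [0, pi/2], because its derivative
  has the sign of u cos u - sin u. This supplies the Gaussian majorant for powers of
  cosines.\<close>

lemma cos_le_exp_square:
  fixes u :: real
  assumes "\<bar>u\<bar> \<le> pi / 2"
  shows "cos u \<le> exp (- u\<^sup>2 / 2)"
proof -
  have *: "cos u \<le> exp (- u\<^sup>2 / 2)" if u: "0 \<le> u" "u \<le> pi / 2" for u :: real
  proof -
    define g where "g x = x * cos x - sin x" for x :: real
    have g: "g x \<le> 0" if "0 \<le> x" "x \<le> pi / 2" for x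
    proof -
      have "g x \<le> g 0"
      proof (rule DERIV_nonpos_imp_nonincreasing[OF that(1)])
        fix t assume t: "0 \<le> t" "t \<le> x"
        have "(g has_real_derivative - t * sin t) (at t)"
          unfolding g_def by (auto intro!: derivative_eq_intros)
        moreover have "- t * sin t \<le> 0" using t that pi_gt_zero by (auto intro!: mult_nonneg_nonneg sin_ge_zero)
        ultimately show "\<exists>y. (g has_real_derivative y) (at t) \<and> y \<le> 0" by blast
      qed
      then show ?thesis by (simp add: g_def)
    qed
    define f where "f x = cos x * exp (x\<^sup>2 / 2)" for x :: real
    have "f u \<le> f 0"
    proof (rule DERIV_nonpos_imp_nonincreasing[OF u(1)])
      fix t assume t: "0 \<le> t" "t \<le> u"
      have "(f has_real_derivative exp (t\<^sup>2 / 2) * g t) (at t)"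
        unfolding f_def g_def by (auto intro!: derivative_eq_intros simp: algebra_simps)
      moreover have "exp (t\<^sup>2 / 2) * g t \<le> 0" using g[of t] t u by (intro mult_nonneg_nonpos) auto
      ultimately show "\<exists>y. (f has_real_derivative y) (at t) \<and> y \<le> 0" by blast
    qed
    then show ?thesis by (simp add: f_def exp_minus field_simps)
  qed
  show ?thesis
    using *[of "\<bar>u\<bar>"] assms by simp
qed

section \<open>Central binomial coefficients and Polya's finite identity\<close>

text \<open>Indexed by the offset from the centre and extended by zero, so that symmetry is d to -d
  and sums may range over all integers.\<close>

definition bin :: "nat \<Rightarrow> int \<Rightarrow> real" where
  "bin m d = (if \<bar>d\<bar> \<le> int m then real ((2 * m) choose nat (int m + d)) else 0)"

lemma bin_minus: "bin m (- d) = bin m d"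
proof (cases "\<bar>d\<bar> \<le> int m")
  case True
  then have "nat (int m + d) \<le> 2 * m" "2 * m - nat (int m + d) = nat (int m - d)" by auto
  then show ?thesis using binomial_symmetric[of "nat (int m + d)" "2 * m"] True by (simp add: bin_def)
qed (simp add: bin_def)

lemma bin_Suc:
  assumes "M < m"
  shows "bin m (int (Suc M)) = bin m (int M) * (real (m - M) / real (m + M + 1))"
proof -
  have "Suc (m + M) * ((2 * m) choose Suc (m + M)) = (2 * m - (m + M)) * ((2 * m) choose (m + M))"
    by (metis binomial_absorb_comp binomial_absorption diff_Suc_Suc mult.commute)
  then have N: "real (Suc (m + M)) * real ((2 * m) choose Suc (m + M)) = real (2 * m - (m + M)) * real ((2 * m) choose (m + M))"
    by (metis of_nat_mult)
  define C C' a b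
    where "C = real ((2 * m) choose (m + M))" and "C' = real ((2 * m) choose Suc (m + M))"
      and "a = real (m - M)" and "b = real (m + M + 1)"
  have "b * C' = a * C"
    using N by (simp add: C_def C'_def a_def b_def)
  moreover have "b > 0" by (simp add: b_def)
  moreover have "bin m (int (Suc M)) = C'" "bin m (int M) = C"
    using assms by (simp_all add: bin_def C_def C'_def nat_add_distrib)
  ultimately show ?thesis unfolding a_def[symmetric] b_def[symmetric] by (simp add: field_simps)
qed

lemma bin_nonneg: "bin m d \<ge> 0"
  by (simp add: bin_def)

text \<open>The ratio of neighbours is 1 - (2 M + 1) / (m + M + 1) = 1 / (1 + (2 M + 1) / (m - M)),
  and each form compares with an exponential. Replacing the varying denominators by m + M0 and m -
  M0 lets the exponents add up, and the odd numbers 2 M + 1 sum to a square.\<close>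

lemma bin_bounds:
  assumes "M0 \<le> m" "M \<le> M0"
  shows "bin m (int M) \<le> bin m 0 * exp (- (real M)\<^sup>2 / (m + M0))"
    and "M0 < m \<Longrightarrow> bin m 0 * exp (- (real M)\<^sup>2 / (m - M0)) \<le> bin m (int M)"
proof -
  have sq: "(real (Suc M))\<^sup>2 = (real M)\<^sup>2 + (2 * M + 1)" for M by (simp add: power2_eq_square algebra_simps)
  show "bin m (int M) \<le> bin m 0 * exp (- (real M)\<^sup>2 / (m + M0))"
    using assms(2)
  proof (induction M)
    case (Suc M)
    have M: "M < m" using Suc.prems assms(1) by simp
    have "real (m - M) / real (m + M + 1) = 1 - real (2 * M + 1) / real (m + M + 1)"
      using M by (simp add: field_simps of_nat_diff)
    also have "\<dots> \<le> exp (- (real (2 * M + 1) / real (m + M + 1)))"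
      using exp_ge_add_one_self[of "- (real (2 * M + 1) / real (m + M + 1))"] by simp
    also have "\<dots> \<le> exp (- (real (2 * M + 1) / real (m + M0)))"
      using Suc.prems by (auto intro!: divide_left_mono mult_pos_pos)
    finally have "bin m (int (Suc M)) \<le> (bin m 0 * exp (- (real M)\<^sup>2 / (m + M0))) * exp (- (real (2 * M + 1) / real (m + M0)))"
      unfolding bin_Suc[OF M] using Suc by (intro mult_mono) (auto simp: bin_nonneg)
    also have "\<dots> = bin m 0 * exp (- (real (Suc M))\<^sup>2 / (m + M0))"
      unfolding mult.assoc exp_add[symmetric] sq by (simp add: add_divide_distrib diff_divide_distrib)
    finally show ?case .
  qed simp
  show "bin m 0 * exp (- (real M)\<^sup>2 / (m - M0)) \<le> bin m (int M)" if "M0 < m"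
    using assms(2)
  proof (induction M)
    case (Suc M)
    have M: "M < m" using Suc.prems assms(1) by simp
    have "exp (- (real (2 * M + 1) / (real m - real M0))) \<le> exp (- (real (2 * M + 1) / (real m - real M)))"
      using Suc.prems that by (auto intro!: divide_left_mono mult_pos_pos)
    also have "\<dots> = 1 / exp (real (2 * M + 1) / (real m - real M))" by (simp add: exp_minus field_simps)
    also have "\<dots> \<le> 1 / (1 + real (2 * M + 1) / (real m - real M))"
      using M by (intro divide_left_mono exp_ge_add_one_self mult_pos_pos add_pos_pos) auto
    also have "\<dots> = real (m - M) / real (m + M + 1)"
      using M by (simp add: field_simps of_nat_diff)
    finally have e: "exp (- (real (2 * M + 1) / (real m - real M0))) \<le> real (m - M) / real (m + M + 1)" .
    have "bin m 0 * exp (- (real (Suc M))\<^sup>2 / (m - M0))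
        = (bin m 0 * exp (- (real M)\<^sup>2 / (m - M0))) * exp (- (real (2 * M + 1) / (real m - real M0)))"
      unfolding mult.assoc exp_add[symmetric] sq using that by (simp add: of_nat_diff add_divide_distrib diff_divide_distrib)
    also have "\<dots> \<le> bin m (int M) * (real (m - M) / real (m + M + 1))"
      using Suc e by (intro mult_mono) (auto simp: bin_nonneg)
    finally show ?case unfolding bin_Suc[OF M] .
  qed simp
qed

text \<open>Orthogonality of the characters modulo the odd number l. The symmetric range of k costs
  a root of unity that is 1 whenever the geometric sum does not vanish.\<close>

lemma sum_cis_powers:
  fixes d :: int and h :: nat
  defines "l \<equiv> 2 * int h + 1"
  shows "(\<Sum>k\<in>{- int h..int h}. cis (2 * pi * d * k / l)) = (if l dvd d then of_int l else 0)"
proof -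
  have l: "l > 0" by (simp add: l_def)
  define w where "w = cis (2 * pi * d / l)"
  have "(\<Sum>k\<in>{- int h..int h}. cis (2 * pi * d * k / l)) = (\<Sum>i<nat l. cis (2 * pi * d * (int i - int h) / l))"
    by (rule sum.reindex_bij_witness[of _ "\<lambda>i. int i - int h" "\<lambda>k. nat (k + int h)"]) (auto simp: l_def)
  also have "\<dots> = (\<Sum>i<nat l. w ^ i * cis (- (2 * pi * d * h / l)))"
    unfolding w_def Complex.DeMoivre cis_mult
    by (intro sum.cong refl arg_cong[where f = cis]) (simp add: field_simps)
  also have "\<dots> = (\<Sum>i<nat l. w ^ i) * cis (- (2 * pi * d * h / l))"
    by (simp add: sum_distrib_right)
  also have "\<dots> = (if l dvd d then of_int l else 0)"
  proof (cases "l dvd d")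
    case True
    then obtain j where j: "d = l * j" by blast
    have "w = 1" using l cis_multiple_2pi[of "of_int j"] by (simp add: w_def j mult_ac)
    moreover have "cis (- (2 * pi * d * h / l)) = 1"
      using l cis_multiple_2pi[of "of_int (- j * int h)"] by (simp add: j mult_ac)
    ultimately show ?thesis using True l by simp
  next
    case False
    have "w \<noteq> 1"
    proof
      assume "w = 1"
      then have "cos (2 * pi * d / l) = 1" by (simp add: w_def complex_eq_iff)
      then obtain n where "2 * pi * d / l = of_int n * 2 * pi" by (auto simp: cos_one_2pi_int)
      then have "real_of_int d = real_of_int (n * l)" using l by (simp add: field_simps)
      then have "d = n * l" by linarith
      then show False using False by simp
    qed
    moreover have "w ^ nat l = 1"
      using l cis_multiple_2pi[of "of_int d"] by (simp add: w_def Complex.DeMoivre mult_ac)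
    ultimately show ?thesis using False by (simp add: geometric_sum)
  qed
  finally show ?thesis .
qed

lemma cos_power_expansion:
  "complex_of_real ((2 * cos u) ^ (2 * m)) = (\<Sum>d\<in>{- int m..int m}. of_real (bin m d) * cis (2 * real_of_int d * u))"
proof -
  have "complex_of_real (2 * cos u) = cis u + cis (- u)" by (simp add: complex_eq_iff)
  then have "complex_of_real ((2 * cos u) ^ (2 * m)) = (cis u + cis (- u)) ^ (2 * m)" by (metis of_real_power)
  also have "\<dots> = (\<Sum>k\<le>2 * m. of_nat ((2 * m) choose k) * cis u ^ k * cis (- u) ^ (2 * m - k))"
    by (rule binomial_ring)
  also have "\<dots> = (\<Sum>d\<in>{- int m..int m}. of_real (bin m d) * cis (2 * real_of_int d * u))"
  proof (rule sum.reindex_bij_witness[of _ "\<lambda>d. nat (int m + d)" "\<lambda>k. int k - int m"], goal_cases)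
    case (5 k)
    then have k: "k \<le> 2 * m" by simp
    then have "cis u ^ k * cis (- u) ^ (2 * m - k) = cis (2 * (int k - int m) * u)"
      unfolding Complex.DeMoivre cis_mult by (intro arg_cong[where f = cis]) (simp add: of_nat_diff algebra_simps)
    moreover have "bin m (int k - int m) = real ((2 * m) choose k)" using k by (simp add: bin_def)
    ultimately show ?case by (simp add: mult.assoc)
  qed auto
  finally show ?thesis .
qed

text \<open>Expanding the powers and summing over k leaves only the frequencies d that are multiples
  of l.\<close>

lemma polya_identity:
  fixes h m :: nat and x :: real
  defines "l \<equiv> 2 * int h + 1"
  shows "complex_of_real (\<Sum>k\<in>{- int h..int h}. (2 * cos (pi * (k + x) / l)) ^ (2 * m))
       = of_int l * (\<Sum>j\<in>{- int m..int m}. of_real (bin m (l * j)) * cis (2 * pi * j * x))"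
proof -
  have l: "l > 0" by (simp add: l_def)
  have "complex_of_real (\<Sum>k\<in>{- int h..int h}. (2 * cos (pi * (k + x) / l)) ^ (2 * m))
      = (\<Sum>k\<in>{- int h..int h}. \<Sum>d\<in>{- int m..int m}. of_real (bin m d) * cis (2 * real_of_int d * (pi * (k + x) / l)))"
    unfolding of_real_sum by (intro sum.cong refl cos_power_expansion)
  also have "\<dots> = (\<Sum>k\<in>{- int h..int h}. \<Sum>d\<in>{- int m..int m}.
      of_real (bin m d) * cis (2 * pi * d * x / l) * cis (2 * pi * d * k / l))"
  proof (intro sum.cong refl)
    fix k d :: int
    have "cis (2 * pi * d * x / l) * cis (2 * pi * d * k / l) = cis (2 * real_of_int d * (pi * (k + x) / l))"
      unfolding cis_mult by (intro arg_cong[where f = cis]) (simp add: algebra_simps add_divide_distrib)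
    then show "of_real (bin m d) * cis (2 * real_of_int d * (pi * (k + x) / l))
        = of_real (bin m d) * cis (2 * pi * d * x / l) * cis (2 * pi * d * k / l)" by (simp add: mult.assoc)
  qed
  also have "\<dots> = (\<Sum>d\<in>{- int m..int m}. of_real (bin m d) * cis (2 * pi * d * x / l) *
      (\<Sum>k\<in>{- int h..int h}. cis (2 * pi * d * k / l)))"
    by (subst sum.swap) (simp add: sum_distrib_left)
  also have "\<dots> = (\<Sum>d\<in>{- int m..int m}. if l dvd d then of_int l * (of_real (bin m d) * cis (2 * pi * d * x / l)) else 0)"
    unfolding sum_cis_powers[of _ h, folded l_def] by (intro sum.cong) auto
  also have "\<dots> = (\<Sum>d\<in>{d\<in>{- int m..int m}. l dvd d}. of_int l * (of_real (bin m d) * cis (2 * pi * d * x / l)))"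
    by (rule sum.inter_filter[symmetric]) simp
  also have "\<dots> = (\<Sum>j\<in>{j\<in>{- int m..int m}. \<bar>l * j\<bar> \<le> int m}. of_int l * (of_real (bin m (l * j)) * cis (2 * pi * j * x)))"
  proof (rule sum.reindex_bij_witness[of _ "\<lambda>j. l * j" "\<lambda>d. d div l"], goal_cases)
    case (2 d)
    then obtain j where j: "d = l * j" by auto
    have "\<bar>j\<bar> * 1 \<le> \<bar>j\<bar> * l" using l by (intro mult_left_mono) auto
    also have "\<dots> = \<bar>d\<bar>" using l by (simp add: j abs_mult)
    finally show ?case using 2 l by (auto simp: j)
  next
    case (5 d)
    then obtain j where "d = l * j" by auto
    then show ?case using l by (simp add: mult_ac)
  qed (use l in auto)
  also have "\<dots> = (\<Sum>j\<in>{- int m..int m}. of_int l * (of_real (bin m (l * j)) * cis (2 * pi * j * x)))"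
    by (rule sum.mono_neutral_left) (auto simp: bin_def)
  finally show ?thesis by (simp add: sum_distrib_left)
qed

lemma infsum_finite_support:
  fixes f :: "'b \<Rightarrow> real"
  assumes "finite A" "\<And>x. x \<notin> A \<Longrightarrow> f x = 0"
  shows "infsum f UNIV = sum f A"
proof -
  have "infsum f UNIV = infsum f A" using assms by (intro infsum_cong_neutral) auto
  then show ?thesis using assms by simp
qed

lemma summable_powi_square:
  fixes p :: real
  assumes "0 < p" "p < 1"
  shows "(\<lambda>k::int. p powi k\<^sup>2) summable_on UNIV"
  using theta_products(1)[of p] assms by (auto simp: summable_on_def)

lemma polya_quotient:
  fixes h m :: nat
  defines "l \<equiv> 2 * int h + 1"
  shows "(\<Sum>k\<in>{- int h..int h}. cos (pi * (k + 1 / 2) / l) ^ (2 * m)) * (\<Sum>j\<in>{- int m..int m}. bin m (l * j))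
       = (\<Sum>k\<in>{- int h..int h}. cos (pi * k / l) ^ (2 * m)) * (\<Sum>j\<in>{- int m..int m}. bin m (l * j) * (- 1) powi j)"
proof -
  have l: "l > 0" by (simp add: l_def)
  have *: "2 ^ (2 * m) * (\<Sum>k\<in>{- int h..int h}. cos (pi * (k + x) / l) ^ (2 * m))
      = l * (\<Sum>j\<in>{- int m..int m}. bin m (l * j) * cos (2 * pi * j * x))" for x :: real
  proof -
    have "(\<Sum>k\<in>{- int h..int h}. (2 * cos (pi * (k + x) / l)) ^ (2 * m))
        = l * (\<Sum>j\<in>{- int m..int m}. bin m (l * j) * cos (2 * pi * j * x))"
      using arg_cong[OF polya_identity[where h = h and x = x and m = m, folded l_def], of Re] by simp
    then show ?thesis by (simp add: power_mult_distrib sum_distrib_left)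
  qed
  have c: "cos (2 * pi * j * (1 / 2)) = (- 1) powi j" for j :: int
    by (simp add: cos_npi_int power_int_minus_left)
  have alg: "C * B = A * D" if "P * A = L * B" "P * C = L * D" "P \<noteq> 0" for A B C D L P :: real
  proof -
    have "P * (C * B) = (P * C) * B" by simp
    also have "\<dots> = D * (L * B)" unfolding that(2) by simp
    also have "\<dots> = P * (A * D)" unfolding that(1)[symmetric] by simp
    finally show ?thesis using that(3) by simp
  qed
  show ?thesis
  proof (rule alg[of "2 ^ (2 * m)" _ l])
    show "2 ^ (2 * m) * (\<Sum>k\<in>{- int h..int h}. cos (pi * k / l) ^ (2 * m)) = l * (\<Sum>j\<in>{- int m..int m}. bin m (l * j))"
      using *[of 0] by simp
    show "2 ^ (2 * m) * (\<Sum>k\<in>{- int h..int h}. cos (pi * (k + 1 / 2) / l) ^ (2 * m))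
        = l * (\<Sum>j\<in>{- int m..int m}. bin m (l * j) * (- 1) powi j)"
      using *[of "1 / 2"] unfolding c .
  qed simp
qed

section \<open>The limit of Polya's identity\<close>

context
  fixes s :: real
  assumes s: "s > 0"
begin

text \<open>The exponent grows like s l^2 with l = 2 h + 1, the scale at which both sides of the
  finite identity have Gaussian limits. Rounding up keeps it at least s l^2, as the cosine bound
  requires.\<close>

definition polya_m :: "nat \<Rightarrow> nat" where
  "polya_m h = nat \<lceil>s * (2 * real h + 1)\<^sup>2\<rceil>"

lemma polya_m_bounds:
  "s * (2 * real h + 1)\<^sup>2 \<le> real (polya_m h)"
  "real (polya_m h) \<le> s * (2 * real h + 1)\<^sup>2 + 1"
proof -
  have "0 \<le> s * (2 * real h + 1)\<^sup>2" using s by simp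
  then have "0 \<le> \<lceil>s * (2 * real h + 1)\<^sup>2\<rceil>" by linarith
  then have "real (polya_m h) = of_int \<lceil>s * (2 * real h + 1)\<^sup>2\<rceil>" by (simp add: polya_m_def)
  then show "s * (2 * real h + 1)\<^sup>2 \<le> real (polya_m h)" "real (polya_m h) \<le> s * (2 * real h + 1)\<^sup>2 + 1"
    by linarith+
qed

lemma polya_m_limit: "(\<lambda>h. real (polya_m h) / (2 * real h + 1)\<^sup>2) \<longlonglongrightarrow> s"
proof (rule tendsto_sandwich)
  show "\<forall>\<^sub>F h in sequentially. s \<le> real (polya_m h) / (2 * real h + 1)\<^sup>2"
    using polya_m_bounds(1) by (intro always_eventually allI) (simp add: field_simps)
  show "\<forall>\<^sub>F h in sequentially. real (polya_m h) / (2 * real h + 1)\<^sup>2 \<le> s + 1 / (2 * real h + 1)\<^sup>2"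
    using polya_m_bounds(2) by (intro always_eventually allI) (simp add: field_simps)
  show "(\<lambda>h. s + 1 / (2 * real h + 1)\<^sup>2) \<longlonglongrightarrow> s" by real_asymp
qed simp

text \<open>Since ln (cos (c / l)) is about - c^2 / (2 l^2) and the exponent is about 2 s l^2, the
  logarithms tend to - s c^2.\<close>

lemma polya_cos_limit:
  "(\<lambda>h. cos (c / (2 * real h + 1)) ^ (2 * polya_m h)) \<longlonglongrightarrow> exp (- s * c\<^sup>2)"
proof -
  have "(\<lambda>h. (2 * real h + 1)\<^sup>2 * ln (cos (c / (2 * real h + 1)))) \<longlonglongrightarrow> - (c * c / 2)" by real_asymp
  then have 1: "(\<lambda>h. (2 * real h + 1)\<^sup>2 * ln (cos (c / (2 * real h + 1)))) \<longlonglongrightarrow> - c\<^sup>2 / 2"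
    by (simp add: power2_eq_square[of c])
  have "(\<lambda>h. exp (2 * (real (polya_m h) / (2 * real h + 1)\<^sup>2) * ((2 * real h + 1)\<^sup>2 * ln (cos (c / (2 * real h + 1))))))
      \<longlonglongrightarrow> exp (2 * s * (- c\<^sup>2 / 2))"
    by (intro tendsto_intros polya_m_limit 1)
  moreover have "\<forall>\<^sub>F h in sequentially. cos (c / (2 * real h + 1)) > 0" by real_asymp
  then have "\<forall>\<^sub>F h in sequentially. exp (2 * (real (polya_m h) / (2 * real h + 1)\<^sup>2) * ((2 * real h + 1)\<^sup>2 * ln (cos (c / (2 * real h + 1)))))
      = cos (c / (2 * real h + 1)) ^ (2 * polya_m h)"
  proof eventually_elim
    case (elim h)
    have "2 * real h + 1 \<noteq> 0" by linarith
    then have "2 * (real (polya_m h) / (2 * real h + 1)\<^sup>2) * ((2 * real h + 1)\<^sup>2 * ln (cos (c / (2 * real h + 1))))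
        = real (2 * polya_m h) * ln (cos (c / (2 * real h + 1)))" by simp
    also have "exp \<dots> = cos (c / (2 * real h + 1)) ^ (2 * polya_m h)"
      using elim by (simp add: exp_of_nat_mult del: of_nat_mult)
    finally show ?case .
  qed
  ultimately show ?thesis by (simp add: tendsto_cong)
qed

lemma polya_cos_bound:
  fixes k :: int and x :: real
  assumes k: "\<bar>k\<bar> \<le> int h" and x: "0 \<le> x" "x \<le> 1 / 2"
  shows "cos (pi * (k + x) / (2 * real h + 1)) ^ (2 * polya_m h) \<le> exp (- (s * pi\<^sup>2 / 4)) powi k\<^sup>2"
proof -
  define l where "l = 2 * real h + 1"
  have l: "l > 0" by (simp add: l_def)
  define u where "u = pi * (k + x) / l"
  have "real_of_int k \<le> real h" "- real_of_int k \<le> real h" using k by linarith+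
  then have "\<bar>real_of_int k + x\<bar> \<le> l / 2" unfolding l_def abs_le_iff using x by (intro conjI) simp_all
  then have "pi * \<bar>k + x\<bar> / l \<le> pi * (l / 2) / l"
    using l by (intro divide_right_mono mult_left_mono) auto
  moreover have "\<bar>u\<bar> = pi * \<bar>k + x\<bar> / l" using l by (simp add: u_def abs_mult)
  ultimately have "\<bar>u\<bar> \<le> pi * (l / 2) / l" by simp
  then have u: "\<bar>u\<bar> \<le> pi / 2" using l by simp
  have "cos u ^ (2 * polya_m h) \<le> exp (- u\<^sup>2 / 2) ^ (2 * polya_m h)"
    using u by (intro power_mono cos_le_exp_square cos_ge_zero) auto
  also have "\<dots> = exp (- (real (polya_m h) * u\<^sup>2))" by (simp flip: exp_of_nat_mult)
  also have "\<dots> \<le> exp (- (s * pi\<^sup>2 / 4 * k\<^sup>2))"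
  proof -
    \<comment> \<open>The shift x lies in [0, 1/2] and |k| is 0 or at least 1, so |k + x| >= |k| /
      2; this is the origin of the 4 in the majorant.\<close>
    have "(real_of_int k)\<^sup>2 / 4 \<le> (k + x)\<^sup>2"
    proof (cases "k = 0")
      case False
      then have "1 \<le> \<bar>real_of_int k\<bar>" by linarith
      then have "\<bar>real_of_int k\<bar> / 2 \<le> \<bar>k + x\<bar>" using x by linarith
      from power_mono[OF this, of 2] show ?thesis by (simp add: power_divide)
    qed simp
    then have "s * pi\<^sup>2 * ((real_of_int k)\<^sup>2 / 4) \<le> s * pi\<^sup>2 * (k + x)\<^sup>2"
      using s by (intro mult_left_mono) auto
    also have "\<dots> = s * l\<^sup>2 * u\<^sup>2" using l by (simp add: u_def power_divide power_mult_distrib)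
    also have "\<dots> \<le> real (polya_m h) * u\<^sup>2"
      using polya_m_bounds(1)[of h] by (intro mult_right_mono) (simp_all add: l_def)
    finally show ?thesis by simp
  qed
  also have "\<dots> = exp (- (s * pi\<^sup>2 / 4)) powi k\<^sup>2"
  proof -
    have "(real_of_int k)\<^sup>2 = real ((nat \<bar>k\<bar>)\<^sup>2)" by simp
    then show ?thesis unfolding powi_square_nat exp_of_nat_mult[symmetric] by (simp add: mult_ac)
  qed
  finally show ?thesis by (simp add: u_def l_def)
qed

lemma bin_0_pos: "bin m 0 > 0"
  by (simp add: bin_def zero_less_binomial)

lemma bin_abs: "bin m \<bar>d\<bar> = bin m d"
  by (simp add: abs_if bin_minus)

text \<open>A local de Moivre-Laplace limit. With l = 2 h + 1, \<open>bin_bounds\<close> with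
  \<open>M\<close> and \<open>M0\<close> both equal to l |k| squeezes the quotient between
  exponentials of - k^2 / (r - |k| / l) and - k^2 / (r + |k| / l), where r tends to s.\<close>

lemma polya_bin_limit:
  fixes k :: int
  shows "(\<lambda>h. bin (polya_m h) ((2 * int h + 1) * k) / bin (polya_m h) 0) \<longlonglongrightarrow> exp (- (real_of_int k)\<^sup>2 / s)"
proof -
  define a where "a = real (nat \<bar>k\<bar>)"
  define r where "r h = real (polya_m h) / (2 * real h + 1)\<^sup>2" for h
  define M where "M h = (2 * h + 1) * nat \<bar>k\<bar>" for h
  have r: "r \<longlonglongrightarrow> s" unfolding r_def by (rule polya_m_limit)
  have a0: "(\<lambda>h. a / (2 * real h + 1)) \<longlonglongrightarrow> 0" by real_asymp
  have a2: "a\<^sup>2 = (real_of_int k)\<^sup>2" by (simp add: a_def)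
  have M: "real (M h) = (2 * real h + 1) * a" for h by (simp add: M_def a_def algebra_simps)
  have q: "(real (M h))\<^sup>2 / (real (polya_m h) + e * real (M h)) = a\<^sup>2 / (r h + e * (a / (2 * real h + 1)))" for h e
  proof -
    define L where "L = 2 * real h + 1"
    have L: "L \<noteq> 0" unfolding L_def by linarith
    have "real (polya_m h) = L\<^sup>2 * r h" using L by (simp add: r_def L_def)
    then have "real (polya_m h) + e * real (M h) = L\<^sup>2 * (r h + e * (a / L))"
      using L by (simp add: M L_def[symmetric] power2_eq_square distrib_left)
    then show ?thesis using L by (simp add: M L_def[symmetric] power_mult_distrib)
  qed
  have lim: "(\<lambda>h. exp (- (a\<^sup>2 / (r h + e * (a / (2 * real h + 1)))))) \<longlonglongrightarrow> exp (- (real_of_int k)\<^sup>2 / s)" for e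
  proof -
    have "(\<lambda>h. exp (- (a\<^sup>2 / (r h + e * (a / (2 * real h + 1)))))) \<longlonglongrightarrow> exp (- (a\<^sup>2 / (s + e * 0)))"
      using s by (intro tendsto_intros r a0) auto
    then show ?thesis by (simp add: a2)
  qed
  have "(\<lambda>h. r h - a / (2 * real h + 1)) \<longlonglongrightarrow> s - 0" by (intro tendsto_intros r a0)
  then have "\<forall>\<^sub>F h in sequentially. r h - a / (2 * real h + 1) > 0"
    using s by (intro order_tendstoD) auto
  then have ev: "\<forall>\<^sub>F h in sequentially. M h < polya_m h"
  proof eventually_elim
    case (elim h)
    define L where "L = 2 * real h + 1"
    have L: "L > 0" unfolding L_def by linarith
    have "a / L < real (polya_m h) / L\<^sup>2" using elim by (simp add: r_def L_def)
    then have "L * a < real (polya_m h)" using L by (simp add: field_simps power2_eq_square)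
    then show ?case using M[of h] by (simp add: L_def)
  qed
  have bM: "bin (polya_m h) ((2 * int h + 1) * k) = bin (polya_m h) (int (M h))" for h
  proof -
    have "int (M h) = (2 * int h + 1) * \<bar>k\<bar>" by (simp add: M_def distrib_right)
    then have "int (M h) = \<bar>(2 * int h + 1) * k\<bar>" by (simp add: abs_mult)
    then show ?thesis by (simp only: bin_abs)
  qed
  show ?thesis
  proof (rule tendsto_sandwich[OF _ _ lim[of "- 1"] lim[of 1]])
    show "\<forall>\<^sub>F h in sequentially. exp (- (a\<^sup>2 / (r h + - 1 * (a / (2 * real h + 1)))))
        \<le> bin (polya_m h) ((2 * int h + 1) * k) / bin (polya_m h) 0"
      using ev
    proof eventually_elim
      case (elim h)
      then have "real (polya_m h - M h) = real (polya_m h) + - 1 * real (M h)" by (simp add: of_nat_diff)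
      then have "(real (M h))\<^sup>2 / real (polya_m h - M h) = a\<^sup>2 / (r h + - 1 * (a / (2 * real h + 1)))"
        unfolding q[symmetric] by simp
      then show ?case
        using bin_bounds(2)[of "M h" "polya_m h" "M h"] elim
        unfolding bM pos_le_divide_eq[OF bin_0_pos] minus_divide_left[symmetric] by (simp only: mult.commute less_imp_le)
    qed
    show "\<forall>\<^sub>F h in sequentially. bin (polya_m h) ((2 * int h + 1) * k) / bin (polya_m h) 0
        \<le> exp (- (a\<^sup>2 / (r h + 1 * (a / (2 * real h + 1)))))"
      using ev
    proof eventually_elim
      case (elim h)
      have "(real (M h))\<^sup>2 / real (polya_m h + M h) = a\<^sup>2 / (r h + 1 * (a / (2 * real h + 1)))"
        unfolding q[symmetric] by simp
      then show ?case
        using bin_bounds(1)[of "M h" "polya_m h" "M h"] elim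
        unfolding bM pos_divide_le_eq[OF bin_0_pos] minus_divide_left[symmetric] by (simp only: mult.commute less_imp_le)
    qed
  qed
qed

text \<open>Outside the support the quotient is zero. Inside, M = l |k| is at most m, and m <= s l^2
  + 1 <= (s + 1) l^2, so the denominator m + M in \<open>bin_bounds\<close> is at most 2 (s + 1)
  l^2.\<close>

lemma polya_bin_bound:
  fixes k :: int
  shows "bin (polya_m h) ((2 * int h + 1) * k) / bin (polya_m h) 0 \<le> exp (- (1 / (2 * (s + 1)))) powi k\<^sup>2"
proof (cases "\<bar>(2 * int h + 1) * k\<bar> \<le> int (polya_m h)")
  case False
  then show ?thesis by (simp add: bin_def zero_le_power_int)
next
  case True
  define M where "M = (2 * h + 1) * nat \<bar>k\<bar>"
  have "int M = (2 * int h + 1) * \<bar>k\<bar>" by (simp add: M_def distrib_right)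
  then have MM: "int M = \<bar>(2 * int h + 1) * k\<bar>" by (simp add: abs_mult)
  then have Mm: "M \<le> polya_m h" using True by linarith
  have rM: "real M = (2 * real h + 1) * real (nat \<bar>k\<bar>)" by (simp add: M_def algebra_simps)
  have "bin (polya_m h) ((2 * int h + 1) * k) = bin (polya_m h) (int M)" by (simp only: MM bin_abs)
  also have "\<dots> \<le> bin (polya_m h) 0 * exp (- (real M)\<^sup>2 / real (polya_m h + M))"
    using bin_bounds(1)[OF Mm, of M] by simp
  also have "\<dots> \<le> bin (polya_m h) 0 * exp (- (1 / (2 * (s + 1)) * real ((nat \<bar>k\<bar>)\<^sup>2)))"
  proof -
    define L where "L = 2 * real h + 1"
    have L: "L \<ge> 1" by (simp add: L_def)
    then have "1 \<le> L\<^sup>2" by simp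
    then have "real (polya_m h) \<le> (s + 1) * L\<^sup>2"
      using polya_m_bounds(2)[of h] unfolding L_def distrib_right by linarith
    then have d: "real (polya_m h + M) \<le> 2 * (s + 1) * L\<^sup>2"
      using of_nat_mono[OF Mm, where 'a = real] unfolding mult.assoc of_nat_add by linarith
    show ?thesis
    proof (cases "k = 0")
      case False
      then have "M > 0" by (simp add: M_def)
      have "1 / (2 * (s + 1)) * real ((nat \<bar>k\<bar>)\<^sup>2) = (real M)\<^sup>2 / (2 * (s + 1) * L\<^sup>2)"
        using L s by (simp add: rM L_def[symmetric] power_mult_distrib)
      also have "\<dots> \<le> (real M)\<^sup>2 / real (polya_m h + M)"
        using d \<open>M > 0\<close> L s by (intro divide_left_mono mult_pos_pos) auto
      finally show ?thesis using bin_0_pos[of "polya_m h"] by simp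
    qed (simp add: M_def)
  qed
  finally have "bin (polya_m h) ((2 * int h + 1) * k) / bin (polya_m h) 0 \<le> exp (- (1 / (2 * (s + 1)) * real ((nat \<bar>k\<bar>)\<^sup>2)))"
    using bin_0_pos[of "polya_m h"] by (simp add: field_simps)
  also have "\<dots> = exp (- (1 / (2 * (s + 1)))) powi k\<^sup>2"
    unfolding powi_square_nat exp_of_nat_mult[symmetric] by (simp add: mult_ac)
  finally show ?thesis .
qed

text \<open>The limit of \<open>polya_quotient\<close>. With t = pi s it says that theta_2 / theta_3
  at t equals theta_4 / theta_3 at 1 / t.\<close>

lemma theta_inversion_quotient:
  "(\<Sum>\<^sub>\<infinity>k::int. exp (- s * (pi * (k + 1 / 2))\<^sup>2)) * (\<Sum>\<^sub>\<infinity>j::int. exp (- (real_of_int j)\<^sup>2 / s))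
   = (\<Sum>\<^sub>\<infinity>k::int. exp (- s * (pi * k)\<^sup>2)) * (\<Sum>\<^sub>\<infinity>j::int. exp (- (real_of_int j)\<^sup>2 / s) * (- 1) powi j)"
proof -
  define a where "a x k h = (if \<bar>k\<bar> \<le> int h then cos (pi * (k + x) / (2 * real h + 1)) ^ (2 * polya_m h) else 0)"
    for x :: real and k :: int and h
  \<comment> \<open>Dividing by the central coefficient makes each term converge; the divisor occurs
    once on either side of \<open>polya_quotient\<close>.\<close>
  define c where "c k h = bin (polya_m h) ((2 * int h + 1) * k) / bin (polya_m h) 0" for k h
  have A: "(\<lambda>h. infsum (\<lambda>k. a x k h) UNIV) \<longlonglongrightarrow> (\<Sum>\<^sub>\<infinity>k::int. exp (- s * (pi * (k + x))\<^sup>2))" if x: "0 \<le> x" "x \<le> 1 / 2" for x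
  proof (rule tannery_int)
    fix k :: int
    have "\<forall>\<^sub>F h in sequentially. int h \<ge> \<bar>k\<bar>"
      using eventually_ge_at_top[of "nat \<bar>k\<bar>"] by eventually_elim linarith
    then have "\<forall>\<^sub>F h in sequentially. cos (pi * (k + x) / (2 * real h + 1)) ^ (2 * polya_m h) = a x k h"
      by eventually_elim (simp add: a_def)
    then show "(\<lambda>h. a x k h) \<longlonglongrightarrow> exp (- s * (pi * (k + x))\<^sup>2)"
      by (rule tendsto_cong[THEN iffD1]) (rule polya_cos_limit)
    show "\<bar>a x k h\<bar> \<le> exp (- (s * pi\<^sup>2 / 4)) powi k\<^sup>2" for h
      using polya_cos_bound[of k h x] x by (simp add: a_def zero_le_power_int)
    show "(\<lambda>k::int. exp (- (s * pi\<^sup>2 / 4)) powi k\<^sup>2) summable_on UNIV"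
      using s by (intro summable_powi_square) auto
  qed
  have c0: "c k h \<ge> 0" for k h using bin_0_pos[of "polya_m h"] by (simp add: c_def bin_nonneg)
  have sc: "(\<lambda>k::int. exp (- (1 / (2 * (s + 1)))) powi k\<^sup>2) summable_on UNIV"
    using s by (intro summable_powi_square) auto
  have cl: "(\<lambda>h. c k h) \<longlonglongrightarrow> exp (- (real_of_int k)\<^sup>2 / s)" for k
    unfolding c_def by (rule polya_bin_limit)
  have cb: "c k h \<le> exp (- (1 / (2 * (s + 1)))) powi k\<^sup>2" for k h
    unfolding c_def by (rule polya_bin_bound)
  have C: "(\<lambda>h. infsum (\<lambda>k. c k h) UNIV) \<longlonglongrightarrow> (\<Sum>\<^sub>\<infinity>j::int. exp (- (real_of_int j)\<^sup>2 / s))"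
  proof (rule tannery_int[OF cl _ sc])
    show "\<bar>c k h\<bar> \<le> exp (- (1 / (2 * (s + 1)))) powi k\<^sup>2" for k h
      using c0[of k h] cb[of k h] by linarith
  qed
  have C': "(\<lambda>h. infsum (\<lambda>k. c k h * (- 1) powi k) UNIV) \<longlonglongrightarrow> (\<Sum>\<^sub>\<infinity>j::int. exp (- (real_of_int j)\<^sup>2 / s) * (- 1) powi j)"
  proof (rule tannery_int[OF _ _ sc])
    show "(\<lambda>h. c k h * (- 1) powi k) \<longlonglongrightarrow> exp (- (real_of_int k)\<^sup>2 / s) * (- 1) powi k" for k
      by (intro tendsto_intros cl)
    have "\<bar>(- 1) powi k\<bar> = (1::real)" for k :: int by (simp add: power_int_minus_left)
    then have "\<bar>c k h * (- 1) powi k\<bar> = c k h" for k h using c0[of k h] by (simp add: abs_mult)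
    then show "\<bar>c k h * (- 1) powi k\<bar> \<le> exp (- (1 / (2 * (s + 1)))) powi k\<^sup>2" for k h
      using cb[of k h] by (simp only:)
  qed
  have "infsum (\<lambda>k. a (1 / 2) k h) UNIV * infsum (\<lambda>k. c k h) UNIV
      = infsum (\<lambda>k. a 0 k h) UNIV * infsum (\<lambda>k. c k h * (- 1) powi k) UNIV" for h
  proof -
    have a: "infsum (\<lambda>k. a x k h) UNIV = (\<Sum>k\<in>{- int h..int h}. cos (pi * (k + x) / (2 * int h + 1)) ^ (2 * polya_m h))" for x :: real
      by (subst infsum_finite_support[of "{- int h..int h}"]) (auto simp: a_def abs_le_iff intro!: sum.cong)
    have z: "bin (polya_m h) ((2 * int h + 1) * k) = 0" if "k \<notin> {- int (polya_m h)..int (polya_m h)}" for k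
    proof -
      have "\<bar>k\<bar> * 1 \<le> \<bar>k\<bar> * (2 * int h + 1)" by (intro mult_left_mono) auto
      then have "\<bar>k\<bar> \<le> \<bar>(2 * int h + 1) * k\<bar>" by (simp add: abs_mult mult.commute)
      moreover have "int (polya_m h) < \<bar>k\<bar>" using that by auto
      ultimately have "\<not> \<bar>(2 * int h + 1) * k\<bar> \<le> int (polya_m h)" by linarith
      then show ?thesis by (simp only: bin_def if_False)
    qed
    have c: "infsum (\<lambda>k. c k h * g k) UNIV
        = (\<Sum>k\<in>{- int (polya_m h)..int (polya_m h)}. bin (polya_m h) ((2 * int h + 1) * k) * g k) / bin (polya_m h) 0" for g
      by (subst infsum_finite_support[of "{- int (polya_m h)..int (polya_m h)}"])
        (auto simp: c_def z sum_divide_distrib)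
    show ?thesis
      using polya_quotient[of h "polya_m h"] c[of "\<lambda>_. 1"] c[of "\<lambda>k. (- 1) powi k"] a[of 0] a[of "1 / 2"] by simp
  qed
  moreover have "(\<lambda>h. infsum (\<lambda>k. a (1 / 2) k h) UNIV * infsum (\<lambda>k. c k h) UNIV) \<longlonglongrightarrow>
      (\<Sum>\<^sub>\<infinity>k::int. exp (- s * (pi * (k + 1 / 2))\<^sup>2)) * (\<Sum>\<^sub>\<infinity>j::int. exp (- (real_of_int j)\<^sup>2 / s))"
    by (intro tendsto_mult A C) auto
  moreover have "(\<lambda>h. infsum (\<lambda>k. a 0 k h) UNIV * infsum (\<lambda>k. c k h * (- 1) powi k) UNIV) \<longlonglongrightarrow>
      (\<Sum>\<^sub>\<infinity>k::int. exp (- s * (pi * (k + 0))\<^sup>2)) * (\<Sum>\<^sub>\<infinity>j::int. exp (- (real_of_int j)\<^sup>2 / s) * (- 1) powi j)"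
    by (intro tendsto_mult A C') auto
  ultimately show ?thesis using LIMSEQ_unique by simp
qed

end

section \<open>Weber functions on the imaginary axis\<close>

lemma euler_phi_pos:
  fixes q :: real
  assumes "0 < q" "q < 1"
  shows "euler_phi q > 0"
proof -
  have "qpoch q q n \<ge> 0" for n
    unfolding qpoch_def using assms power_le_one[of q "Suc _"] by (intro prod_nonneg) auto
  then have "euler_phi q \<ge> 0"
    using assms by (intro LIMSEQ_le_const[OF qpoch_tendsto_qinf]) auto
  moreover have "euler_phi q \<noteq> 0" using assms by (intro qinf_neq_0) auto
  ultimately show ?thesis by simp
qed

text \<open>The Weber functions \<open>f\<close>, \<open>f\<^sub>1\<close>, \<open>f\<^sub>2\<close> at \<open>\<i> * t\<close>.\<close>

definition weber :: "real \<Rightarrow> real" where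
  "weber t = (let p = exp (- pi * t) in exp (pi * t / 24) * ((euler_phi (p\<^sup>2))\<^sup>2 / (euler_phi p * euler_phi (p ^ 4))))"

definition weber1 :: "real \<Rightarrow> real" where
  "weber1 t = (let p = exp (- pi * t) in exp (pi * t / 24) * (euler_phi p / euler_phi (p\<^sup>2)))"

definition weber2 :: "real \<Rightarrow> real" where
  "weber2 t = (let p = exp (- pi * t) in sqrt 2 * exp (- pi * t / 12) * (euler_phi (p ^ 4) / euler_phi (p\<^sup>2)))"

context
  fixes t :: real
  assumes t: "t > 0"
begin

lemma euler_phi_exp_pos: "euler_phi (exp (- pi * t) ^ Suc n) > 0"
  using t by (intro euler_phi_pos) (auto simp: power_less_one_iff simp del: power_Suc)

lemma euler_phi_exp_pos_numerals:
  "euler_phi (exp (- pi * t)) > 0" "euler_phi ((exp (- pi * t))\<^sup>2) > 0" "euler_phi (exp (- pi * t) ^ 4) > 0"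
  using euler_phi_exp_pos[of 0] euler_phi_exp_pos[of 1] euler_phi_exp_pos[of 3]
  by (simp_all add: numeral_2_eq_2 eval_nat_numeral)

lemma weber_pos: "weber t > 0" "weber1 t > 0" "weber2 t > 0"
  using euler_phi_exp_pos_numerals by (auto simp: weber_def weber1_def weber2_def Let_def)

lemma weber_product: "weber t * weber1 t * weber2 t = sqrt 2"
proof -
  have "exp (pi * t / 24) * exp (pi * t / 24) * exp (- pi * t / 12) = 1"
    by (simp flip: exp_add)
  moreover have alg: "E * (b\<^sup>2 / (a * c)) * (F * (a / b)) * (S * G * (c / b)) = S * (E * F * G)"
    if "a > 0" "b > 0" "c > 0" for a b c E F G S :: real
    using that by (simp add: power2_eq_square)
  ultimately show ?thesis
    unfolding weber_def weber1_def weber2_def Let_def alg[OF euler_phi_exp_pos_numerals] by simp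
qed

text \<open>Each theta constant is eta times the square of a Weber function. The common factor is
  eta at i t, namely q^(1/24) (q; q)_inf with q = exp (-2 pi t), and cancels in quotients.\<close>

lemma weber_theta:
  "((\<lambda>k::int. exp (- pi * t * (real_of_int k)\<^sup>2)) has_sum
      euler_phi ((exp (- pi * t))\<^sup>2) * exp (- pi * t / 12) * (weber t)\<^sup>2) UNIV"
  "((\<lambda>k::int. exp (- pi * t * (real_of_int k)\<^sup>2) * (- 1) powi k) has_sum
      euler_phi ((exp (- pi * t))\<^sup>2) * exp (- pi * t / 12) * (weber1 t)\<^sup>2) UNIV"
  "((\<lambda>k::int. exp (- pi * t * (k + 1 / 2)\<^sup>2)) has_sum
      euler_phi ((exp (- pi * t))\<^sup>2) * exp (- pi * t / 12) * (weber2 t)\<^sup>2) UNIV"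
proof -
  define p where "p = exp (- pi * t)"
  have p: "norm p < 1" "p \<noteq> 0" using t by (auto simp: p_def)
  note nz = euler_phi_exp_pos_numerals[folded p_def, THEN less_imp_neq, symmetric]
  have pull: "b * g * (e * x)\<^sup>2 = (g * e\<^sup>2) * (b * x\<^sup>2)" for b g e x :: real
    by (simp add: power2_eq_square mult_ac)
  have powi: "p powi n = exp (- pi * t * n)" for n :: int
    unfolding p_def by (simp add: exp_power_int mult_ac)
  have E: "exp (- pi * t / 12) * (exp (pi * t / 24))\<^sup>2 = 1"
    by (simp add: power2_eq_square flip: exp_add)
  have "p powi k\<^sup>2 = exp (- pi * t * (real_of_int k)\<^sup>2)" for k :: int
    unfolding powi by simp
  note pk = this
  have "euler_phi (p\<^sup>2) ^ 5 / (euler_phi p * euler_phi (p ^ 4))\<^sup>2 = euler_phi (p\<^sup>2) * exp (- pi * t / 12) * (weber t)\<^sup>2"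
  proof -
    have "b ^ 5 / (a * c)\<^sup>2 = b * g * (e * (b\<^sup>2 / (a * c)))\<^sup>2" if "g * e\<^sup>2 = 1" for a b c e g :: real
    proof -
      have "b * g * (e * (b\<^sup>2 / (a * c)))\<^sup>2 = (g * e\<^sup>2) * (b * (b\<^sup>2 / (a * c))\<^sup>2)"
        by (rule pull)
      also have "\<dots> = b ^ 5 / (a * c)\<^sup>2" unfolding that by (simp add: power_divide eval_nat_numeral)
      finally show ?thesis ..
    qed
    then show ?thesis using E unfolding weber_def p_def[symmetric] Let_def by blast
  qed
  then show "((\<lambda>k::int. exp (- pi * t * (real_of_int k)\<^sup>2)) has_sum
      euler_phi ((exp (- pi * t))\<^sup>2) * exp (- pi * t / 12) * (weber t)\<^sup>2) UNIV"
    using theta_products(1)[OF p] unfolding pk by (simp add: p_def)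
  have "(euler_phi p)\<^sup>2 / euler_phi (p\<^sup>2) = euler_phi (p\<^sup>2) * exp (- pi * t / 12) * (weber1 t)\<^sup>2"
  proof -
    have "a\<^sup>2 / b = b * g * (e * (a / b))\<^sup>2" if "g * e\<^sup>2 = 1" "b \<noteq> 0" for a b e g :: real
    proof -
      have "b * g * (e * (a / b))\<^sup>2 = (g * e\<^sup>2) * (b * (a / b)\<^sup>2)"
        by (rule pull)
      also have "\<dots> = a\<^sup>2 / b" unfolding that(1) using that(2) by (simp add: power2_eq_square)
      finally show ?thesis ..
    qed
    then show ?thesis using E nz unfolding weber1_def p_def[symmetric] Let_def by blast
  qed
  then show "((\<lambda>k::int. exp (- pi * t * (real_of_int k)\<^sup>2) * (- 1) powi k) has_sum
      euler_phi ((exp (- pi * t))\<^sup>2) * exp (- pi * t / 12) * (weber1 t)\<^sup>2) UNIV"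
    using theta_products(2)[OF p] unfolding pk by (simp add: p_def)
  have F: "exp (- pi * t / 12) * (exp (- pi * t / 12))\<^sup>2 = exp (- pi * t / 4)"
    by (simp add: power2_eq_square flip: exp_add)
  have "exp (- pi * t / 4) * (2 * (euler_phi (p ^ 4))\<^sup>2 / euler_phi (p\<^sup>2)) = euler_phi (p\<^sup>2) * exp (- pi * t / 12) * (weber2 t)\<^sup>2"
  proof -
    have "f * (2 * c\<^sup>2 / b) = b * g * (sqrt 2 * e * (c / b))\<^sup>2" if "g * e\<^sup>2 = f" "b \<noteq> 0" for c b e f g :: real
    proof -
      have "b * g * (sqrt 2 * e * (c / b))\<^sup>2 = (g * (sqrt 2 * e)\<^sup>2) * (b * (c / b)\<^sup>2)"
        by (rule pull)
      also have "g * (sqrt 2 * e)\<^sup>2 = 2 * f" unfolding that(1)[symmetric] by (simp add: power_mult_distrib)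
      also have "2 * f * (b * (c / b)\<^sup>2) = f * (2 * c\<^sup>2 / b)" using that(2) by (simp add: power2_eq_square)
      finally show ?thesis ..
    qed
    then show ?thesis using F nz unfolding weber2_def p_def[symmetric] Let_def by blast
  qed
  \<comment> \<open>Completing the square, k^2 + k + 1/4 = (k + 1/2)^2: the prefactor is the fourth
    root of the nome.\<close>
  moreover have "exp (- pi * t / 4) * p powi (k\<^sup>2 + k) = exp (- pi * t * (k + 1 / 2)\<^sup>2)" for k :: int
    unfolding powi exp_add[symmetric] by (simp add: power2_eq_square algebra_simps)
  ultimately show "((\<lambda>k::int. exp (- pi * t * (k + 1 / 2)\<^sup>2)) has_sum
      euler_phi ((exp (- pi * t))\<^sup>2) * exp (- pi * t / 12) * (weber2 t)\<^sup>2) UNIV"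
    using has_sum_cmult_right[OF theta_products(3)[OF p], of "exp (- pi * t / 4)"] by (simp add: p_def)
qed

end

text \<open>Apply the theta inversion with s = t / pi. The eta factors at t and at 1 / t occur once
  on each side and cancel; positivity then removes the squares.\<close>

lemma weber_quotient_inversion:
  assumes t: "t > 0"
  shows "weber2 t / weber t = weber1 (1 / t) / weber (1 / t)"
proof -
  have t': "1 / t > 0" using t by simp
  note pos = weber_pos[OF t] weber_pos[OF t']
  define A B where "A = euler_phi ((exp (- pi * t))\<^sup>2) * exp (- pi * t / 12)"
    and "B = euler_phi ((exp (- pi * (1 / t)))\<^sup>2) * exp (- pi * (1 / t) / 12)"
  have AB: "A \<noteq> 0" "B \<noteq> 0"
    using euler_phi_exp_pos_numerals(2)[OF t] euler_phi_exp_pos_numerals(2)[OF t'] by (auto simp: A_def B_def)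
  have s: "t / pi > 0" using t by simp
  have 1: "exp (- (t / pi) * (pi * (k + 1 / 2))\<^sup>2) = exp (- pi * t * (k + 1 / 2)\<^sup>2)"
    and 2: "exp (- (t / pi) * (pi * k)\<^sup>2) = exp (- pi * t * (real_of_int k)\<^sup>2)"
    and 3: "exp (- (real_of_int k)\<^sup>2 / (t / pi)) = exp (- pi * (1 / t) * (real_of_int k)\<^sup>2)" for k :: int
    using t by (simp_all add: power2_eq_square mult_ac)
  have "A * (weber2 t)\<^sup>2 * (B * (weber (1 / t))\<^sup>2) = A * (weber t)\<^sup>2 * (B * (weber1 (1 / t))\<^sup>2)"
    using theta_inversion_quotient[OF s] unfolding 1 2 3 A_def B_def
      infsumI[OF weber_theta(1)[OF t]] infsumI[OF weber_theta(3)[OF t]]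
      infsumI[OF weber_theta(1)[OF t']] infsumI[OF weber_theta(2)[OF t']]
    .
  then have "(weber2 t)\<^sup>2 * (weber (1 / t))\<^sup>2 = (weber t)\<^sup>2 * (weber1 (1 / t))\<^sup>2"
    using AB by simp
  then have "(weber2 t * weber (1 / t))\<^sup>2 = (weber t * weber1 (1 / t))\<^sup>2"
    by (simp only: power_mult_distrib)
  then have "weber2 t * weber (1 / t) = weber t * weber1 (1 / t)"
    using pos by (simp add: power2_eq_iff_nonneg less_imp_le)
  then show ?thesis using pos by (simp add: field_simps)
qed

text \<open>The product formula reads f^3 (f1 / f) (f2 / f) = sqrt 2. Passing from t to 1 / t swaps
  the two quotients, so f^3 is unchanged, and positivity allows the cube root.\<close>

theorem weber_inversion:
  assumes t: "t > 0"
  shows "weber (1 / t) = weber t" and "weber2 (1 / t) = weber1 t"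
proof -
  have t': "1 / t > 0" using t by simp
  have cube: "weber t ^ 3 * (weber1 t / weber t * (weber2 t / weber t)) = sqrt 2" if "t > 0" for t
    using weber_pos[OF that] weber_product[OF that] by (simp add: eval_nat_numeral)
  have q: "weber2 t / weber t = weber1 (1 / t) / weber (1 / t)" "weber2 (1 / t) / weber (1 / t) = weber1 t / weber t"
    using weber_quotient_inversion[OF t] weber_quotient_inversion[OF t'] by simp_all
  define u where "u = weber1 t / weber t * (weber2 t / weber t)"
  have u: "u > 0" using weber_pos[OF t] by (simp add: u_def)
  have "weber1 (1 / t) / weber (1 / t) * (weber2 (1 / t) / weber (1 / t)) = u"
    unfolding u_def q by (rule mult.commute)
  then have "weber (1 / t) ^ 3 * u = weber t ^ 3 * u"
    using cube[OF t] cube[OF t'] by (simp add: u_def)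
  then have "weber (1 / t) ^ 3 = weber t ^ 3" using u by simp
  then show w: "weber (1 / t) = weber t"
    by (rule power_eq_imp_eq_base) (use weber_pos(1)[OF t] weber_pos(1)[OF t'] in auto)
  show "weber2 (1 / t) = weber1 t"
    using q(2) weber_pos(1)[OF t] unfolding w by simp
qed

section \<open>The inversion formula on the upper half plane\<close>

lemma qinf_of_real:
  fixes a q :: real
  assumes "\<bar>q\<bar> < 1"
  shows "qinf (complex_of_real a) (complex_of_real q) = of_real (qinf a q)"
proof -
  have "(\<lambda>n. complex_of_real (qpoch a q n)) \<longlonglongrightarrow> of_real (qinf a q)"
    using assms by (intro tendsto_of_real qpoch_tendsto_qinf) simp
  moreover have "complex_of_real (qpoch a q n) = qpoch (of_real a) (of_real q) n" for n
    by (simp add: qpoch_def)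
  moreover have "qpoch (complex_of_real a) (of_real q) \<longlonglongrightarrow> qinf (complex_of_real a) (of_real q)"
    using assms by (intro qpoch_tendsto_qinf) simp
  ultimately show ?thesis using LIMSEQ_unique by fastforce
qed

text \<open>The partial products are polynomials converging uniformly on a disc around x, with
  geometric majorant R^(n+1). The radius d is half the distance from x to the unit circle, which
  keeps R below 1.\<close>

lemma holomorphic_euler_phi: "euler_phi holomorphic_on ball (0 :: complex) 1"
proof (rule holomorphic_uniform_sequence)
  show "(\<lambda>q. qpoch q q n) holomorphic_on ball 0 1" for n
    unfolding qpoch_def by (intro holomorphic_intros)
  fix x :: complex assume "x \<in> ball 0 1"
  then have x: "norm x < 1" by simp
  define d where "d = (1 - norm x) / 2"
  define R where "R = norm x + d"
  have d: "d > 0" "R < 1" "R \<ge> 0" using x by (auto simp: d_def R_def field_simps)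
  have cb: "norm y \<le> R" if "y \<in> cball x d" for y
    using that norm_triangle_sub[of y x] by (auto simp: R_def dist_norm norm_minus_commute)
  have "uniformly_convergent_on (cball x d) (\<lambda>N y. \<Prod>n<N. 1 - y * y ^ n)"
  proof (rule Infinite_Products.uniformly_convergent_on_prod')
    show "continuous_on (cball x d) (\<lambda>y. 1 - y * y ^ n)" for n by (intro continuous_intros)
    show "compact (cball x d)" by simp
    have "uniform_limit (cball x d) (\<lambda>N y. \<Sum>n<N. norm (1 - y * y ^ n - 1)) (\<lambda>y. suminf (\<lambda>n. norm (1 - y * y ^ n - 1))) sequentially"
    proof (rule Weierstrass_m_test_ev)
      show "\<forall>\<^sub>F n in sequentially. \<forall>y\<in>cball x d. norm (norm (1 - y * y ^ n - 1)) \<le> R ^ Suc n"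
        using cb by (intro always_eventually allI ballI)
          (simp add: norm_power norm_mult mult_mono power_mono d)
      show "summable (\<lambda>n. R ^ Suc n)" using d by (subst summable_Suc_iff) (simp add: summable_geometric)
    qed
    then show "uniformly_convergent_on (cball x d) (\<lambda>N y. \<Sum>n<N. norm (1 - y * y ^ n - 1))"
      unfolding uniformly_convergent_on_def by blast
  qed
  then obtain g where g: "uniform_limit (cball x d) (\<lambda>N y. \<Prod>n<N. 1 - y * y ^ n) g sequentially"
    unfolding uniformly_convergent_on_def by blast
  have "g y = euler_phi y" if "y \<in> cball x d" for y
    using LIMSEQ_unique[OF tendsto_uniform_limitI[OF g that] qpoch_tendsto_qinf[of y y, unfolded qpoch_def[abs_def]]] cb[OF that] d
    by simp
  then have "uniform_limit (cball x d) (\<lambda>n q. qpoch q q n) euler_phi sequentially"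
    by (intro uniform_limit_cong'[THEN iffD1, OF _ _ g]) (auto simp: qpoch_def)
  moreover have "cball x d \<subseteq> ball 0 1" using cb d by fastforce
  ultimately show "\<exists>d. 0 < d \<and> cball x d \<subseteq> ball 0 1 \<and> uniform_limit (cball x d) (\<lambda>n q. qpoch q q n) euler_phi sequentially"
    using d by blast
qed simp

lemma euler_phi_power_neq_0:
  fixes q :: complex
  assumes "norm q < 1" "n > 0"
  shows "euler_phi (q ^ n) \<noteq> 0"
  using assms by (intro qinf_neq_0 norm_power_less_1)

text \<open>The Capparelli product (-q^2, -q^3, -q^4, -q^6; q^6)_inf as an eta quotient, the form
  that shows holomorphy and can be compared with Weber functions.\<close>

lemma a1_product:
  assumes q: "norm q < 1" "q \<noteq> 0"
  shows "a1 q = euler_phi (q ^ 4) * (euler_phi (q ^ 6))\<^sup>2 / (euler_phi (q\<^sup>2) * euler_phi (q ^ 12) * euler_phi (q ^ 3))"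
proof -
  have "a1 q * euler_phi (q ^ 3) = euler_phi (q ^ 4) * (euler_phi (q ^ 6))\<^sup>2 / (euler_phi (q\<^sup>2) * euler_phi (q ^ 12) * euler_phi (q ^ 3)) * euler_phi (q ^ 3)"
    using has_sum_unique[OF a1_theta[OF q] capparelli_theta_products(1)[OF q]] euler_phi_power_neq_0[OF q(1), of 3]
    by simp
  then show ?thesis by (rule mult_right_cancel[THEN iffD1, rotated]) (simp add: euler_phi_power_neq_0[OF q(1)])
qed

text \<open>The eta quotient of the companion product (-q, -q^3, -q^5, -q^6; q^6)_inf.\<close>

lemma a2_product:
  assumes q: "norm q < 1" "q \<noteq> 0"
  shows "a2 q = (euler_phi (q\<^sup>2))\<^sup>2 * euler_phi (q ^ 12) / (euler_phi q * euler_phi (q ^ 4) * euler_phi (q ^ 6))"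
proof -
  have "a2 q * euler_phi (q ^ 3) = (euler_phi (q\<^sup>2))\<^sup>2 * euler_phi (q ^ 12) / (euler_phi q * euler_phi (q ^ 4) * euler_phi (q ^ 6)) * euler_phi (q ^ 3)"
    using has_sum_unique[OF a2_theta[OF q] capparelli_theta_products(2)[OF q]] by (simp add: mult_ac)
  then show ?thesis by (rule mult_right_cancel[THEN iffD1, rotated]) (simp add: euler_phi_power_neq_0[OF q(1)])
qed

text \<open>With q = x^4 the prefactors of the two components of \<open>X\<close> differ by q^(1/4)
  = x, so the left side is q^(1/24) times their sum. It is the theta series split by parity, divided
  by (x^12; x^12)_inf.\<close>

lemma a1_a2_combination:
  fixes x :: complex
  assumes x: "norm x < 1" "x \<noteq> 0"
  shows "a1 (x ^ 4) + x * a2 (x ^ 4)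
       = (euler_phi (x\<^sup>2))\<^sup>2 * euler_phi (x ^ 3) / (euler_phi x * euler_phi (x ^ 4) * euler_phi (x ^ 6))"
proof -
  have x4: "norm (x ^ 4) < 1" "x ^ 4 \<noteq> 0" using x norm_power_less_1[of x 4] by auto
  have "(x ^ 4) ^ 3 = x ^ 12" by (simp flip: power_mult)
  then have "a1 (x ^ 4) * euler_phi (x ^ 12) + x * (a2 (x ^ 4) * euler_phi (x ^ 12))
       = (euler_phi (x\<^sup>2))\<^sup>2 * euler_phi (x ^ 3) * euler_phi (x ^ 12) / (euler_phi x * euler_phi (x ^ 4) * euler_phi (x ^ 6))"
    using has_sum_unique[OF theta_parity_split[OF x a1_theta[OF x4] a2_theta[OF x4]] capparelli_theta_products(2)[OF x]]
    by simp
  then have "(a1 (x ^ 4) + x * a2 (x ^ 4)) * euler_phi (x ^ 12)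
       = (euler_phi (x\<^sup>2))\<^sup>2 * euler_phi (x ^ 3) / (euler_phi x * euler_phi (x ^ 4) * euler_phi (x ^ 6)) * euler_phi (x ^ 12)"
    by (simp add: algebra_simps)
  then show ?thesis by (rule mult_right_cancel[THEN iffD1, rotated]) (simp add: euler_phi_power_neq_0[OF x(1)])
qed

definition X1 :: "complex \<Rightarrow> complex" where
  "X1 \<tau> = q_pow (- 1 / 24) \<tau> * a1 (q_pow 1 \<tau>)"

definition X2 :: "complex \<Rightarrow> complex" where
  "X2 \<tau> = q_pow (5 / 24) \<tau> * a2 (q_pow 1 \<tau>)"

lemma norm_q_pow_1:
  assumes "Im \<tau> > 0"
  shows "norm (q_pow 1 \<tau>) < 1" "q_pow 1 \<tau> \<noteq> 0"
  using assms by (simp_all add: q_pow_def)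

lemma q_pow_holomorphic [holomorphic_intros]:
  "f holomorphic_on A \<Longrightarrow> (\<lambda>\<tau>. q_pow r (f \<tau>)) holomorphic_on A"
  unfolding q_pow_def by (intro holomorphic_intros)

lemma euler_phi_q_pow_holomorphic:
  assumes "n > 0"
  shows "(\<lambda>\<tau>. euler_phi (q_pow 1 \<tau> ^ n)) holomorphic_on {\<tau>. Im \<tau> > 0}"
proof -
  have "euler_phi \<circ> (\<lambda>\<tau>. q_pow 1 \<tau> ^ n) holomorphic_on {\<tau>. Im \<tau> > 0}"
    by (rule holomorphic_on_compose_gen[OF _ holomorphic_euler_phi])
      (use norm_q_pow_1 assms in \<open>auto intro!: holomorphic_intros norm_power_less_1\<close>)
  then show ?thesis by (simp add: comp_def)
qed

lemma X1_X2_holomorphic: "X1 holomorphic_on {\<tau>. Im \<tau> > 0}" "X2 holomorphic_on {\<tau>. Im \<tau> > 0}"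
proof -
  note h = euler_phi_q_pow_holomorphic and nz = euler_phi_power_neq_0[OF norm_q_pow_1(1)]
  have "(\<lambda>\<tau>. q_pow (- 1 / 24) \<tau> * (euler_phi (q_pow 1 \<tau> ^ 4) * (euler_phi (q_pow 1 \<tau> ^ 6))\<^sup>2
      / (euler_phi ((q_pow 1 \<tau>)\<^sup>2) * euler_phi (q_pow 1 \<tau> ^ 12) * euler_phi (q_pow 1 \<tau> ^ 3)))) holomorphic_on {\<tau>. Im \<tau> > 0}"
    by (intro holomorphic_intros h) (use nz in auto)
  then show "X1 holomorphic_on {\<tau>. Im \<tau> > 0}"
    by (rule holomorphic_transform) (simp add: X1_def a1_product norm_q_pow_1)
  have "(\<lambda>\<tau>. q_pow (5 / 24) \<tau> * ((euler_phi ((q_pow 1 \<tau>)\<^sup>2))\<^sup>2 * euler_phi (q_pow 1 \<tau> ^ 12)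
      / (euler_phi (q_pow 1 \<tau> ^ 1) * euler_phi (q_pow 1 \<tau> ^ 4) * euler_phi (q_pow 1 \<tau> ^ 6)))) holomorphic_on {\<tau>. Im \<tau> > 0}"
    by (intro holomorphic_intros h) (use nz[of _ 1] nz in auto)
  then show "X2 holomorphic_on {\<tau>. Im \<tau> > 0}"
    by (rule holomorphic_transform) (simp add: X2_def a2_product norm_q_pow_1)
qed

lemma q_pow_imaginary: "q_pow r (\<i> * of_real t) = of_real (exp (- 2 * pi * of_rat r * t))"
proof -
  have "2 * of_real pi * \<i> * of_rat r * (\<i> * of_real t) = complex_of_real (- 2 * pi * of_rat r * t)"
  proof -
    have "of_rat r = complex_of_real (of_rat r)" by (cases r) (simp add: of_rat_rat)
    then show ?thesis by (simp add: complex_eq_iff)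
  qed
  then show ?thesis by (simp only: q_pow_def exp_of_real)
qed

lemma X1_imaginary:
  assumes t: "t > 0"
  shows "X1 (\<i> * of_real t) = of_real (weber (6 * t) * weber2 (2 * t) / sqrt 2)"
proof -
  define q where "q = exp (- 2 * pi * t)"
  have q: "0 < q" "q < 1" using t by (auto simp: q_def)
  have e: "q_pow 1 (\<i> * of_real t) = of_real q" unfolding q_pow_imaginary by (simp add: q_def)
  have r: "euler_phi (complex_of_real q ^ n) = of_real (euler_phi (q ^ n))" if "n > 0" for n
    using qinf_of_real[of "q ^ n" "q ^ n"] q that by (simp add: power_less_one_iff)
  have p6: "exp (- pi * (6 * t)) = q ^ 3" and p2: "exp (- pi * (2 * t)) = q"
    by (simp_all add: q_def flip: exp_of_nat_mult)
  have pw: "(q ^ 3)\<^sup>2 = q ^ 6" "(q ^ 3) ^ 4 = q ^ 12" by (simp_all flip: power_mult)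
  have "norm (complex_of_real q) < 1" "complex_of_real q \<noteq> 0" using q by auto
  from a1_product[OF this] have "a1 (of_real q) = of_real (euler_phi (q ^ 4) * (euler_phi (q ^ 6))\<^sup>2
      / (euler_phi (q\<^sup>2) * euler_phi (q ^ 12) * euler_phi (q ^ 3)))"
    by (simp add: r)
  moreover have "q_pow (- 1 / 24) (\<i> * of_real t) = of_real (exp (pi * (6 * t) / 24) * exp (- pi * (2 * t) / 12))"
    unfolding q_pow_imaginary exp_add[symmetric] by (simp add: of_rat_divide of_rat_minus)
  moreover have "weber (6 * t) * weber2 (2 * t) / sqrt 2 = exp (pi * (6 * t) / 24) * exp (- pi * (2 * t) / 12) *
     (euler_phi (q ^ 4) * (euler_phi (q ^ 6))\<^sup>2 / (euler_phi (q\<^sup>2) * euler_phi (q ^ 12) * euler_phi (q ^ 3)))"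
    unfolding weber_def weber2_def Let_def p6 p2 pw by (simp add: mult_ac)
  ultimately show ?thesis unfolding X1_def e by (simp only: of_real_mult)
qed

lemma X_inversion_imaginary:
  assumes t: "t > 0"
  shows "sqrt 2 * X1 (\<i> / of_real t) = X1 (\<i> * of_real t / 3) + X2 (\<i> * of_real t / 3)"
proof -
  \<comment> \<open>At i t / 3 one has q = exp (-2 pi t / 3) = x^4. Moreover x is the nome of
    \<open>weber (t / 6)\<close> and x^3 that of \<open>weber1 (t / 2)\<close>.\<close>
  define x where "x = exp (- pi * (t / 6))"
  have x: "0 < x" "x < 1" using t by (auto simp: x_def)
  have x': "norm (complex_of_real x) < 1" "complex_of_real x \<noteq> 0" using x by auto
  have r: "euler_phi (complex_of_real x ^ n) = of_real (euler_phi (x ^ n))" if "n > 0" for n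
    using qinf_of_real[of "x ^ n" "x ^ n"] x that by (simp add: power_less_one_iff)
  have t3: "\<i> * of_real t / 3 = \<i> * of_real (t / 3)" by simp
  have q: "q_pow 1 (\<i> * of_real (t / 3)) = of_real x ^ 4"
    unfolding q_pow_imaginary of_real_power[symmetric] by (simp add: x_def flip: exp_of_nat_mult)
  have q1: "q_pow (- 1 / 24) (\<i> * of_real (t / 3)) = of_real (exp (pi * t / 36))"
    unfolding q_pow_imaginary by (simp add: of_rat_divide of_rat_minus)
  have "exp (- (5 * pi * t / 36)) = exp (pi * t / 36) * x" unfolding x_def exp_add[symmetric] by simp
  then have q2: "q_pow (5 / 24) (\<i> * of_real (t / 3)) = of_real (exp (pi * t / 36)) * of_real x"
    unfolding q_pow_imaginary by (simp add: of_rat_divide flip: of_real_mult)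
  have "X1 (\<i> * of_real t / 3) + X2 (\<i> * of_real t / 3) = of_real (exp (pi * t / 36)) * (a1 (of_real x ^ 4) + of_real x * a2 (of_real x ^ 4))"
    unfolding t3 X1_def X2_def q q1 q2 by (simp add: algebra_simps)
  also have "\<dots> = of_real (exp (pi * t / 36) * ((euler_phi (x\<^sup>2))\<^sup>2 * euler_phi (x ^ 3) / (euler_phi x * euler_phi (x ^ 4) * euler_phi (x ^ 6))))"
    unfolding a1_a2_combination[OF x'] using r[of 1] by (simp add: r)
  also have "exp (pi * t / 36) * ((euler_phi (x\<^sup>2))\<^sup>2 * euler_phi (x ^ 3) / (euler_phi x * euler_phi (x ^ 4) * euler_phi (x ^ 6)))
      = weber (t / 6) * weber1 (t / 2)"
  proof -
    have p: "exp (- pi * (t / 2)) = x ^ 3" by (simp add: x_def flip: exp_of_nat_mult)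
    have p6: "(x ^ 3)\<^sup>2 = x ^ 6" by (simp flip: power_mult)
    \<comment> \<open>1/36 = 1/144 + 1/48 distributes the prefactor over the two Weber
      functions.\<close>
    have e: "exp (pi * t / 36) = exp (pi * (t / 6) / 24) * exp (pi * (t / 2) / 24)"
      unfolding exp_add[symmetric] by simp
    show ?thesis unfolding weber_def weber1_def Let_def p x_def[symmetric] p6 e by simp
  qed
  also have "weber (t / 6) * weber1 (t / 2) = weber (6 * (1 / t)) * weber2 (2 * (1 / t))"
    using weber_inversion(1)[of "t / 6"] weber_inversion(2)[of "t / 2"] t by simp
  also have "complex_of_real (weber (6 * (1 / t)) * weber2 (2 * (1 / t))) = sqrt 2 * X1 (\<i> * of_real (1 / t))"
    using X1_imaginary[of "1 / t"] t by simp
  finally show ?thesis by simp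
qed

theorem X1_inversion:
  assumes \<tau>: "Im \<tau> > 0"
  shows "sqrt 2 * X1 (- 1 / \<tau>) = X1 (\<tau> / 3) + X2 (\<tau> / 3)"
proof -
  let ?S = "{\<tau>. Im \<tau> > 0}"
  have inv: "Im (- 1 / z) > 0" if "Im z > 0" for z
    using that by (simp add: Im_divide power2_eq_square divide_pos_pos add_nonneg_pos)
  have "(\<lambda>\<tau>. X1 (- 1 / \<tau>)) holomorphic_on ?S"
    by (rule holomorphic_on_compose_gen[OF _ X1_X2_holomorphic(1), unfolded comp_def])
      (use inv in \<open>auto intro!: holomorphic_intros\<close>)
  moreover have "(\<lambda>\<tau>. X1 (\<tau> / 3)) holomorphic_on ?S" "(\<lambda>\<tau>. X2 (\<tau> / 3)) holomorphic_on ?S"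
    by (rule holomorphic_on_compose_gen[OF _ X1_X2_holomorphic(1), unfolded comp_def];
        auto intro!: holomorphic_intros)
      (rule holomorphic_on_compose_gen[OF _ X1_X2_holomorphic(2), unfolded comp_def];
        auto intro!: holomorphic_intros)
  ultimately have h: "(\<lambda>\<tau>. sqrt 2 * X1 (- 1 / \<tau>) - (X1 (\<tau> / 3) + X2 (\<tau> / 3))) holomorphic_on ?S"
    by (intro holomorphic_intros)
  define U where "U = (\<lambda>t. \<i> * complex_of_real t) ` {0<..}"
  have "sqrt 2 * X1 (- 1 / \<tau>) - (X1 (\<tau> / 3) + X2 (\<tau> / 3)) = 0"
  proof (rule analytic_continuation[OF h, of U \<i>])
    show "open ?S" by (rule open_halfspace_Im_gt)
    show "connected ?S" by (rule connected_halfspace_Im_gt)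
    show "U \<subseteq> ?S" by (auto simp: U_def)
    show "\<i> islimpt U"
    proof (rule islimptI)
      fix T assume T: "\<i> \<in> T" "open T"
      then obtain e where e: "e > 0" "ball \<i> e \<subseteq> T" using open_contains_ball by blast
      have "\<i> * of_real (1 + e / 2) \<in> ball \<i> e"
        using e by (simp add: dist_norm norm_mult algebra_simps)
      moreover have "\<i> * of_real (1 + e / 2) \<in> U" unfolding U_def by (rule imageI) (use e in simp)
      moreover have "\<i> * of_real (1 + e / 2) \<noteq> \<i>" using e by (simp add: complex_eq_iff)
      ultimately show "\<exists>y\<in>U. y \<in> T \<and> y \<noteq> \<i>" using e by blast
    qed
    show "sqrt 2 * X1 (- 1 / z) - (X1 (z / 3) + X2 (z / 3)) = 0" if "z \<in> U" for z
    proof -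
      from that obtain t where t: "t > 0" "z = \<i> * of_real t" by (auto simp: U_def)
      have "- 1 / z = \<i> / of_real t" using t by (simp add: field_simps)
      then show ?thesis using X_inversion_imaginary[OF t(1)] t by simp
    qed
  qed (use \<tau> in auto)
  then show ?thesis by simp
qed

section \<open>Modularity on \<open>\<Gamma>\<^sub>0(3)\<close>\<close>

lemma vec2_eq_iff: "(x :: 'a ^ 2) = y \<longleftrightarrow> x $ 1 = y $ 1 \<and> x $ 2 = y $ 2"
  by (simp add: vec_eq_iff forall_2)

lemma matrix2_mult_vector:
  fixes x :: "complex ^ 2"
  shows "(vector [vector [a, b], vector [c, d]] :: complex ^ 2 ^ 2) *v x = vector [a * x $ 1 + b * x $ 2, c * x $ 1 + d * x $ 2]"
  by (simp add: vec2_eq_iff matrix_vector_mult_def sum_2)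

lemma X_eq: "X \<tau> = vector [X1 \<tau>, X2 \<tau>]"
  by (simp add: X_def X1_def X2_def)

lemma X_translation:
  "X (\<tau> + 1) = (vector [vector [inverse (zeta 24), 0], vector [0, zeta 24 ^ 5]] :: complex ^ 2 ^ 2) *v X \<tau>"
proof -
  have q: "q_pow r (\<tau> + 1) = exp (2 * of_real pi * \<i> * of_rat r) * q_pow r \<tau>" for r
    unfolding q_pow_def exp_add[symmetric] by (simp add: algebra_simps)
  have 1: "exp (2 * of_real pi * \<i>) = (1 :: complex)" by simp
  have "exp (2 * of_real pi * \<i> * of_rat (- 1 / 24)) = inverse (zeta 24)"
    by (simp add: zeta_def of_rat_divide of_rat_minus flip: exp_minus)
  moreover have "exp (2 * of_real pi * \<i> * of_rat (5 / 24)) = zeta 24 ^ 5"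
    unfolding zeta_def exp_of_nat_mult[symmetric] by (simp add: of_rat_divide)
  ultimately show ?thesis
    unfolding matrix2_mult_vector X_eq X1_def X2_def q by (simp add: vec2_eq_iff 1)
qed

lemma X2_inversion:
  assumes \<tau>: "Im \<tau> > 0"
  shows "sqrt 2 * X2 (- 1 / \<tau>) = X1 (\<tau> / 3) - X2 (\<tau> / 3)"
proof -
  have "Im (- 3 / \<tau>) > 0"
    using \<tau> by (simp add: Im_divide power2_eq_square divide_pos_pos add_nonneg_pos)
  from X1_inversion[OF this] have "sqrt 2 * X1 (\<tau> / 3) = X1 (- 1 / \<tau>) + X2 (- 1 / \<tau>)" by simp
  then have "sqrt 2 * (sqrt 2 * X1 (\<tau> / 3)) = sqrt 2 * X1 (- 1 / \<tau>) + sqrt 2 * X2 (- 1 / \<tau>)"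
    by (simp add: distrib_left)
  moreover have "complex_of_real (sqrt 2) * (sqrt 2 * z) = 2 * z" for z :: complex
  proof -
    have "complex_of_real (sqrt 2) * sqrt 2 = 2" by (simp flip: of_real_mult)
    then show ?thesis by (metis mult.assoc)
  qed
  ultimately have "2 * X1 (\<tau> / 3) = (X1 (\<tau> / 3) + X2 (\<tau> / 3)) + sqrt 2 * X2 (- 1 / \<tau>)"
    by (simp only: X1_inversion[OF \<tau>])
  then show ?thesis by (simp add: algebra_simps)
qed

abbreviation (input) inversion_matrix :: "complex ^ 2 ^ 2" where
  "inversion_matrix \<equiv> (1 / sqrt 2) *\<^sub>R (vector [vector [1, 1], vector [1, -1]] :: complex ^ 2 ^ 2)"

lemma inversion_matrix_mult:
  "inversion_matrix *v x = vector [(1 / sqrt 2) *\<^sub>R (x $ 1 + x $ 2), (1 / sqrt 2) *\<^sub>R (x $ 1 - x $ 2)]"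
  by (simp add: vec2_eq_iff matrix_vector_mult_def sum_2 scaleR_add_right scaleR_diff_right)

lemma X_inversion:
  assumes \<tau>: "Im \<tau> > 0"
  shows "X (- 1 / \<tau>) = inversion_matrix *v X (\<tau> / 3)"
proof -
  have "z = (1 / sqrt 2) *\<^sub>R w" if "sqrt 2 * z = w" for z w :: complex
    using that by (simp add: scaleR_conv_of_real field_simps)
  from this[OF X1_inversion[OF \<tau>]] this[OF X2_inversion[OF \<tau>]] show ?thesis
    by (simp add: vec2_eq_iff X_eq inversion_matrix_mult)
qed

text \<open>Allows the inversion formula to be read backwards in
  \<open>X_lower_unipotent\<close>.\<close>

lemma inversion_matrix_involution: "inversion_matrix *v (inversion_matrix *v x) = x"
proof -
  have "(1 / sqrt 2) *\<^sub>R ((1 / sqrt 2) *\<^sub>R u + (1 / sqrt 2) *\<^sub>R v) = (1 / 2) *\<^sub>R (u + v)"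
    "(1 / sqrt 2) *\<^sub>R ((1 / sqrt 2) *\<^sub>R u - (1 / sqrt 2) *\<^sub>R v) = (1 / 2) *\<^sub>R (u - v)" for u v :: complex
    by (simp_all flip: scaleR_add_right scaleR_diff_right)
  note half = this
  show ?thesis unfolding inversion_matrix_mult vec2_eq_iff vector_2 half by (simp add: scaleR_conv_of_real)
qed

lemma X_translation_int: "\<exists>\<rho> :: complex ^ 2 ^ 2. \<forall>\<tau>. X (\<tau> + of_int k) = \<rho> *v X \<tau>"
proof -
  have up: "\<exists>\<rho> :: complex ^ 2 ^ 2. \<forall>\<tau>. X (\<tau> + of_nat n) = \<rho> *v X \<tau>" for n
  proof (induction n)
    case 0
    show ?case by (intro exI[of _ "mat 1"]) simp
  next
    case (Suc n)
    then obtain \<rho> :: "complex ^ 2 ^ 2" where "\<And>\<tau>. X (\<tau> + of_nat n) = \<rho> *v X \<tau>" by blast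
    then have "X (\<tau> + of_nat (Suc n)) = ((vector [vector [inverse (zeta 24), 0], vector [0, zeta 24 ^ 5]]) ** \<rho>) *v X \<tau>" for \<tau>
      using X_translation[of "\<tau> + of_nat n"] by (simp add: matrix_vector_mul_assoc add_ac)
    then show ?case by blast
  qed
  let ?D = "vector [vector [zeta 24, 0], vector [0, inverse (zeta 24 ^ 5)]] :: complex ^ 2 ^ 2"
  have down1: "X (\<tau> - 1) = ?D *v X \<tau>" for \<tau>
  proof -
    have "zeta 24 \<noteq> 0" by (simp add: zeta_def)
    then show ?thesis
      using X_translation[of "\<tau> - 1"] by (simp add: matrix2_mult_vector vec2_eq_iff)
  qed
  have down: "\<exists>\<rho> :: complex ^ 2 ^ 2. \<forall>\<tau>. X (\<tau> - of_nat n) = \<rho> *v X \<tau>" for n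
  proof (induction n)
    case 0
    show ?case by (intro exI[of _ "mat 1"]) simp
  next
    case (Suc n)
    then obtain \<rho> :: "complex ^ 2 ^ 2" where "\<And>\<tau>. X (\<tau> - of_nat n) = \<rho> *v X \<tau>" by blast
    then have "X (\<tau> - of_nat (Suc n)) = (?D ** \<rho>) *v X \<tau>" for \<tau>
      using down1[of "\<tau> - of_nat n"] by (simp add: matrix_vector_mul_assoc algebra_simps)
    then show ?case by blast
  qed
  show ?thesis
    using up[of "nat k"] down[of "nat (- k)"] by (cases "k \<ge> 0") auto
qed

text \<open>With \<open>S = (0, -1; 1, 0)\<close> and \<open>T = (1, 1; 0, 1)\<close>, this is the action of \<open>S T\<^sup>-\<^sup>3\<^sup>k S\<^sup>-\<^sup>1\<close>.\<close>

lemma X_lower_unipotent: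
  "\<exists>\<rho> :: complex ^ 2 ^ 2. \<forall>\<tau>. Im \<tau> > 0 \<longrightarrow> X (\<tau> / (of_int (3 * k) * \<tau> + 1)) = \<rho> *v X \<tau>"
proof -
  obtain R :: "complex ^ 2 ^ 2" where R: "\<And>\<tau>. X (\<tau> + of_int (- k)) = R *v X \<tau>"
    using X_translation_int[of "- k"] by blast
  have "X (\<tau> / (of_int (3 * k) * \<tau> + 1)) = (inversion_matrix ** (R ** inversion_matrix)) *v X \<tau>"
    if \<tau>: "Im \<tau> > 0" for \<tau>
  proof -
    define w where "w = - 1 / \<tau>"
    have w: "Im w > 0"
      using \<tau> by (simp add: w_def Im_divide power2_eq_square divide_pos_pos add_nonneg_pos)
    have \<tau>0: "\<tau> \<noteq> 0" using \<tau> by auto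
    have "of_int (3 * k) * \<tau> + 1 \<noteq> 0"
    proof
      assume "of_int (3 * k) * \<tau> + 1 = 0"
      then have "Im (of_int (3 * k) * \<tau> + 1) = 0" "Re (of_int (3 * k) * \<tau> + 1) = 0" by (simp_all only: zero_complex.sel)
      then show False using \<tau> by auto
    qed
    moreover define P where "P = of_int (3 * k) * \<tau> + 1"
    moreover have "w + of_int (- 3 * k) = - (P / \<tau>)"
      using \<tau>0 by (simp add: w_def P_def field_simps)
    ultimately have e: "\<tau> / (of_int (3 * k) * \<tau> + 1) = - 1 / (w + of_int (- 3 * k))"
      unfolding P_def[symmetric] by simp
    have "X \<tau> = inversion_matrix *v X (w / 3)"
      using X_inversion[OF w] \<tau>0 by (simp add: w_def)
    then have X\<tau>: "inversion_matrix *v X \<tau> = X (w / 3)" by (simp only: inversion_matrix_involution)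
    have "X (\<tau> / (of_int (3 * k) * \<tau> + 1)) = inversion_matrix *v X ((w + of_int (- 3 * k)) / 3)"
      unfolding e by (rule X_inversion) (use w in simp)
    \<comment> \<open>The inversion formula evaluates \<open>X\<close> at a third of the argument,
      so translating w by a multiple of 3 becomes an integral translation. This is the source of the
      level 3.\<close>
    also have "(w + of_int (- 3 * k)) / 3 = w / 3 + of_int (- k)" by (simp add: field_simps)
    also have "X \<dots> = R *v (inversion_matrix *v X \<tau>)" unfolding R X\<tau> ..
    finally show ?thesis by (simp only: matrix_vector_mul_assoc matrix_mul_assoc)
  qed
  then show ?thesis by blast
qed

section \<open>Row operations and descent in Gamma_0(3)\<close>

definition int_moebius :: "int \<Rightarrow> int \<Rightarrow> int \<Rightarrow> int \<Rightarrow> complex \<Rightarrow> complex" where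
  "int_moebius a b c d \<tau> = (of_int a * \<tau> + of_int b) / (of_int c * \<tau> + of_int d)"

lemma int_moebius_upper_half_plane:
  assumes "a * d - b * c = 1" "Im \<tau> > 0"
  shows "of_int c * \<tau> + of_int d \<noteq> 0" "Im (int_moebius a b c d \<tau>) > 0"
proof -
  show nz: "of_int c * \<tau> + of_int d \<noteq> 0"
  proof
    assume "of_int c * \<tau> + of_int d = 0"
    then have "Im (of_int c * \<tau> + of_int d) = 0" "Re (of_int c * \<tau> + of_int d) = 0" by (simp_all only: zero_complex.sel)
    then show False using assms by auto
  qed
  have det: "real_of_int a * d - real_of_int b * c = 1" using assms(1) by (metis of_int_1 of_int_diff of_int_mult)
  have "Im (int_moebius a b c d \<tau>) = ((real_of_int a * d - real_of_int b * c) * Im \<tau>)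
      / ((Re (of_int c * \<tau> + of_int d))\<^sup>2 + (Im (of_int c * \<tau> + of_int d))\<^sup>2)"
    unfolding int_moebius_def Im_divide by (simp add: algebra_simps)
  moreover have "(Re (of_int c * \<tau> + of_int d))\<^sup>2 + (Im (of_int c * \<tau> + of_int d))\<^sup>2 > 0"
    using nz complex_neq_0 by blast
  ultimately show "Im (int_moebius a b c d \<tau>) > 0" using assms(2) unfolding det by simp
qed

definition X_transforms :: "int \<Rightarrow> int \<Rightarrow> int \<Rightarrow> int \<Rightarrow> bool" where
  "X_transforms a b c d \<longleftrightarrow>
     (\<exists>\<rho> :: complex ^ 2 ^ 2. \<forall>\<tau>. Im \<tau> > 0 \<longrightarrow> X (int_moebius a b c d \<tau>) = \<rho> *v X \<tau>)"

text \<open>Left multiplication by a power of the translation: the value z of the Moebius map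
  becomes z + k.\<close>

lemma X_transforms_add_row1:
  assumes det: "a * d - b * c = 1" and tr: "X_transforms a b c d"
  shows "X_transforms (a + k * c) (b + k * d) c d"
proof -
  obtain \<rho> :: "complex ^ 2 ^ 2" where \<rho>: "\<And>\<tau>. Im \<tau> > 0 \<Longrightarrow> X (int_moebius a b c d \<tau>) = \<rho> *v X \<tau>"
    using tr unfolding X_transforms_def by blast
  obtain R :: "complex ^ 2 ^ 2" where R: "\<And>\<tau>. X (\<tau> + of_int k) = R *v X \<tau>" using X_translation_int by blast
  have "X (int_moebius (a + k * c) (b + k * d) c d \<tau>) = (R ** \<rho>) *v X \<tau>" if \<tau>: "Im \<tau> > 0" for \<tau>
  proof -
    have "int_moebius (a + k * c) (b + k * d) c d \<tau> = int_moebius a b c d \<tau> + of_int k"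
      using int_moebius_upper_half_plane(1)[OF det \<tau>] by (simp add: int_moebius_def field_simps)
    then show ?thesis by (simp add: R \<rho>[OF \<tau>] matrix_vector_mul_assoc)
  qed
  then show ?thesis unfolding X_transforms_def by blast
qed

text \<open>Left multiplication by the lower unipotent matrix with entry 3 k: the value z becomes z
  / (3 k z + 1).\<close>

lemma X_transforms_add_row2:
  assumes det: "a * d - b * c = 1" and tr: "X_transforms a b c d"
  shows "X_transforms a b (c + 3 * k * a) (d + 3 * k * b)"
proof -
  obtain \<rho> :: "complex ^ 2 ^ 2" where \<rho>: "\<And>\<tau>. Im \<tau> > 0 \<Longrightarrow> X (int_moebius a b c d \<tau>) = \<rho> *v X \<tau>"
    using tr unfolding X_transforms_def by blast
  obtain R :: "complex ^ 2 ^ 2" where R: "\<And>\<tau>. Im \<tau> > 0 \<Longrightarrow> X (\<tau> / (of_int (3 * k) * \<tau> + 1)) = R *v X \<tau>"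
    using X_lower_unipotent by blast
  have "X (int_moebius a b (c + 3 * k * a) (d + 3 * k * b) \<tau>) = (R ** \<rho>) *v X \<tau>" if \<tau>: "Im \<tau> > 0" for \<tau>
  proof -
    note m = int_moebius_upper_half_plane[OF det \<tau>]
    define N D where "N = of_int a * \<tau> + of_int b" and "D = of_int c * \<tau> + of_int d"
    have "int_moebius a b (c + 3 * k * a) (d + 3 * k * b) \<tau> = N / (D + of_int (3 * k) * N)"
      by (simp add: int_moebius_def N_def D_def algebra_simps)
    also have "\<dots> = (N / D) / (of_int (3 * k) * (N / D) + 1)"
    proof -
      have "D \<noteq> 0" using m(1) by (simp add: D_def)
      then have "of_int (3 * k) * (N / D) + 1 = (D + of_int (3 * k) * N) / D" by (simp add: field_simps)
      then show ?thesis using \<open>D \<noteq> 0\<close> by simp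
    qed
    also have "N / D = int_moebius a b c d \<tau>" by (simp add: int_moebius_def N_def D_def)
    finally show ?thesis using R[OF m(2)] by (simp add: \<rho>[OF \<tau>] matrix_vector_mul_assoc)
  qed
  then show ?thesis unfolding X_transforms_def by blast
qed

text \<open>If the remainder exceeds |c| / 2 in size, subtracting c once more brings it below. The
  halved bound is what makes the descent contract despite the factor 3.\<close>

lemma ex_small_residue:
  fixes a c :: int
  assumes "c \<noteq> 0"
  shows "\<exists>k. 2 * \<bar>a + k * c\<bar> \<le> \<bar>c\<bar>"
proof -
  have m: "a mod c = a + (- (a div c)) * c" by (simp add: minus_div_mult_eq_mod[symmetric])
  show ?thesis
  proof (cases "2 * \<bar>a mod c\<bar> \<le> \<bar>c\<bar>")
    case True
    then show ?thesis unfolding m by blast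
  next
    case False
    have "2 * \<bar>a mod c - c\<bar> \<le> \<bar>c\<bar>"
    proof (cases "c > 0")
      case True
      then show ?thesis using False pos_mod_bound[OF True, of a] pos_mod_sign[OF True, of a] by (simp add: abs_if split: if_splits)
    next
      case neg: False
      then have "c < 0" using assms by simp
      then show ?thesis using False neg_mod_bound[OF \<open>c < 0\<close>, of a] neg_mod_sign[OF \<open>c < 0\<close>, of a] by (simp add: abs_if split: if_splits)
    qed
    moreover have "a mod c - c = a + (- (a div c) - 1) * c" unfolding m by (simp add: algebra_simps)
    ultimately show ?thesis by metis
  qed
qed

text \<open>Euclidean descent on the lower left entry \<open>c\<close>: reducing \<open>a\<close> modulo \<open>c\<close> and then \<open>c\<close>
  modulo \<open>3 * a\<close> leaves an entry of size at most \<open>3 / 4 * \<bar>c\<bar>\<close>.\<close>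

lemma X_transforms_Gamma0:
  assumes "a * d - b * c = 1" "3 dvd c"
  shows "X_transforms a b c d"
  using assms
proof (induction "nat \<bar>c\<bar>" arbitrary: a b c d rule: less_induct)
  case less
  show ?case
  proof (cases "c = 0")
    case True
    then have "a * d = 1" using less.prems by simp
    \<comment> \<open>The matrix is plus or minus a translation; since a = d is 1 or -1, the shift b
      / d equals a b.\<close>
    then have ad: "a = 1 \<and> d = 1 \<or> a = - 1 \<and> d = - 1" by (simp add: zmult_eq_1_iff)
    obtain R :: "complex ^ 2 ^ 2" where R: "\<And>\<tau>. X (\<tau> + of_int (a * b)) = R *v X \<tau>" using X_translation_int by blast
    have "int_moebius a b c d \<tau> = \<tau> + of_int (a * b)" for \<tau>
      using ad True by (auto simp: int_moebius_def)
    then show ?thesis unfolding X_transforms_def using R by auto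
  next
    case False
    obtain k where k: "2 * \<bar>a + k * c\<bar> \<le> \<bar>c\<bar>" using ex_small_residue[OF False] by blast
    define a' b' where "a' = a + k * c" and "b' = b + k * d"
    have det': "a' * d - b' * c = 1" using less.prems by (simp add: a'_def b'_def algebra_simps)
    \<comment> \<open>If a' were 0, the determinant would make c a unit, although 3 divides c. So
      reduction modulo 3 a' is possible.\<close>
    have "a' \<noteq> 0"
    proof
      assume "a' = 0"
      then have "c dvd 1" using det' by (metis dvd_minus_iff dvd_triv_right mult_zero_left diff_0)
      then have "3 dvd (1 :: int)" using less.prems(2) dvd_trans by blast
      then show False by simp
    qed
    then obtain j where j: "2 * \<bar>c + j * (3 * a')\<bar> \<le> \<bar>3 * a'\<bar>" using ex_small_residue[of "3 * a'" c] by auto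
    define c' d' where "c' = c + 3 * j * a'" and "d' = d + 3 * j * b'"
    have det'': "a' * d' - b' * c' = 1" using det' by (simp add: c'_def d'_def algebra_simps)
    have "x < z" if "2 * x \<le> 3 * y" "2 * y \<le> z" "0 < z" for x y z :: int
      using that by linarith
    moreover have "2 * \<bar>c'\<bar> \<le> 3 * \<bar>a'\<bar>" using j by (simp add: c'_def abs_mult mult_ac)
    moreover have "2 * \<bar>a'\<bar> \<le> \<bar>c\<bar>" using k by (simp only: a'_def)
    ultimately have "\<bar>c'\<bar> < \<bar>c\<bar>" using False by (metis zero_less_abs_iff)
    then have "nat \<bar>c'\<bar> < nat \<bar>c\<bar>" using False by simp
    moreover have "3 dvd c'" using less.prems(2) by (simp add: c'_def mult.assoc)
    ultimately have "X_transforms a' b' c' d'" using less.hyps det'' by blast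
    \<comment> \<open>The two reductions are undone in reverse order.\<close>
    from X_transforms_add_row2[OF det'' this, of "- j"] have "X_transforms a' b' c d"
      by (simp add: c'_def d'_def)
    from X_transforms_add_row1[OF det' this, of "- k"] show ?thesis
      by (simp add: a'_def b'_def)
  qed
qed

theorem theorem1p2:
  shows "(\<forall>\<tau>. Im \<tau> > 0 \<longrightarrow>
            X (\<tau> + 1) = (vector [vector [inverse (zeta 24), 0], vector [0, zeta 24 ^ 5]] :: complex ^ 2 ^ 2) *v X \<tau> \<and>
            X (- 1 / \<tau>) = ((1 / sqrt 2) *\<^sub>R (vector [vector [1, 1], vector [1, -1]] :: complex ^ 2 ^ 2)) *v X (\<tau> / 3))
         \<and> vv_modular_function 3 X"
proof (intro conjI allI impI)
  show "X (\<tau> + 1) = (vector [vector [inverse (zeta 24), 0], vector [0, zeta 24 ^ 5]] :: complex ^ 2 ^ 2) *v X \<tau>" for \<tau>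
    by (rule X_translation)
  show "X (- 1 / \<tau>) = inversion_matrix *v X (\<tau> / 3)" if "Im \<tau> > 0" for \<tau>
    by (rule X_inversion[OF that])
  show "vv_modular_function 3 X"
    unfolding vv_modular_function_def
  proof
    fix \<gamma> :: "int ^ 2 ^ 2" assume "\<gamma> \<in> Gamma0 3"
    then have "\<gamma> $ 1 $ 1 * \<gamma> $ 2 $ 2 - \<gamma> $ 1 $ 2 * \<gamma> $ 2 $ 1 = 1" "3 dvd \<gamma> $ 2 $ 1"
      by (simp_all add: Gamma0_def det_2)
    then have "X_transforms (\<gamma> $ 1 $ 1) (\<gamma> $ 1 $ 2) (\<gamma> $ 2 $ 1) (\<gamma> $ 2 $ 2)"
      by (rule X_transforms_Gamma0)
    then show "\<exists>\<rho> :: complex ^ 2 ^ 2. \<forall>\<tau>. Im \<tau> > 0 \<longrightarrow> X (moebius_act \<gamma> \<tau>) = \<rho> *v X \<tau>"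
      by (simp add: X_transforms_def int_moebius_def moebius_act_def moebius_def)
  qed
qed

end
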